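(* Let $F:\mathcal X\to\mathcal Y$ be a causal operator given by functions $f_t:\mathbb R^{nt}\times\Omega\to\mathbb R^m$, $t=1,\dots,T$, satisfying Assumption 1 (see context); for $t=1,\dots,T$ let $Y_t:\Omega\rightrightarrows\mathbb R^m$ and $X_t:\Omega\rightrightarrows\mathbb R^n$ be $\mathcal F_t$-measurable multifunctions with convex and closed values; and let $\varphi:\mathcal X\to\mathbb R$ be Lipschitz continuous. Suppose the system $$f_t(\zeta_{1:t-1},\xi,\omega)\in Y_t(\omega),\qquad \xi\in X_t(\omega)$$ admits complete subregular recourse (see context), and the policy $\hat x\in\mathcal X$ is a local minimum of the problem $$\min_{x\in\mathcal X}\ \varphi(x_1,\dots,x_T)\quad\text{s.t.}\quad F_t(x_{1:t})\in Y_t\ \text{a.s.},\quad x_t\in X_t\ \text{a.s.},\quad t=1,\dots,T.$$ Then there exist a subgradient $\hat g\in\partial\varphi(\hat x)$, multipliers $\hat\psi_t\in N_{Y_t}(F_t(\hat x_{1:t}))$, $t=1,\dots,T$, and normal elements $\hat n_t\in N_{X_t}(\hat x_t)$, $t=1,\dots,T$, such that for $P$-almost all $\omega\in\Omega$ $$\hat g_t+A_{t,t}^\top\hat\psi_t+\mathbb E_t\Big[\sum_{\ell=t+1}^T A_{\ell,t}^\top\hat\psi_\ell\Big]+\hat n_t=0,\qquad t=1,\dots,T.$$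
   Context: $(\Omega,\mathcal F,P)$ is a probability space with filtration $\{\emptyset,\Omega\}=\mathcal F_1\subset\dots\subset\mathcal F_T=\mathcal F$; $p\in[1,\infty)$, $1/p+1/q=1$. $\mathcal X_t=L_p(\Omega,\mathcal F_t,P;\mathbb R^n)$, $\mathcal Y_t=L_p(\Omega,\mathcal F_t,P;\mathbb R^m)$, $\mathcal X=\mathcal X_1\times\dots\times\mathcal X_T$, $\mathcal Y=\mathcal Y_1\times\dots\times\mathcal Y_T$, with the $L_p$ norms; duals $\mathcal X_t^*=L_q(\Omega,\mathcal F_t,P;\mathbb R^n)$, $\mathcal Y_t^*=L_q(\Omega,\mathcal F_t,P;\mathbb R^m)$, $\mathcal X^*=\prod_t\mathcal X_t^*$, with pairing $\langle y,x\rangle=\int y(\omega)^\top x(\omega)\,P(d\omega)$ (summed over $t$ for the products). $x_{1:t}=(x_1,\dots,x_t)$ and $\mathbb E_t[\cdot]=\mathbb E[\cdot\,|\,\mathcal F_t]$. $F:\mathcal X\to\mathcal Y$ is causal if $F=(F_1,\dots,F_T)$ with $F_t(x)(\omega)=f_t(x_{1:t}(\omega),\omega)$ for superpositionally measurable functions $f_t:\mathbb R^{nt}\times\Omega\to\mathbb R^m$; one also writes $F_t(x_{1:t})$. Assumption 1: for all $t$: (i) $f_t(\xi,\cdot)\in\mathcal Y_t$ for all $\xi\in\mathbb R^{nt}$; (ii) for almost all $\omega$, $f_t(\cdot,\omega)$ is continuously differentiable with Jacobian $f_t'(\cdot,\omega)$; (iii) there is a constant $C_f$ with $\|f_t'(\cdot,\omega)\|\le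 C_f$ almost surely. $A_{t,\ell}$ ($1\le\ell\le t\le T$) is the random matrix $A_{t,\ell}(\omega)=\dfrac{\partial f_t(\hat x_{1:t}(\omega),\omega)}{\partial x_\ell(\omega)}$, the partial Jacobian of $f_t(\cdot,\omega)$ with respect to its $\ell$-th $\mathbb R^n$-block, evaluated at $\hat x_{1:t}(\omega)$. The multifunctions are identified with the sets $Y_t=\{y\in\mathcal Y_t:y(\omega)\in Y_t(\omega)\text{ a.s.}\}$, $X_t=\{x\in\mathcal X_t:x(\omega)\in X_t(\omega)\text{ a.s.}\}$. Normal cones are taken in the function spaces: $N_{Y_t}(y)=\{\psi\in\mathcal Y_t^*:\langle\psi,z-y\rangle\le0\ \forall z\in Y_t\}$, $N_{X_t}(x)=\{\nu\in\mathcal X_t^*:\langle\nu,z-x\rangle\le0\ \forall z\in X_t\}$. $\partial\varphi(\hat x)\subset\mathcal X^*$ is the Clarke subdifferential. $\mathsf d$ is the distance to a set in a finite-dimensional space. Complete subregular recourse: there is a constant $C$ such that for every $t=1,\dots,T$, for almost all $\omega\in\Omega$, every $\zeta_{1:t-1}\in X_1(\omega)\times\dots\times X_{t-1}(\omega)$ and every $\eta\in\mathbb R^n$, there exists $\xi$ with $f_t(\zeta_{1:t-1},\xi,\omega)\in Y_t(\omega)$, $\xi\in X_t(\omega)$ and $$\|\xi-\eta\|\le C\big(\mathsf d(f_t(\zeta_{1:t-1},\eta,\omega),Y_t(\omega))+\mathsf d(\eta,X_t(\omega))\big).$$ (For $t=1$ the parameter $\zeta_{1:t-1}$ is absent.)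 *)

theory Defs
  imports "HOL-Probability.Probability"
begin

text \<open>
  The stages \<open>1, \<dots>, T\<close> are the elements of a type \<open>'t\<close> of class \<open>{finite, linorder}\<close>, with
  \<open>T = CARD('t)\<close>; the first stage is \<open>Min UNIV\<close> and the last is \<open>Max UNIV\<close>. A policy
  \<open>x = (x\<^sub>1, \<dots>, x\<^sub>T)\<close> is a function \<open>x :: 'a \<Rightarrow> real^'n^'t\<close>, so that \<open>x\<^sub>t(\<omega>)\<close> is \<open>x \<omega> $ t\<close>.
  A function on the product of the first \<open>t\<close> blocks is a function on \<open>real^'n^'t\<close> whose value depends
  on the blocks \<open>s \<le> t\<close> only; its derivative and the operator norm of its derivative do not change
  under this identification.

  Elements of \<open>L\<^sub>p\<close> spaces are represented by functions; equality of elements is equality almost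
  everywhere.
\<close>

section \<open>Lebesgue spaces\<close>

text \<open>The sub-sigma-algebra \<open>G\<close> governs measurability, \<open>M\<close> provides the measure.\<close>

definition lp_space ::
    "ennreal \<Rightarrow> 'a measure \<Rightarrow> 'a measure \<Rightarrow> ('a \<Rightarrow> 'b::euclidean_space) set" where
  "lp_space p M G = {x \<in> borel_measurable G.
     if p = \<infinity> then \<exists>C. AE \<omega> in M. norm (x \<omega>) \<le> C
     else integrable M (\<lambda>\<omega>. norm (x \<omega>) powr enn2real p)}"

definition lp_norm :: "real \<Rightarrow> 'a measure \<Rightarrow> ('a \<Rightarrow> 'b::euclidean_space) \<Rightarrow> real" where
  "lp_norm p M x = (\<integral>\<omega>. norm (x \<omega>) powr p \<partial>M) powr (1 / p)"

definition adapted_lp ::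
    "ennreal \<Rightarrow> 'a measure \<Rightarrow> ('t::finite \<Rightarrow> 'a measure) \<Rightarrow> ('a \<Rightarrow> ('b::euclidean_space)^'t) set" where
  "adapted_lp p M \<F> = {x. \<forall>t. (\<lambda>\<omega>. x \<omega> $ t) \<in> lp_space p M (\<F> t)}"

text \<open>On \<open>real^'n^'t\<close> the inner product is the sum over the blocks, so this is also the pairing on the
  product spaces.\<close>

definition pairing :: "'a measure \<Rightarrow> ('a \<Rightarrow> 'b::euclidean_space) \<Rightarrow> ('a \<Rightarrow> 'b) \<Rightarrow> real" where
  "pairing M y x = (\<integral>\<omega>. y \<omega> \<bullet> x \<omega> \<partial>M)"


section \<open>Measurable multifunctions and normal cones\<close>

definition measurable_multifunction ::
    "'a measure \<Rightarrow> ('a \<Rightarrow> 'b::euclidean_space set) \<Rightarrow> bool" where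
  "measurable_multifunction G Y \<longleftrightarrow>
     (\<forall>U. open U \<longrightarrow> {\<omega> \<in> space G. Y \<omega> \<inter> U \<noteq> {}} \<in> sets G)"

definition lp_selections ::
    "ennreal \<Rightarrow> 'a measure \<Rightarrow> 'a measure \<Rightarrow> ('a \<Rightarrow> 'b::euclidean_space set) \<Rightarrow> ('a \<Rightarrow> 'b) set" where
  "lp_selections p M G Y = {y \<in> lp_space p M G. AE \<omega> in M. y \<omega> \<in> Y \<omega>}"

definition normal_cone ::
    "ennreal \<Rightarrow> ennreal \<Rightarrow> 'a measure \<Rightarrow> 'a measure \<Rightarrow> ('a \<Rightarrow> 'b::euclidean_space set)
      \<Rightarrow> ('a \<Rightarrow> 'b) \<Rightarrow> ('a \<Rightarrow> 'b) set" where
  "normal_cone p q M G Y y =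
     {\<psi> \<in> lp_space q M G. \<forall>z \<in> lp_selections p M G Y. pairing M \<psi> (\<lambda>\<omega>. z \<omega> - y \<omega>) \<le> 0}"


section \<open>Clarke subdifferential\<close>

definition lp_lipschitz ::
    "real \<Rightarrow> 'a measure \<Rightarrow> ('t::finite \<Rightarrow> 'a measure)
      \<Rightarrow> (('a \<Rightarrow> ('b::euclidean_space)^'t) \<Rightarrow> real) \<Rightarrow> bool" where
  "lp_lipschitz p M \<F> \<phi> \<longleftrightarrow>
     (\<exists>L. \<forall>x \<in> adapted_lp (ennreal p) M \<F>. \<forall>y \<in> adapted_lp (ennreal p) M \<F>.
        \<bar>\<phi> x - \<phi> y\<bar> \<le> L * lp_norm p M (\<lambda>\<omega>. x \<omega> - y \<omega>))"

text \<open>The upper limit of the difference quotients for \<open>y \<rightarrow> x\<close> in the norm and \<open>\<tau> \<down> 0\<close>.\<close>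

definition clarke_derivative ::
    "real \<Rightarrow> 'a measure \<Rightarrow> ('t::finite \<Rightarrow> 'a measure)
      \<Rightarrow> (('a \<Rightarrow> ('b::euclidean_space)^'t) \<Rightarrow> real)
      \<Rightarrow> ('a \<Rightarrow> 'b^'t) \<Rightarrow> ('a \<Rightarrow> 'b^'t) \<Rightarrow> ereal" where
  "clarke_derivative p M \<F> \<phi> x d =
     (INF \<epsilon> \<in> {0::real<..}.
        SUP (y, \<tau>) \<in> {(y, \<tau>). y \<in> adapted_lp (ennreal p) M \<F> \<and>
              lp_norm p M (\<lambda>\<omega>. y \<omega> - x \<omega>) < \<epsilon> \<and> 0 < \<tau> \<and> \<tau> < \<epsilon>}.
          ereal ((\<phi> (\<lambda>\<omega>. y \<omega> + \<tau> *\<^sub>R d \<omega>) - \<phi> y) / \<tau>))"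

definition clarke_subdifferential ::
    "real \<Rightarrow> ennreal \<Rightarrow> 'a measure \<Rightarrow> ('t::finite \<Rightarrow> 'a measure)
      \<Rightarrow> (('a \<Rightarrow> ('b::euclidean_space)^'t) \<Rightarrow> real)
      \<Rightarrow> ('a \<Rightarrow> 'b^'t) \<Rightarrow> ('a \<Rightarrow> 'b^'t) set" where
  "clarke_subdifferential p q M \<F> \<phi> x =
     {g \<in> adapted_lp q M \<F>. \<forall>d \<in> adapted_lp (ennreal p) M \<F>.
        ereal (pairing M g d) \<le> clarke_derivative p M \<F> \<phi> x d}"


section \<open>Causal operators\<close>

definition superpositionally_measurable ::
    "'a measure \<Rightarrow> ('c::euclidean_space \<Rightarrow> 'a \<Rightarrow> 'b::euclidean_space) \<Rightarrow> bool" where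
  "superpositionally_measurable G h \<longleftrightarrow>
     (\<forall>x \<in> borel_measurable G. (\<lambda>\<omega>. h (x \<omega>) \<omega>) \<in> borel_measurable G)"

definition causal_operator ::
    "ennreal \<Rightarrow> 'a measure \<Rightarrow> ('t::{finite,linorder} \<Rightarrow> 'a measure)
      \<Rightarrow> ('t \<Rightarrow> (real^'n, 't) vec \<Rightarrow> 'a \<Rightarrow> real^'m)
      \<Rightarrow> (('a \<Rightarrow> (real^'n, 't) vec) \<Rightarrow> ('a \<Rightarrow> (real^'m, 't) vec)) \<Rightarrow> bool" where
  "causal_operator p M \<F> f F \<longleftrightarrow>
     (\<forall>t. superpositionally_measurable (\<F> t) (f t)) \<and>
     (\<forall>t. \<forall>\<omega> \<in> space M. \<forall>\<xi> \<xi>'. (\<forall>s\<le>t. \<xi> $ s = \<xi>' $ s) \<longrightarrow> f t \<xi> \<omega> = f t \<xi>' \<omega>) \<and>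
     (\<forall>x \<in> adapted_lp p M \<F>. F x \<in> adapted_lp p M \<F> \<and>
        (\<forall>t. AE \<omega> in M. F x \<omega> $ t = f t (x \<omega>) \<omega>))"

definition smooth_bounded_jacobian ::
    "ennreal \<Rightarrow> 'a measure \<Rightarrow> ('t::{finite,linorder} \<Rightarrow> 'a measure)
      \<Rightarrow> ('t \<Rightarrow> (real^'n, 't) vec \<Rightarrow> 'a \<Rightarrow> real^'m)
      \<Rightarrow> ('t \<Rightarrow> (real^'n, 't) vec \<Rightarrow> 'a \<Rightarrow> (real^'n, 't) vec \<Rightarrow>\<^sub>L (real^'m)) \<Rightarrow> bool" where
  "smooth_bounded_jacobian p M \<F> f f' \<longleftrightarrow> (\<forall>t.
     (\<forall>\<xi>. f t \<xi> \<in> lp_space p M (\<F> t)) \<and>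
     (AE \<omega> in M.
        (\<forall>\<xi>. ((\<lambda>\<xi>. f t \<xi> \<omega>) has_derivative blinfun_apply (f' t \<xi> \<omega>)) (at \<xi>)) \<and>
        continuous_on UNIV (\<lambda>\<xi>. f' t \<xi> \<omega>)) \<and>
     (\<exists>C. AE \<omega> in M. \<forall>\<xi>. norm (f' t \<xi> \<omega>) \<le> C))"

definition block_upd :: "'b^'t \<Rightarrow> 't \<Rightarrow> 'b \<Rightarrow> 'b^('t::finite)" where
  "block_upd \<zeta> t \<xi> = (\<chi> s. if s = t then \<xi> else \<zeta> $ s)"

definition partial_jacobian ::
    "('t::{finite,linorder} \<Rightarrow> (real^'n, 't) vec \<Rightarrow> 'a \<Rightarrow> real^'m)
      \<Rightarrow> ('a \<Rightarrow> (real^'n, 't) vec) \<Rightarrow> 't \<Rightarrow> 't \<Rightarrow> 'a \<Rightarrow> real^'n^'m" where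
  "partial_jacobian f x t l \<omega> = jacobian (\<lambda>u. f t (block_upd (x \<omega>) l u) \<omega>) (at (x \<omega> $ l))"

text \<open>For stage \<open>t\<close>, the blocks of \<open>\<zeta>\<close> from \<open>t\<close> onwards are irrelevant: block \<open>t\<close> is overwritten, and
  \<open>f t\<close> does not depend on the later ones.\<close>

definition complete_subregular_recourse ::
    "'a measure \<Rightarrow> ('t::{finite,linorder} \<Rightarrow> (real^'n, 't) vec \<Rightarrow> 'a \<Rightarrow> real^'m)
      \<Rightarrow> ('t \<Rightarrow> 'a \<Rightarrow> (real^'m) set) \<Rightarrow> ('t \<Rightarrow> 'a \<Rightarrow> (real^'n) set) \<Rightarrow> bool" where
  "complete_subregular_recourse M f Y X \<longleftrightarrow>
     (\<exists>C. \<forall>t. AE \<omega> in M. \<forall>\<zeta>. (\<forall>s<t. \<zeta> $ s \<in> X s \<omega>) \<longrightarrow>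
        (\<forall>\<eta>. \<exists>\<xi>. f t (block_upd \<zeta> t \<xi>) \<omega> \<in> Y t \<omega> \<and> \<xi> \<in> X t \<omega> \<and>
           norm (\<xi> - \<eta>) \<le> C * (infdist (f t (block_upd \<zeta> t \<eta>) \<omega>) (Y t \<omega>) + infdist \<eta> (X t \<omega>))))"


section \<open>The optimization problem\<close>

definition feasible_policies ::
    "ennreal \<Rightarrow> 'a measure \<Rightarrow> ('t::finite \<Rightarrow> 'a measure)
      \<Rightarrow> (('a \<Rightarrow> (real^'n, 't) vec) \<Rightarrow> ('a \<Rightarrow> (real^'m, 't) vec))
      \<Rightarrow> ('t \<Rightarrow> 'a \<Rightarrow> (real^'m) set) \<Rightarrow> ('t \<Rightarrow> 'a \<Rightarrow> (real^'n) set) \<Rightarrow> ('a \<Rightarrow> (real^'n, 't) vec) set" where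
  "feasible_policies p M \<F> F Y X = {x \<in> adapted_lp p M \<F>.
     \<forall>t. (AE \<omega> in M. F x \<omega> $ t \<in> Y t \<omega>) \<and> (AE \<omega> in M. x \<omega> $ t \<in> X t \<omega>)}"

definition lp_local_minimum ::
    "real \<Rightarrow> 'a measure \<Rightarrow> (('a \<Rightarrow> 'b::euclidean_space) \<Rightarrow> real)
      \<Rightarrow> ('a \<Rightarrow> 'b) set \<Rightarrow> ('a \<Rightarrow> 'b) \<Rightarrow> bool" where
  "lp_local_minimum p M \<phi> S x \<longleftrightarrow> x \<in> S \<and>
     (\<exists>\<epsilon>>0. \<forall>y \<in> S. lp_norm p M (\<lambda>\<omega>. y \<omega> - x \<omega>) < \<epsilon> \<longrightarrow> \<phi> x \<le> \<phi> y)"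

text \<open>Partial Jacobians of \<open>f t\<close> exist only almost surely, so expressions containing them are
  measurable only after a change on a null set, whereas \<^const>\<open>real_cond_exp\<close> needs an integrand
  measurable for the ambient measure. Hence the completion; for integrands measurable with respect
  to \<open>M\<close> it changes the conditional expectation on null sets only.\<close>

definition vec_cond_exp ::
    "'a measure \<Rightarrow> 'a measure \<Rightarrow> ('a \<Rightarrow> real^'n) \<Rightarrow> 'a \<Rightarrow> real^'n" where
  "vec_cond_exp M G v \<omega> = (\<chi> i. real_cond_exp (completion M) G (\<lambda>\<omega>. v \<omega> $ i) \<omega>)"

end

theory Submission
  imports Defs "HOL-Library.Function_Algebras"
begin

text \<open>
  The constraints are removed by exact penalization, the penalized problem is linearized, and the
  multipliers come from one application of the Hahn-Banach theorem in a product of Lebesgue spaces.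

  Recourse makes penalization exact. A policy near \<open>xh\<close> that violates the constraints is repaired
  stage by stage: at each stage recourse offers a nearby feasible decision, which causality prevents
  from disturbing the earlier stages, and the Lipschitz continuity of the \<open>f t\<close> keeps the accumulated
  correction proportional to the original violation. The correction at stage \<open>t\<close> must be observable at
  \<open>t\<close>, so it is chosen measurably, as a zero of a nonnegative function that is measurable in
  \<open>\<omega>\<close> and continuous in the decision (\<open>measurable_zero_selection\<close>). The outcome is the global
  error bound \<open>feasible_error_bound\<close>.

  Let \<open>A d\<close> be the linearization of the operator at \<open>xh\<close> in the direction \<open>d\<close>, let \<open>y\<close> and \<open>v\<close> be
  directions from \<open>F xh\<close> and \<open>xh\<close> into the constraint sets, and compare \<open>xh + \<tau> d\<close> with the points
  \<open>F xh + \<tau> y\<close> and \<open>xh + \<tau> v\<close>. Since \<open>\<phi>\<close> is Lipschitz continuous, local minimality and the error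
  bound give, as \<open>\<tau>\<close> tends to 0,
  \<open>0 \<le> \<phi>\<degree>(xh; d) + N (\<Sum>\<^sub>t \<parallel>A\<^sub>t d - y\<^sub>t\<parallel> + \<parallel>d\<^sub>t - v\<^sub>t\<parallel>)\<close>
  with the Clarke derivative \<open>\<phi>\<degree>\<close> (\<open>penalized_optimality\<close>). The right-hand side is a sublinear functional
  of \<open>(d, A d - y, d - v)\<close>, and these triples form a convex cone. A linear functional \<open>(g, \<psi>, \<nu>)\<close> below
  the sublinear one and nonnegative on the cone (\<open>hahn_banach_cone\<close>) has all the required properties
  (\<open>multiplier_rule\<close>): domination of \<open>g\<close> by \<open>\<phi>\<degree>\<close> makes it a Clarke subgradient; the triples with \<open>d = 0\<close>
  make \<open>\<psi>\<close> and \<open>\<nu>\<close> normal; the triples \<open>(d, A d, d)\<close> form a subspace, so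
  \<open>g d + \<psi> (A d) + \<nu> d = 0\<close>.

  All three functionals are bounded, hence given by functions in the dual Lebesgue space over the
  information of each stage (\<open>Lp_functional_representation\<close>). The last identity, tested with
  directions at stage \<open>t\<close>, is the adjoint equation; the conditional expectation appears because
  such directions see the later terms \<open>A\<^sub>l\<^sub>,\<^sub>t\<^sup>T \<psi>\<^sub>l\<close> only through the information of stage \<open>t\<close>
  (\<open>adjoint_equation\<close>).
\<close>

section \<open>The Hahn-Banach theorem for sublinear functionals and cones\<close>

text \<open>With the pointwise operations the set of all functions is a vector space, and Lebesgue spaces
  and their products become subspaces of one type each.\<close>

instantiation "fun" :: (type, real_vector) real_vector
begin

definition scaleR_fun_def: "c *\<^sub>R f = (\<lambda>x. c *\<^sub>R f x)"

instance
  by standard (auto simp: scaleR_fun_def fun_eq_iff scaleR_add_left scaleR_add_right)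

end

lemma sum_fun_apply: "(\<Sum>i\<in>I. g i) x = (\<Sum>i\<in>I. g i x)"
  by (induction I rule: infinite_finite_induct) auto

text \<open>Both notions are relative to a carrier \<open>W\<close>, since the functionals of interest are meaningful on
  Lebesgue spaces only and not on the surrounding type.\<close>

definition sublinear_on :: "'v::real_vector set \<Rightarrow> ('v \<Rightarrow> real) \<Rightarrow> bool" where
  "sublinear_on W s \<longleftrightarrow>
     (\<forall>x\<in>W. \<forall>y\<in>W. s (x + y) \<le> s x + s y) \<and> (\<forall>x\<in>W. \<forall>c>0. s (c *\<^sub>R x) = c * s x)"

definition linear_functional_on :: "'v::real_vector set \<Rightarrow> ('v \<Rightarrow> real) \<Rightarrow> bool" where
  "linear_functional_on W f \<longleftrightarrow>
     (\<forall>x\<in>W. \<forall>y\<in>W. f (x + y) = f x + f y) \<and> (\<forall>x\<in>W. \<forall>c. f (c *\<^sub>R x) = c * f x)"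

lemma sublinear_on_add: "sublinear_on W s \<Longrightarrow> x \<in> W \<Longrightarrow> y \<in> W \<Longrightarrow> s (x + y) \<le> s x + s y"
  by (simp add: sublinear_on_def)

lemma sublinear_on_scale: "sublinear_on W s \<Longrightarrow> x \<in> W \<Longrightarrow> c > 0 \<Longrightarrow> s (c *\<^sub>R x) = c * s x"
  by (simp add: sublinear_on_def)

lemma sublinear_on_zero:
  assumes "sublinear_on W s" "subspace W" shows "s 0 = 0"
  using sublinear_on_scale[OF assms(1), of 0 2] assms(2) by (auto simp: subspace_0)

lemma sublinear_on_neg:
  assumes "sublinear_on W s" "subspace W" "x \<in> W" shows "- s (- x) \<le> s x"
  using sublinear_on_add[OF assms(1,3), of "-x"] sublinear_on_zero[OF assms(1,2)]
    subspace_neg[OF assms(2,3)] by simp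

lemma linear_functional_on_add:
  "linear_functional_on W f \<Longrightarrow> x \<in> W \<Longrightarrow> y \<in> W \<Longrightarrow> f (x + y) = f x + f y"
  by (simp add: linear_functional_on_def)

lemma linear_functional_on_scale:
  "linear_functional_on W f \<Longrightarrow> x \<in> W \<Longrightarrow> f (c *\<^sub>R x) = c * f x"
  by (simp add: linear_functional_on_def)

lemma linear_functional_on_zero:
  "linear_functional_on W f \<Longrightarrow> subspace W \<Longrightarrow> f 0 = 0"
  using linear_functional_on_scale[of W f 0 0] by (simp add: subspace_0)

lemma linear_functional_on_neg:
  "linear_functional_on W f \<Longrightarrow> x \<in> W \<Longrightarrow> f (- x) = - f x"
  using linear_functional_on_scale[of W f x "-1"] by simp

lemma linear_functional_on_diff:
  "linear_functional_on W f \<Longrightarrow> subspace W \<Longrightarrow> x \<in> W \<Longrightarrow> y \<in> W \<Longrightarrow> f (x - y) = f x - f y"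
  using linear_functional_on_add[of W f x "-y"] linear_functional_on_neg[of W f y]
    subspace_neg[of W y] by simp

lemma linear_functional_on_sum:
  assumes "linear_functional_on W f" "subspace W" "\<And>i. i \<in> I \<Longrightarrow> x i \<in> W"
  shows "f (\<Sum>i\<in>I. x i) = (\<Sum>i\<in>I. f (x i))"
  using assms(3)
proof (induction I rule: infinite_finite_induct)
  case (insert i I)
  have "(\<Sum>i\<in>I. x i) \<in> W" using insert.prems by (intro subspace_sum[OF assms(2)]) blast
  then show ?case using insert linear_functional_on_add[OF assms(1)] by auto
qed (simp_all add: linear_functional_on_zero[OF assms(1,2)])

text \<open>The infimal convolution of \<open>s\<close> with a cone \<open>N\<close> of pairs \<open>(l, a)\<close> is the largest sublinear
  functional below \<open>s\<close> with \<open>r (- l) \<le> - a\<close> on \<open>N\<close>; it is finite because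
  \<open>s (x + l) - a \<ge> s (x + l) - s l \<ge> - s (- x)\<close>. Taking \<open>a = 0\<close> forces a sign on a cone of vectors, and
  taking the ray through a point of the graph will show that minimal functionals are odd.\<close>

lemma sublinear_minorant:
  fixes s :: "'v::real_vector \<Rightarrow> real"
  assumes s: "sublinear_on W s" and W: "subspace W"
    and N0: "(0, 0) \<in> N"
    and Nadd: "\<And>u v. u \<in> N \<Longrightarrow> v \<in> N \<Longrightarrow> u + v \<in> N"
    and Nscale: "\<And>u c. u \<in> N \<Longrightarrow> c > 0 \<Longrightarrow> c *\<^sub>R u \<in> N"
    and NW: "\<And>l a. (l, a) \<in> N \<Longrightarrow> l \<in> W \<and> a \<le> s l"
  obtains r where "sublinear_on W r" "\<And>x. x \<in> W \<Longrightarrow> r x \<le> s x"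
    "\<And>l a. (l, a) \<in> N \<Longrightarrow> r (- l) \<le> - a" "\<And>x. x \<notin> W \<Longrightarrow> r x = 0"
proof -
  define r where "r x = (if x \<in> W then INF (l,a)\<in>N. s (x + l) - a else 0)" for x
  have low: "- s (- x) \<le> s (x + l) - a" if "x \<in> W" "(l,a) \<in> N" for x l a
    using sublinear_on_add[OF s, of "x + l" "- x"] NW[OF that(2)] that W
    by (fastforce intro: subspace_add subspace_neg)
  have bdd: "bdd_below ((\<lambda>(l,a). s (x + l) - a) ` N)" if "x \<in> W" for x
    using low[OF that] by (intro bdd_belowI2[of _ "- s (- x)"]) auto
  have le: "r x \<le> s (x + l) - a" if "x \<in> W" "(l,a) \<in> N" for x l a
    unfolding r_def using cINF_lower[OF bdd[OF that(1)] that(2)] that(1) by simp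
  have ge: "c \<le> r x" if "x \<in> W" "\<And>l a. (l,a) \<in> N \<Longrightarrow> c \<le> s (x + l) - a" for x c
    unfolding r_def using that N0 by (auto intro!: cINF_greatest)
  have scale1: "c * r x \<le> r (c *\<^sub>R x)" if "x \<in> W" "c > 0" for x c
  proof (rule ge)
    fix l a assume la: "(l,a) \<in> N"
    have "r x \<le> s (x + inverse c *\<^sub>R l) - inverse c * a"
      using Nscale[OF la, of "inverse c"] that by (intro le) auto
    then have "c * r x \<le> c * s (x + inverse c *\<^sub>R l) - a"
      using that by (simp add: field_simps)
    also have "c * s (x + inverse c *\<^sub>R l) = s (c *\<^sub>R (x + inverse c *\<^sub>R l))"
      using sublinear_on_scale[OF s, of "x + inverse c *\<^sub>R l" c] that NW[OF la] W
      by (simp add: subspace_add subspace_scale)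
    finally show "c * r x \<le> s (c *\<^sub>R x + l) - a" using that by (simp add: scaleR_add_right)
  qed (use that W in \<open>auto intro: subspace_scale\<close>)
  have "sublinear_on W r"
    unfolding sublinear_on_def
  proof (intro conjI ballI allI impI)
    fix x y assume xy: "x \<in> W" "y \<in> W"
    have "r (x + y) - (s (y + l') - a') \<le> r x" if l': "(l',a') \<in> N" for l' a'
    proof (rule ge[OF xy(1)])
      fix l a assume la: "(l,a) \<in> N"
      have "r (x + y) \<le> s ((x + y) + (l + l')) - (a + a')"
        using Nadd[OF la l'] xy W by (intro le) (auto intro: subspace_add)
      also have "s ((x + y) + (l + l')) \<le> s (x + l) + s (y + l')"
        using sublinear_on_add[OF s, of "x + l" "y + l'"] xy NW[OF la] NW[OF l'] W
        by (simp add: subspace_add add_ac)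
      finally show "r (x + y) - (s (y + l') - a') \<le> s (x + l) - a" by simp
    qed
    then have "r (x + y) - r x \<le> r y" by (intro ge xy) (force simp: algebra_simps)
    then show "r (x + y) \<le> r x + r y" by simp
  next
    fix x and c :: real assume x: "x \<in> W" "0 < c"
    have "inverse c * r (c *\<^sub>R x) \<le> r x"
      using scale1[of "c *\<^sub>R x" "inverse c"] x W by (simp add: subspace_scale)
    then have "r (c *\<^sub>R x) \<le> c * r x" using x by (simp add: field_simps)
    with scale1[OF x] show "r (c *\<^sub>R x) = c * r x" by simp
  qed
  moreover have "r x \<le> s x" if "x \<in> W" for x using le[OF that N0] by simp
  moreover have "r (- l) \<le> - a" if "(l, a) \<in> N" for l a
    using le[OF _ that, of "- l"] NW[OF that] W sublinear_on_zero[OF s W] by (simp add: subspace_neg)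
  moreover have "r x = 0" if "x \<notin> W" for x using that by (simp add: r_def)
  ultimately show ?thesis using that by blast
qed

text \<open>Zorn's lemma applies to the sublinear functionals below \<open>s\<close>: along a chain the pointwise infimum
  is bounded below by \<open>- s (- x)\<close>, and it is subadditive because any two members of a chain are
  comparable, so that one member serves both summands.\<close>

lemma minimal_sublinear_exists:
  fixes s :: "'v::real_vector \<Rightarrow> real"
  assumes s: "sublinear_on W s" and W: "subspace W"
  obtains m where "sublinear_on W m" "\<And>x. x \<in> W \<Longrightarrow> m x \<le> s x"
    "\<And>k x. sublinear_on W k \<Longrightarrow> (\<And>x. x \<in> W \<Longrightarrow> k x \<le> m x) \<Longrightarrow> x \<in> W \<Longrightarrow> k x = m x"
proof -
  \<comment> \<open>Vanishing outside \<open>W\<close> makes functionals that agree on \<open>W\<close> equal, as antisymmetry requires.\<close>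
  define A where "A = {r. sublinear_on W r \<and> (\<forall>x\<in>W. r x \<le> s x) \<and> (\<forall>x. x \<notin> W \<longrightarrow> r x = 0)}"
  define P :: "('v \<Rightarrow> real) \<Rightarrow> ('v \<Rightarrow> real) \<Rightarrow> bool" where "P = (\<lambda>a b. \<forall>x. b x \<le> a x)"
  have po: "partial_order_on A (relation_of P A)"
    by (rule partial_order_on_relation_ofI) (auto simp: P_def fun_eq_iff intro: order_trans antisym)
  have s0: "(\<lambda>x. if x \<in> W then s x else 0) \<in> A"
    using s W by (auto simp: A_def sublinear_on_def subspace_add subspace_scale)
  have ch: "\<exists>u\<in>A. \<forall>a\<in>C. P a u" if C: "C \<in> Chains (relation_of P A)" for C
  proof (cases "C = {}")
    case True then show ?thesis using s0 by auto
  next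
    case False
    have CA: "C \<subseteq> A" by (rule Chains_relation_of[OF C])
    have comp: "(\<forall>x. a x \<le> b x) \<or> (\<forall>x. b x \<le> a x)" if "a \<in> C" "b \<in> C" for a b
      using C that unfolding Chains_def relation_of_def P_def by blast
    define u where "u x = (INF a\<in>C. a x)" for x
    have low: "min 0 (- s (- x)) \<le> a x" if "a \<in> C" for a x
    proof (cases "x \<in> W")
      case True
      have "a (- x) \<le> s (- x)" "sublinear_on W a"
        using that CA True W by (auto simp: A_def subspace_neg)
      then show ?thesis using sublinear_on_neg[of W a x] W True by auto
    qed (use that CA in \<open>auto simp: A_def\<close>)
    have le: "u x \<le> a x" if "a \<in> C" for a x
      unfolding u_def using low by (intro cINF_lower that bdd_belowI2[of _ "min 0 (- s (- x))"]) auto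
    have ge: "c \<le> u x" if "\<And>a. a \<in> C \<Longrightarrow> c \<le> a x" for c x
      unfolding u_def using that False by (intro cINF_greatest) auto
    have "sublinear_on W u"
      unfolding sublinear_on_def
    proof (intro conjI ballI allI impI)
      fix x y assume xy: "x \<in> W" "y \<in> W"
      have *: "u (x + y) \<le> a x + b y" if ab: "a \<in> C" "b \<in> C" for a b
      proof -
        from comp[OF ab] obtain c where c: "c \<in> C" "c x \<le> a x" "c y \<le> b y"
          using ab by blast
        have "c (x + y) \<le> c x + c y" using c(1) CA xy by (auto simp: A_def sublinear_on_def)
        then show ?thesis using le[OF c(1), of "x + y"] c by simp
      qed
      have "u (x + y) - b y \<le> u x" if "b \<in> C" for b
        using *[OF _ that] by (intro ge) (auto simp: algebra_simps)
      then have "u (x + y) - u x \<le> u y" by (intro ge) (auto simp: algebra_simps)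
      then show "u (x + y) \<le> u x + u y" by simp
    next
      fix x and c :: real assume x: "x \<in> W" "0 < c"
      have hom: "a (c *\<^sub>R x) = c * a x" if "a \<in> C" for a
        using that CA x by (auto simp: A_def sublinear_on_def)
      have "inverse c * u (c *\<^sub>R x) \<le> u x"
      proof (rule ge)
        fix a assume "a \<in> C"
        then have "u (c *\<^sub>R x) \<le> c * a x" using le hom by metis
        then show "inverse c * u (c *\<^sub>R x) \<le> a x" using x by (simp add: field_simps)
      qed
      moreover have "c * u x \<le> u (c *\<^sub>R x)"
        using x by (intro ge) (simp add: hom le mult_left_mono)
      ultimately show "u (c *\<^sub>R x) = c * u x" using x by (simp add: field_simps)
    qed
    moreover obtain a where a: "a \<in> C" using False by auto
    moreover have "\<forall>x\<in>W. u x \<le> s x"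
    proof
      fix x assume "x \<in> W"
      then have "a x \<le> s x" using a CA by (auto simp: A_def)
      then show "u x \<le> s x" using le[OF a, of x] by simp
    qed
    moreover have "u x = 0" if "x \<notin> W" for x
    proof (rule antisym)
      show "u x \<le> 0" using le[OF a, of x] a CA that by (auto simp: A_def)
      show "0 \<le> u x" using CA that by (intro ge) (auto simp: A_def)
    qed
    ultimately have "u \<in> A" by (auto simp: A_def)
    then show ?thesis using le by (auto simp: P_def)
  qed
  from predicate_Zorn[OF po ch] obtain m where m: "m \<in> A" "\<And>a. a \<in> A \<Longrightarrow> P m a \<Longrightarrow> a = m" by blast
  show ?thesis
  proof (rule that[of m])
    show "sublinear_on W m" "\<And>x. x \<in> W \<Longrightarrow> m x \<le> s x" using m(1) by (auto simp: A_def)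
    fix r x assume r: "sublinear_on W r" "\<And>x. x \<in> W \<Longrightarrow> r x \<le> m x" and x: "x \<in> W"
    define r' where "r' x = (if x \<in> W then r x else 0)" for x
    have "sublinear_on W r'"
      using r(1) W by (auto simp: r'_def sublinear_on_def subspace_add subspace_scale)
    moreover have "r' y \<le> s y" if "y \<in> W" for y
    proof -
      have "m y \<le> s y" using m(1) that by (auto simp: A_def)
      then show ?thesis using r(2)[OF that] that by (simp add: r'_def)
    qed
    ultimately have "r' \<in> A" by (auto simp: A_def r'_def)
    moreover have "P m r'" using r m(1) by (auto simp: P_def r'_def A_def)
    ultimately have "r' = m" by (rule m(2))
    then have "r' x = m x" by simp
    then show "r x = m x" using x by (simp add: r'_def)
  qed
qed

text \<open>The Hahn-Banach theorem in sandwich form. First lower \<open>s\<close> so that it becomes nonpositive on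
  \<open>- L\<close>; every sublinear minorant of the result then inherits this sign. A minimal minorant is odd,
  and an odd sublinear functional is linear.\<close>

theorem hahn_banach_cone:
  fixes s :: "'v::real_vector \<Rightarrow> real"
  assumes s: "sublinear_on W s" and W: "subspace W"
    and L: "L \<subseteq> W" "0 \<in> L" "\<And>x y. x \<in> L \<Longrightarrow> y \<in> L \<Longrightarrow> x + y \<in> L"
      "\<And>x c. x \<in> L \<Longrightarrow> c > 0 \<Longrightarrow> c *\<^sub>R x \<in> L"
    and pos: "\<And>x. x \<in> L \<Longrightarrow> 0 \<le> s x"
  obtains f where "linear_functional_on W f" "\<And>x. x \<in> W \<Longrightarrow> f x \<le> s x" "\<And>x. x \<in> L \<Longrightarrow> 0 \<le> f x"
proof -
  obtain r where r: "sublinear_on W r" "\<And>x. x \<in> W \<Longrightarrow> r x \<le> s x" "\<And>l. l \<in> L \<Longrightarrow> r (- l) \<le> 0"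
    by (rule sublinear_minorant[OF s W, of "L \<times> {0}"]) (use L pos in \<open>auto simp: zero_prod_def\<close>)
  obtain m where m: "sublinear_on W m" "\<And>x. x \<in> W \<Longrightarrow> m x \<le> r x"
    "\<And>k x. sublinear_on W k \<Longrightarrow> (\<And>x. x \<in> W \<Longrightarrow> k x \<le> m x) \<Longrightarrow> x \<in> W \<Longrightarrow> k x = m x"
    by (rule minimal_sublinear_exists[OF r(1) W]) blast
  have neg: "m (- y) = - m y" if y: "y \<in> W" for y
  proof -
    \<comment> \<open>Lowering \<^term>\<open>m\<close> along the ray through \<open>(y, m y)\<close> changes nothing, by minimality.\<close>
    define N where "N = (\<lambda>t. (t *\<^sub>R y, t * m y)) ` {0..}"
    obtain r' where r': "sublinear_on W r'" "\<And>x. x \<in> W \<Longrightarrow> r' x \<le> m x"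
      "\<And>l a. (l, a) \<in> N \<Longrightarrow> r' (- l) \<le> - a"
    proof (rule sublinear_minorant[OF m(1) W, of N])
      show "(0, 0) \<in> N" by (auto simp: N_def image_iff intro!: bexI[of _ 0])
      show "u + v \<in> N" if "u \<in> N" "v \<in> N" for u v
        using that unfolding N_def
        by (auto simp: image_iff scaleR_add_left[symmetric] distrib_right[symmetric] intro: add_nonneg_nonneg)
      show "c *\<^sub>R u \<in> N" if "u \<in> N" "c > 0" for u and c :: real
        using that unfolding N_def by (auto simp: image_iff intro!: bexI[of _ "c * _"])
      show "l \<in> W \<and> a \<le> m l" if la: "(l, a) \<in> N" for l a
      proof -
        obtain t where t: "t \<ge> 0" "l = t *\<^sub>R y" "a = t * m y" using la by (auto simp: N_def)
        then show ?thesis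
          using y W sublinear_on_scale[OF m(1) y, of t] sublinear_on_zero[OF m(1) W]
          by (cases "t = 0") (auto simp: subspace_scale subspace_0)
      qed
    qed blast
    have "(y, m y) \<in> N" by (auto simp: N_def image_iff intro!: bexI[of _ 1])
    then have "m (- y) \<le> - m y" using r'(3) m(3)[OF r'(1,2)] y W by (metis subspace_neg)
    then show ?thesis using sublinear_on_neg[OF m(1) W y] by simp
  qed
  have "linear_functional_on W m"
    unfolding linear_functional_on_def
  proof (intro conjI ballI allI)
    fix x y assume xy: "x \<in> W" "y \<in> W"
    have "m ((x + y) + (- y)) \<le> m (x + y) + m (- y)"
      using xy W by (intro sublinear_on_add[OF m(1)]) (auto intro: subspace_add subspace_neg)
    then show "m (x + y) = m x + m y"
      using neg[OF xy(2)] sublinear_on_add[OF m(1) xy] by simp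
  next
    fix x and c :: real assume x: "x \<in> W"
    consider "c > 0" | "c = 0" | "c < 0" by linarith
    then show "m (c *\<^sub>R x) = c * m x"
    proof cases
      case 3
      have "m (c *\<^sub>R x) = - m ((- c) *\<^sub>R x)" using neg[OF subspace_scale[OF W x, of c]] by simp
      then show ?thesis using sublinear_on_scale[OF m(1) x, of "- c"] 3 by simp
    qed (use x sublinear_on_scale[OF m(1) x] sublinear_on_zero[OF m(1) W] in auto)
  qed
  then show ?thesis
  proof (rule that)
    show "m x \<le> s x" if "x \<in> W" for x using m(2) r(2) that order_trans by blast
    show "0 \<le> m x" if "x \<in> L" for x
      using neg[of x] m(2)[of "- x"] r(3)[OF that] that L W by (auto simp: subspace_neg subset_iff)
  qed
qed

section \<open>Lebesgue spaces\<close>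

text \<open>At the boundary point 0, which the convexity of powers on the open half-line does not cover, the
  inequality says that \<open>c powr p \<le> c\<close> for weights \<open>c \<le> 1\<close>.\<close>

lemma powr_convex_nonneg:
  fixes p :: real
  assumes "1 \<le> p" "0 \<le> u" "0 \<le> v" "0 \<le> a" "0 \<le> b" "a + b = 1"
  shows "(a * u + b * v) powr p \<le> a * u powr p + b * v powr p"
proof -
  have sub: "c powr p \<le> c" if "0 \<le> c" "c \<le> 1" for c
    using powr_mono'[of 1 p c] that assms(1) by (cases "c = 0") auto
  have "a \<le> 1" "b \<le> 1" using assms by auto
  show ?thesis
  proof (cases "u = 0 \<or> v = 0")
    case True
    then show ?thesis
      using sub[of a] sub[of b] \<open>a \<le> 1\<close> \<open>b \<le> 1\<close> assms by (auto simp: powr_mult mult_right_mono)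
  next
    case False
    then show ?thesis
      using convex_onD[OF powr_convex[OF assms(1)], of b u v] assms by (simp add: eq_diff_eq[symmetric])
  qed
qed

lemma borel_measurable_vec:
  fixes x :: "'a \<Rightarrow> ('b::euclidean_space)^'t::finite"
  assumes "\<And>t. (\<lambda>\<omega>. x \<omega> $ t) \<in> borel_measurable G"
  shows "x \<in> borel_measurable G"
  unfolding borel_measurable_euclidean_space[of x]
proof
  fix i :: "'b^'t" assume "i \<in> Basis"
  then obtain t b where "i = axis t b" by (auto simp: Basis_vec_def)
  then have "(\<lambda>\<omega>. x \<omega> \<bullet> i) = (\<lambda>\<omega>. x \<omega> $ t \<bullet> b)" by (simp add: inner_axis)
  with assms[of t] show "(\<lambda>\<omega>. x \<omega> \<bullet> i) \<in> borel_measurable G" by simp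
qed

locale lp_exponent = prob_space M for M :: "'a measure" +
  fixes p :: real
  assumes p_ge_1: "1 \<le> p"
begin

abbreviation "Lp \<equiv> lp_space (ennreal p) M"
abbreviation "nrm \<equiv> lp_norm p M"

lemma Lp_iff: "x \<in> Lp G \<longleftrightarrow> x \<in> borel_measurable G \<and> integrable M (\<lambda>\<omega>. norm (x \<omega>) powr p)"
  using p_ge_1 by (simp add: lp_space_def)

lemma Lp_measurable: "x \<in> Lp G \<Longrightarrow> x \<in> borel_measurable G"
  by (simp add: Lp_iff)

lemma Lp_integrable_powr: "x \<in> Lp G \<Longrightarrow> integrable M (\<lambda>\<omega>. norm (x \<omega>) powr p)"
  by (simp add: Lp_iff)

lemma Lp_subalgebra: "subalgebra M G \<Longrightarrow> x \<in> Lp G \<Longrightarrow> x \<in> Lp M"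
  by (auto simp: Lp_iff intro: measurable_from_subalg)

lemma subalgebra_self: "subalgebra M M"
  by (simp add: subalgebra_def)

lemma lp_norm_nonneg: "0 \<le> nrm x"
  by (simp add: lp_norm_def)

lemma lp_norm_powr: "nrm x powr p = (\<integral>\<omega>. norm (x \<omega>) powr p \<partial>M)"
  using p_ge_1 by (simp add: lp_norm_def powr_powr integral_nonneg_AE)

lemma lp_norm_le_iff:
  assumes "0 \<le> c" shows "nrm x \<le> c \<longleftrightarrow> (\<integral>\<omega>. norm (x \<omega>) powr p \<partial>M) \<le> c powr p"
proof
  assume "nrm x \<le> c"
  then show "(\<integral>\<omega>. norm (x \<omega>) powr p \<partial>M) \<le> c powr p"
    using powr_mono2[of p "nrm x" c] p_ge_1 lp_norm_nonneg[of x] by (simp add: lp_norm_powr)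
next
  assume *: "(\<integral>\<omega>. norm (x \<omega>) powr p \<partial>M) \<le> c powr p"
  show "nrm x \<le> c"
    using powr_mono2[OF _ _ *, of "1/p"] p_ge_1 assms
    by (simp add: lp_norm_def powr_powr integral_nonneg_AE)
qed

lemma Lp_dominated:
  fixes x :: "'a \<Rightarrow> 'b::euclidean_space" and y :: "'a \<Rightarrow> 'c::euclidean_space"
  assumes "subalgebra M G" "x \<in> borel_measurable G" "y \<in> Lp H"
    "AE \<omega> in M. norm (x \<omega>) \<le> norm (y \<omega>)"
  shows "x \<in> Lp G"
  unfolding Lp_iff
proof
  have [measurable]: "x \<in> borel_measurable M" by (rule measurable_from_subalg[OF assms(1,2)])
  show "integrable M (\<lambda>\<omega>. norm (x \<omega>) powr p)"
  proof (rule Bochner_Integration.integrable_bound[OF Lp_integrable_powr[OF assms(3)]])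
    show "AE \<omega> in M. norm (norm (x \<omega>) powr p) \<le> norm (norm (y \<omega>) powr p)"
      using assms(4) p_ge_1 by (auto elim!: eventually_mono intro: powr_mono2)
  qed measurable
qed (rule assms)

lemma lp_norm_mono:
  fixes x :: "'a \<Rightarrow> 'b::euclidean_space" and y :: "'a \<Rightarrow> 'c::euclidean_space"
  assumes "y \<in> Lp G" "AE \<omega> in M. norm (x \<omega>) \<le> norm (y \<omega>)"
  shows "nrm x \<le> nrm y"
proof -
  have "(\<integral>\<omega>. norm (x \<omega>) powr p \<partial>M) \<le> (\<integral>\<omega>. norm (y \<omega>) powr p \<partial>M)"
    using assms(2) p_ge_1
    by (intro integral_mono_AE' Lp_integrable_powr[OF assms(1)])
       (auto elim!: eventually_mono intro: powr_mono2)
  then show ?thesis by (simp add: lp_norm_le_iff lp_norm_nonneg lp_norm_powr)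
qed

lemma lp_norm_cong_AE:
  fixes x :: "'a \<Rightarrow> 'b::euclidean_space" and y :: "'a \<Rightarrow> 'c::euclidean_space"
  assumes "x \<in> borel_measurable M" "y \<in> borel_measurable M" "AE \<omega> in M. norm (x \<omega>) = norm (y \<omega>)"
  shows "nrm x = nrm y"
  unfolding lp_norm_def using assms by (intro arg_cong[where f = "\<lambda>c. c powr _"] integral_cong_AE) auto

lemma Lp_norm_function: "x \<in> Lp G \<Longrightarrow> (\<lambda>\<omega>. norm (x \<omega>)) \<in> Lp G"
  by (auto simp: Lp_iff)

lemma lp_norm_norm: "nrm (\<lambda>\<omega>. norm (x \<omega>)) = nrm x"
  by (simp add: lp_norm_def)

lemma Lp_zero: "(\<lambda>\<omega>. 0) \<in> Lp G"
  by (simp add: Lp_iff)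

lemma Lp_const: "(\<lambda>\<omega>. c) \<in> Lp G"
  by (simp add: Lp_iff)

lemma Lp_scaleR: "x \<in> Lp G \<Longrightarrow> (\<lambda>\<omega>. c *\<^sub>R x \<omega>) \<in> Lp G"
  by (auto simp: Lp_iff powr_mult)

lemma lp_norm_scaleR: "nrm (\<lambda>\<omega>. c *\<^sub>R x \<omega>) = \<bar>c\<bar> * nrm x"
  using p_ge_1 by (simp add: lp_norm_def powr_mult powr_powr)

lemma lp_norm_zero: "nrm (\<lambda>\<omega>. 0) = 0"
  by (simp add: lp_norm_def)

lemma Lp_add:
  assumes "x \<in> Lp G" "y \<in> Lp G" "subalgebra M G" shows "(\<lambda>\<omega>. x \<omega> + y \<omega>) \<in> Lp G"
  unfolding Lp_iff
proof
  have [measurable]: "x \<in> borel_measurable G" "y \<in> borel_measurable G"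
    using assms by (auto simp: Lp_iff)
  show m: "(\<lambda>\<omega>. x \<omega> + y \<omega>) \<in> borel_measurable G" by measurable
  have [measurable]: "(\<lambda>\<omega>. x \<omega> + y \<omega>) \<in> borel_measurable M"
    by (rule measurable_from_subalg[OF assms(3) m])
  show "integrable M (\<lambda>\<omega>. norm (x \<omega> + y \<omega>) powr p)"
  proof (rule Bochner_Integration.integrable_bound)
    show "integrable M (\<lambda>\<omega>. 2 powr p * (norm (x \<omega>) powr p + norm (y \<omega>) powr p))"
      using assms by (auto simp: Lp_iff)
    have "norm (x \<omega> + y \<omega>) powr p \<le> 2 powr p * (norm (x \<omega>) powr p + norm (y \<omega>) powr p)" for \<omega>
    proof -
      let ?m = "max (norm (x \<omega>)) (norm (y \<omega>))"
      have "norm (x \<omega> + y \<omega>) powr p \<le> (2 * ?m) powr p"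
        using p_ge_1 norm_triangle_ineq[of "x \<omega>" "y \<omega>"] by (intro powr_mono2) auto
      also have "\<dots> = 2 powr p * ?m powr p" by (simp add: powr_mult)
      also have "?m powr p \<le> norm (x \<omega>) powr p + norm (y \<omega>) powr p" by (auto simp: max_def)
      finally show ?thesis by simp
    qed
    then show "AE \<omega> in M. norm (norm (x \<omega> + y \<omega>) powr p)
        \<le> norm (2 powr p * (norm (x \<omega>) powr p + norm (y \<omega>) powr p))" by simp
  qed measurable
qed

lemma Lp_uminus: "x \<in> Lp G \<Longrightarrow> (\<lambda>\<omega>. - x \<omega>) \<in> Lp G"
  by (auto simp: Lp_iff)

lemma Lp_diff:
  assumes "x \<in> Lp G" "y \<in> Lp G" "subalgebra M G" shows "(\<lambda>\<omega>. x \<omega> - y \<omega>) \<in> Lp G"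
  using Lp_add[OF assms(1) Lp_uminus[OF assms(2)] assms(3)] by simp

lemma Lp_sum:
  assumes "\<And>i. i \<in> I \<Longrightarrow> x i \<in> Lp G" "subalgebra M G" shows "(\<lambda>\<omega>. \<Sum>i\<in>I. x i \<omega>) \<in> Lp G"
  using assms(1) by (induction I rule: infinite_finite_induct) (auto simp: Lp_zero intro: Lp_add assms(2))

lemma subspace_Lp: "subalgebra M G \<Longrightarrow> subspace (Lp G)"
  by (auto simp: subspace_def zero_fun_def plus_fun_def scaleR_fun_def Lp_zero
      intro: Lp_add Lp_scaleR)

text \<open>Minkowski's inequality: for \<open>a > \<parallel>x\<parallel>\<close> and \<open>b > \<parallel>y\<parallel>\<close>, write \<open>(x + y) / (a + b)\<close> as a convex
  combination of \<open>x / a\<close> and \<open>y / b\<close> and use convexity of the power.\<close>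

lemma lp_norm_triangle:
  assumes "x \<in> Lp M" "y \<in> Lp M" shows "nrm (\<lambda>\<omega>. x \<omega> + y \<omega>) \<le> nrm x + nrm y"
proof (rule field_le_epsilon)
  fix e :: real assume "e > 0"
  define a b where "a = nrm x + e/2" and "b = nrm y + e/2"
  have ab: "a > 0" "b > 0" "nrm x \<le> a" "nrm y \<le> b"
    using \<open>e > 0\<close> lp_norm_nonneg[of x] lp_norm_nonneg[of y] by (auto simp: a_def b_def)
  define s where "s = a + b"
  have s: "s > 0" using ab by (simp add: s_def)
  have pt: "norm (x \<omega> + y \<omega>) powr p
      \<le> s powr p * (a / s * (norm (x \<omega>) powr p / a powr p) + b / s * (norm (y \<omega>) powr p / b powr p))" for \<omega>
  proof -
    have "norm (x \<omega> + y \<omega>) powr p \<le> (s * (a / s * (norm (x \<omega>) / a) + b / s * (norm (y \<omega>) / b))) powr p"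
    proof (rule powr_mono2)
      have "s * (a / s * (norm (x \<omega>) / a) + b / s * (norm (y \<omega>) / b)) = norm (x \<omega>) + norm (y \<omega>)"
        using ab s by (simp add: field_simps)
      then show "norm (x \<omega> + y \<omega>) \<le> s * (a / s * (norm (x \<omega>) / a) + b / s * (norm (y \<omega>) / b))"
        using norm_triangle_ineq by metis
    qed (use p_ge_1 in auto)
    also have "\<dots> = s powr p * (a / s * (norm (x \<omega>) / a) + b / s * (norm (y \<omega>) / b)) powr p"
      by (simp only: powr_mult)
    also have "(a / s * (norm (x \<omega>) / a) + b / s * (norm (y \<omega>) / b)) powr p
        \<le> a / s * (norm (x \<omega>) / a) powr p + b / s * (norm (y \<omega>) / b) powr p"
    proof (rule powr_convex_nonneg[OF p_ge_1])
      show "a / s + b / s = 1" using s by (simp add: s_def add_divide_distrib[symmetric])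
    qed (use ab s in auto)
    also have "\<dots> = a / s * (norm (x \<omega>) powr p / a powr p) + b / s * (norm (y \<omega>) powr p / b powr p)"
      using ab by (simp add: powr_divide)
    finally show ?thesis by (simp add: mult_left_mono)
  qed
  have "(\<integral>\<omega>. norm (x \<omega> + y \<omega>) powr p \<partial>M)
     \<le> (\<integral>\<omega>. s powr p * (a / s * (norm (x \<omega>) powr p / a powr p) + b / s * (norm (y \<omega>) powr p / b powr p)) \<partial>M)"
    using pt assms ab s
    by (intro integral_mono_AE')
      (auto simp: Lp_iff intro!: AE_I2 mult_nonneg_nonneg add_nonneg_nonneg divide_nonneg_nonneg)
  also have "\<dots> = s powr p * (a / s * ((\<integral>\<omega>. norm (x \<omega>) powr p \<partial>M) / a powr p)
      + b / s * ((\<integral>\<omega>. norm (y \<omega>) powr p \<partial>M) / b powr p))"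
    using assms by (simp add: Lp_iff)
  also have "\<dots> \<le> s powr p * (a / s * 1 + b / s * 1)"
  proof (intro mult_left_mono add_mono)
    show "(\<integral>\<omega>. norm (x \<omega>) powr p \<partial>M) / a powr p \<le> 1"
      using ab lp_norm_le_iff[of a x] by (simp add: divide_le_eq)
    show "(\<integral>\<omega>. norm (y \<omega>) powr p \<partial>M) / b powr p \<le> 1"
      using ab lp_norm_le_iff[of b y] by (simp add: divide_le_eq)
  qed (use ab s in auto)
  also have "\<dots> = s powr p" using s by (simp add: s_def add_divide_distrib[symmetric])
  finally have "nrm (\<lambda>\<omega>. x \<omega> + y \<omega>) \<le> s" using s by (simp add: lp_norm_le_iff)
  then show "nrm (\<lambda>\<omega>. x \<omega> + y \<omega>) \<le> nrm x + nrm y + e" by (simp add: s_def a_def b_def)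
qed

lemma lp_norm_sum:
  assumes "finite I" "\<And>i. i \<in> I \<Longrightarrow> x i \<in> Lp M"
  shows "nrm (\<lambda>\<omega>. \<Sum>i\<in>I. x i \<omega>) \<le> (\<Sum>i\<in>I. nrm (x i))"
  using assms
proof (induction I)
  case (insert i I)
  have "nrm (\<lambda>\<omega>. x i \<omega> + (\<Sum>i\<in>I. x i \<omega>)) \<le> nrm (x i) + nrm (\<lambda>\<omega>. \<Sum>i\<in>I. x i \<omega>)"
    using insert by (intro lp_norm_triangle Lp_sum subalgebra_self) auto
  then show ?case using insert by auto
qed (simp add: lp_norm_zero)

lemma lp_norm_dominated_convergence:
  fixes x :: "nat \<Rightarrow> 'a \<Rightarrow> 'b::euclidean_space" and y :: "'a \<Rightarrow> 'c::euclidean_space"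
  assumes x: "\<And>k. x k \<in> borel_measurable M" and y: "y \<in> Lp M"
    and bound: "\<And>k. AE \<omega> in M. norm (x k \<omega>) \<le> norm (y \<omega>)"
    and lim: "AE \<omega> in M. (\<lambda>k. x k \<omega>) \<longlonglongrightarrow> 0"
  shows "(\<lambda>k. nrm (x k)) \<longlonglongrightarrow> 0"
proof -
  have "(\<lambda>k. \<integral>\<omega>. norm (x k \<omega>) powr p \<partial>M) \<longlonglongrightarrow> (\<integral>\<omega>. 0 \<partial>M)"
  proof (rule integral_dominated_convergence)
    show "integrable M (\<lambda>\<omega>. norm (y \<omega>) powr p)" using y by (rule Lp_integrable_powr)
    show "AE \<omega> in M. norm (norm (x k \<omega>) powr p) \<le> norm (y \<omega>) powr p" for k
      using bound[of k] p_ge_1 by (auto elim!: eventually_mono intro: powr_mono2)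
    show "AE \<omega> in M. (\<lambda>k. norm (x k \<omega>) powr p) \<longlonglongrightarrow> 0"
      using lim
    proof eventually_elim
      case (elim \<omega>)
      have "(\<lambda>k. norm (x k \<omega>) powr p) \<longlonglongrightarrow> norm (0::'b) powr p"
        using p_ge_1 by (intro tendsto_powr' tendsto_norm elim tendsto_const) auto
      then show ?case by simp
    qed
  qed (use x in measurable)
  then have "(\<lambda>k. (\<integral>\<omega>. norm (x k \<omega>) powr p \<partial>M) powr (1/p)) \<longlonglongrightarrow> 0 powr (1/p)"
    using p_ge_1 by (intro tendsto_powr' tendsto_const) (auto simp: integral_nonneg_AE)
  then show ?thesis by (simp add: lp_norm_def)
qed

lemma Lp_integrable:
  fixes x :: "'a \<Rightarrow> 'b::euclidean_space"
  assumes "x \<in> Lp M" shows "integrable M x"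
proof (rule Bochner_Integration.integrable_bound)
  show "integrable M (\<lambda>\<omega>. 1 + norm (x \<omega>) powr p)" using assms by (simp add: Lp_iff)
  have "norm (x \<omega>) \<le> 1 + norm (x \<omega>) powr p" for \<omega>
    using powr_mono[of 1 p "norm (x \<omega>)"] p_ge_1
    by (cases "1 \<le> norm (x \<omega>)") (auto intro: add_increasing2)
  then show "AE \<omega> in M. norm (x \<omega>) \<le> norm (1 + norm (x \<omega>) powr p)" by simp
qed (use assms in \<open>simp add: Lp_iff\<close>)

abbreviation "adapted \<F> \<equiv> adapted_lp (ennreal p) M \<F>"

lemma adapted_iff: "x \<in> adapted \<F> \<longleftrightarrow> (\<forall>t. (\<lambda>\<omega>. x \<omega> $ t) \<in> Lp (\<F> t))"
  by (simp add: adapted_lp_def)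

lemma subspace_adapted:
  fixes \<F> :: "'t::finite \<Rightarrow> 'a measure"
  assumes "\<And>t. subalgebra M (\<F> t)"
  shows "subspace (adapted \<F> :: ('a \<Rightarrow> ('b::euclidean_space)^'t) set)"
  using assms by (auto simp: subspace_def adapted_iff zero_fun_def plus_fun_def scaleR_fun_def Lp_zero
      intro: Lp_add Lp_scaleR)

lemma Lp_vec:
  fixes x :: "'a \<Rightarrow> ('b::euclidean_space)^'t::finite"
  assumes x: "\<And>t. (\<lambda>\<omega>. x \<omega> $ t) \<in> Lp M"
  shows "x \<in> Lp M"
proof (rule Lp_dominated[OF subalgebra_self])
  show "x \<in> borel_measurable M"
    using x by (intro borel_measurable_vec) (simp add: Lp_iff)
  show "(\<lambda>\<omega>. \<Sum>t\<in>UNIV. norm (x \<omega> $ t)) \<in> Lp M"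
    using x by (intro Lp_sum Lp_norm_function subalgebra_self)
  show "AE \<omega> in M. norm (x \<omega>) \<le> norm (\<Sum>t\<in>UNIV. norm (x \<omega> $ t))"
    by (intro AE_I2) (simp add: norm_le_l1_cart norm_vec_def L2_set_le_sum sum_nonneg)
qed

lemma adapted_Lp:
  fixes x :: "'a \<Rightarrow> ('b::euclidean_space)^'t::finite"
  assumes "\<And>t. subalgebra M (\<F> t)" "x \<in> adapted \<F>"
  shows "x \<in> Lp M"
  using assms by (intro Lp_vec Lp_subalgebra) (auto simp: adapted_iff)

end

section \<open>Representation of functionals on Lebesgue spaces\<close>

context lp_exponent
begin

text \<open>Dominated pointwise convergence is convergence in norm, so bounded functionals pass to the
  limit. This yields both the countable additivity of \<open>A \<mapsto> f 1\<^sub>A\<close> and the extension of identities by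
  monotone approximation.\<close>

lemma functional_dominated_convergence:
  fixes y :: "nat \<Rightarrow> 'a \<Rightarrow> 'b::euclidean_space" and u :: "'a \<Rightarrow> 'b"
  assumes G: "subalgebra M G" and f: "linear_functional_on (Lp G) f"
    and bound: "\<And>y. y \<in> Lp G \<Longrightarrow> \<bar>f y\<bar> \<le> K * nrm y"
    and y: "\<And>k. y k \<in> borel_measurable G" and u: "u \<in> Lp G"
    and le: "\<And>k \<omega>. \<omega> \<in> space M \<Longrightarrow> norm (y k \<omega>) \<le> norm (u \<omega>)"
    and lim: "\<And>\<omega>. \<omega> \<in> space M \<Longrightarrow> (\<lambda>k. y k \<omega>) \<longlonglongrightarrow> u \<omega>"
  shows "(\<lambda>k. f (y k)) \<longlonglongrightarrow> f u"
proof -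
  have yL: "y k \<in> Lp G" for k using Lp_dominated[OF G y u] le by auto
  have d: "(\<lambda>\<omega>. y k \<omega> - u \<omega>) \<in> Lp G" for k by (rule Lp_diff[OF yL u G])
  have lim0: "(\<lambda>k. nrm (\<lambda>\<omega>. y k \<omega> - u \<omega>)) \<longlonglongrightarrow> 0"
  proof (rule lp_norm_dominated_convergence)
    show "(\<lambda>\<omega>. 2 *\<^sub>R u \<omega>) \<in> Lp M" by (intro Lp_scaleR Lp_subalgebra[OF G u])
    show "(\<lambda>\<omega>. y k \<omega> - u \<omega>) \<in> borel_measurable M" for k
      using Lp_subalgebra[OF G d] by (rule Lp_measurable)
    show "AE \<omega> in M. norm (y k \<omega> - u \<omega>) \<le> norm (2 *\<^sub>R u \<omega>)" for k
    proof (rule AE_I2)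
      fix \<omega> assume "\<omega> \<in> space M"
      then show "norm (y k \<omega> - u \<omega>) \<le> norm (2 *\<^sub>R u \<omega>)"
        using le[of \<omega> k] norm_triangle_ineq4[of "y k \<omega>" "u \<omega>"] by simp
    qed
    show "AE \<omega> in M. (\<lambda>k. y k \<omega> - u \<omega>) \<longlonglongrightarrow> 0"
      using lim by (intro AE_I2) (simp add: LIM_zero)
  qed
  have "\<bar>f (y k) - f u\<bar> \<le> K * nrm (\<lambda>\<omega>. y k \<omega> - u \<omega>)" for k
    using bound[OF d] linear_functional_on_diff[OF f subspace_Lp[OF G] yL u]
    by (simp add: fun_diff_def)
  then have "(\<lambda>k. f (y k) - f u) \<longlonglongrightarrow> 0"
    using tendsto_mult_right[OF lim0, of K] by (intro Lim_null_comparison[of "\<lambda>k. f (y k) - f u"]) (auto simp: mult.commute)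
  then show ?thesis by (simp add: LIM_zero_iff)
qed

lemma lp_norm_indicator_null: "A \<in> null_sets M \<Longrightarrow> nrm (indicator A :: 'a \<Rightarrow> real) = 0"
proof -
  assume "A \<in> null_sets M"
  then have "AE \<omega> in M. \<omega> \<notin> A" by (rule AE_not_in)
  then have "nrm (indicator A :: 'a \<Rightarrow> real) = nrm (\<lambda>\<omega>. 0::real)"
    using \<open>A \<in> null_sets M\<close> by (intro lp_norm_cong_AE) (auto elim!: eventually_mono)
  then show ?thesis by (simp add: lp_norm_zero)
qed

lemma Lp_indicator: "A \<in> sets G \<Longrightarrow> subalgebra M G \<Longrightarrow> (indicator A :: 'a \<Rightarrow> real) \<in> Lp G"
  by (rule Lp_dominated[OF _ _ Lp_const[of "1::real" G]]) (auto simp: indicator_def)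

text \<open>The set function \<open>A \<mapsto> f 1\<^sub>A\<close> is a finite measure, absolutely continuous because
  \<open>\<bar>f 1\<^sub>A\<bar> \<le> K \<parallel>1\<^sub>A\<parallel>\<close>, and so has a Radon-Nikodym density.\<close>

lemma positive_functional_density:
  fixes f :: "('a \<Rightarrow> real) \<Rightarrow> real"
  assumes G: "subalgebra M G" and f: "linear_functional_on (Lp G) f"
    and bound: "\<And>y. y \<in> Lp G \<Longrightarrow> \<bar>f y\<bar> \<le> K * nrm y"
    and pos: "\<And>y. y \<in> Lp G \<Longrightarrow> (\<And>\<omega>. 0 \<le> y \<omega>) \<Longrightarrow> 0 \<le> f y"
  obtains w :: "'a \<Rightarrow> real" where "w \<in> borel_measurable G" "\<And>\<omega>. 0 \<le> w \<omega>"
    "\<And>A. A \<in> sets G \<Longrightarrow> integrable M (\<lambda>\<omega>. w \<omega> * indicator A \<omega>)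
        \<and> f (indicator A) = (\<integral>\<omega>. w \<omega> * indicator A \<omega> \<partial>M)"
proof -
  have W: "subspace (Lp G :: ('a \<Rightarrow> real) set)" by (rule subspace_Lp[OF G])
  have ind: "(indicator A :: 'a \<Rightarrow> real) \<in> Lp G" if "A \<in> sets G" for A
    using that G by (rule Lp_indicator)
  have sp: "space G = space M" using G by (simp add: subalgebra_def)
  define \<mu> where "\<mu> A = ennreal (f (indicator A))" for A :: "'a set"
  define N where "N = measure_of (space G) (sets G) \<mu>"
  have ca: "countably_additive (sets G) \<mu>"
    unfolding countably_additive_def
  proof (intro allI impI)
    fix A :: "nat \<Rightarrow> 'a set"
    assume A: "range A \<subseteq> sets G" "disjoint_family A" "\<Union> (range A) \<in> sets G"
    have split: "(\<Sum>i<n. f (indicator (A i))) = f (indicator (\<Union>i<n. A i))" for n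
    proof -
      have "(\<Sum>i<n. indicator (A i)) = (indicator (\<Union>i<n. A i) :: 'a \<Rightarrow> real)"
        using A(2) by (auto simp: fun_eq_iff sum_fun_apply indicator_UN_disjoint disjoint_family_on_def)
      then show ?thesis
        using linear_functional_on_sum[OF f W, of "{..<n}" "\<lambda>i. indicator (A i)"] A(1) ind by auto
    qed
    have "(\<lambda>n. f (indicator (\<Union>i<n. A i))) \<longlonglongrightarrow> f (indicator (\<Union> (range A)))"
    proof (rule functional_dominated_convergence[OF G f bound])
      show "(indicator (\<Union>i<k. A i) :: 'a \<Rightarrow> real) \<in> borel_measurable G" for k
        using A(1) by (intro borel_measurable_indicator) auto
      show "(indicator (\<Union> (range A)) :: 'a \<Rightarrow> real) \<in> Lp G" using A(3) by (rule ind)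
      show "(\<lambda>k. indicator (\<Union>i<k. A i) \<omega> :: real) \<longlonglongrightarrow> indicator (\<Union> (range A)) \<omega>" for \<omega>
        by (rule LIMSEQ_indicator_UN)
    qed (auto simp: indicator_def)
    then have "(\<lambda>i. f (indicator (A i))) sums f (indicator (\<Union> (range A)))"
      by (simp add: sums_def split)
    then show "(\<Sum>i. \<mu> (A i)) = \<mu> (\<Union> (range A))"
      unfolding \<mu>_def using A(1) ind pos by (intro suminf_ennreal_eq) auto
  qed
  have posm: "positive (sets G) \<mu>"
  proof -
    have "(indicator {} :: 'a \<Rightarrow> real) = 0" by (simp add: fun_eq_iff)
    then show ?thesis using linear_functional_on_zero[OF f W] by (simp add: positive_def \<mu>_def)
  qed
  have N: "emeasure N A = \<mu> A" if "A \<in> sets G" for A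
    unfolding N_def using that by (intro emeasure_measure_of_sigma sets.sigma_algebra_axioms posm ca)
  have setsN: "sets N = sets G" by (simp add: N_def)
  define R where "R = restr_to_subalg M G"
  have setsR: "sets R = sets G" using G by (simp add: R_def sets_restr_to_subalg)
  interpret R: prob_space R unfolding R_def by (rule prob_space_restr_to_subalg[OF G prob_space_axioms])
  have "absolutely_continuous R N"
    unfolding absolutely_continuous_def
  proof
    fix A assume A: "A \<in> null_sets R"
    then have AG: "A \<in> sets G" using setsR by auto
    have "A \<in> null_sets M" using A by (simp add: R_def null_sets_restr_to_subalg[OF G])
    then have "f (indicator A) = 0" using bound[OF ind[OF AG]] lp_norm_indicator_null by simp
    then show "A \<in> null_sets N" using N[OF AG] setsN AG by (intro null_setsI) (auto simp: \<mu>_def)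
  qed
  then obtain w0 where w0: "w0 \<in> borel_measurable R" "density R w0 = N"
    using R.Radon_Nikodym setsN setsR by metis
  have [measurable]: "w0 \<in> borel_measurable G" using w0(1) unfolding R_def by (rule measurable_in_subalg'[OF G])
  have [measurable]: "w0 \<in> borel_measurable M" by (rule measurable_from_subalg[OF G]) simp
  have int: "(\<integral>\<^sup>+\<omega>. w0 \<omega> * indicator A \<omega> \<partial>M) = ennreal (f (indicator A))" if A[measurable]: "A \<in> sets G" for A
  proof -
    have "(\<integral>\<^sup>+\<omega>. w0 \<omega> * indicator A \<omega> \<partial>M) = (\<integral>\<^sup>+\<omega>. w0 \<omega> * indicator A \<omega> \<partial>R)"
      unfolding R_def by (rule nn_integral_subalgebra2[OF G, symmetric]) measurable
    also have "\<dots> = emeasure (density R w0) A"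
      using w0(1) A setsR by (intro emeasure_density[symmetric]) auto
    also have "\<dots> = ennreal (f (indicator A))" using w0(2) N[OF A] by (simp add: \<mu>_def)
    finally show ?thesis .
  qed
  have "(\<integral>\<^sup>+\<omega>. w0 \<omega> \<partial>M) = (\<integral>\<^sup>+\<omega>. w0 \<omega> * indicator (space M) \<omega> \<partial>M)"
    by (intro nn_integral_cong) auto
  also have "\<dots> \<noteq> \<infinity>" using int[of "space M"] sets.top[of G] sp by simp
  finally have fin: "AE \<omega> in M. w0 \<omega> \<noteq> \<infinity>" by (intro nn_integral_PInf_AE) auto
  define w where "w \<omega> = enn2real (w0 \<omega>)" for \<omega>
  have wm [measurable]: "w \<in> borel_measurable G" unfolding w_def by measurable
  have [measurable]: "w \<in> borel_measurable M" by (rule measurable_from_subalg[OF G wm])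
  show ?thesis
  proof (rule that[of w, OF wm])
    show "0 \<le> w \<omega>" for \<omega> by (simp add: w_def)
    fix A assume A: "A \<in> sets G"
    have [measurable]: "A \<in> sets M" using A G by (auto simp: subalgebra_def)
    have "(\<integral>\<^sup>+\<omega>. ennreal (w \<omega> * indicator A \<omega>) \<partial>M) = (\<integral>\<^sup>+\<omega>. w0 \<omega> * indicator A \<omega> \<partial>M)"
      using fin by (intro nn_integral_cong_AE)
        (auto elim!: eventually_mono simp: w_def indicator_def ennreal_enn2real_if)
    also have "\<dots> = ennreal (f (indicator A))" by (rule int[OF A])
    finally have "(\<integral>\<^sup>+\<omega>. ennreal (w \<omega> * indicator A \<omega>) \<partial>M) = ennreal (f (indicator A))" .
    moreover have "0 \<le> f (indicator A)" by (intro pos ind A) auto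
    ultimately show "integrable M (\<lambda>\<omega>. w \<omega> * indicator A \<omega>)
        \<and> f (indicator A) = (\<integral>\<omega>. w \<omega> * indicator A \<omega> \<partial>M)"
      by (subst (asm) nn_integral_eq_integrable) (auto simp: w_def)
  qed
qed

text \<open>The identity extends from indicators to nonnegative functions by monotone approximation, where
  the bound on \<open>f\<close> also gives the integrability of the product, and then by differences.\<close>

lemma positive_functional_representation:
  fixes f :: "('a \<Rightarrow> real) \<Rightarrow> real"
  assumes G: "subalgebra M G" and f: "linear_functional_on (Lp G) f"
    and bound: "\<And>y. y \<in> Lp G \<Longrightarrow> \<bar>f y\<bar> \<le> K * nrm y"
    and pos: "\<And>y. y \<in> Lp G \<Longrightarrow> (\<And>\<omega>. 0 \<le> y \<omega>) \<Longrightarrow> 0 \<le> f y"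
  obtains w :: "'a \<Rightarrow> real" where "w \<in> borel_measurable G"
    "\<And>y. y \<in> Lp G \<Longrightarrow> integrable M (\<lambda>\<omega>. w \<omega> * y \<omega>) \<and> f y = (\<integral>\<omega>. w \<omega> * y \<omega> \<partial>M)"
proof -
  have W: "subspace (Lp G :: ('a \<Rightarrow> real) set)" by (rule subspace_Lp[OF G])
  obtain w :: "'a \<Rightarrow> real" where w: "w \<in> borel_measurable G" "\<And>\<omega>. 0 \<le> w \<omega>"
    and ind: "\<And>A. A \<in> sets G \<Longrightarrow> integrable M (\<lambda>\<omega>. w \<omega> * indicator A \<omega>)
        \<and> f (indicator A) = (\<integral>\<omega>. w \<omega> * indicator A \<omega> \<partial>M)"
    using positive_functional_density[OF G f bound pos] by blast
  have [measurable]: "w \<in> borel_measurable M" by (rule measurable_from_subalg[OF G w(1)])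
  have nn: "u \<in> Lp G \<longrightarrow> integrable M (\<lambda>\<omega>. w \<omega> * u \<omega>) \<and> f u = (\<integral>\<omega>. w \<omega> * u \<omega> \<partial>M)"
    if "u \<in> borel_measurable G" "\<And>\<omega>. 0 \<le> u \<omega>" for u
    using that
  proof (induction u rule: borel_measurable_induct_real)
    case (set A)
    then show ?case using ind by blast
  next
    case (mult u c)
    show ?case
    proof (cases "c = 0")
      case True
      then show ?thesis using linear_functional_on_zero[OF f W] by (simp add: zero_fun_def)
    next
      case False
      show ?thesis
      proof
        assume "(\<lambda>x. c * u x) \<in> Lp G"
        from Lp_scaleR[OF this, of "inverse c"] False have u: "u \<in> Lp G" by (simp add: field_simps)
        have "f (\<lambda>x. c * u x) = c * f u"
          using linear_functional_on_scale[OF f u, of c] by (simp add: scaleR_fun_def)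
        with mult.IH u show "integrable M (\<lambda>\<omega>. w \<omega> * (c * u \<omega>)) \<and> f (\<lambda>x. c * u x) = (\<integral>\<omega>. w \<omega> * (c * u \<omega>) \<partial>M)"
          by (auto simp: mult.left_commute[of _ c])
      qed
    qed
  next
    case (add u v)
    show ?case
    proof
      assume s: "(\<lambda>x. v x + u x) \<in> Lp G"
      have u: "u \<in> Lp G" and v: "v \<in> Lp G"
        by (rule Lp_dominated[OF G _ s]; use add in auto)+
      have "f (\<lambda>x. v x + u x) = f v + f u"
        using linear_functional_on_add[OF f v u] by (simp add: plus_fun_def)
      with add.IH u v show "integrable M (\<lambda>\<omega>. w \<omega> * (v \<omega> + u \<omega>))
          \<and> f (\<lambda>x. v x + u x) = (\<integral>\<omega>. w \<omega> * (v \<omega> + u \<omega>) \<partial>M)"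
        by (auto simp: distrib_left)
    qed
  next
    case (seq U)
    have sp: "space G = space M" using G by (simp add: subalgebra_def)
    have lim: "(\<lambda>i. U i \<omega>) \<longlonglongrightarrow> u \<omega>" if "\<omega> \<in> space M" for \<omega> using seq that sp by auto
    have inc: "incseq (\<lambda>i. U i \<omega>)" for \<omega> using seq by (auto simp: incseq_def le_fun_def)
    have le: "U i \<omega> \<le> u \<omega>" if "\<omega> \<in> space M" for i \<omega> using incseq_le[OF inc lim[OF that]] .
    show ?case
    proof
      assume u: "u \<in> Lp G"
      have [measurable]: "u \<in> borel_measurable M" using Lp_measurable[OF Lp_subalgebra[OF G u]] .
      have UL: "U i \<in> Lp G" for i
        using seq.hyps(1)[of i] le[of _ i] seq.hyps(2)[of i] that(2)
        by (intro Lp_dominated[OF G _ u]) (auto simp: abs_of_nonneg intro!: AE_I2 order_trans[OF _ abs_ge_self])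
      have I: "integrable M (\<lambda>\<omega>. w \<omega> * U i \<omega>)" "f (U i) = (\<integral>\<omega>. w \<omega> * U i \<omega> \<partial>M)" for i
        using seq.IH[of i] UL by auto
      have "(\<lambda>i. f (U i)) \<longlonglongrightarrow> f u"
        using seq.hyps(1,2) le
        by (intro functional_dominated_convergence[OF G f bound _ u _ lim])
           (auto simp: intro!: order_trans[OF _ abs_ge_self])
      then have c: "(\<lambda>i. \<integral>\<omega>. w \<omega> * U i \<omega> \<partial>M) \<longlonglongrightarrow> f u" by (simp add: I(2))
      have a: "AE \<omega> in M. mono (\<lambda>i. w \<omega> * U i \<omega>)"
        using inc w(2) by (intro AE_I2) (auto simp: mono_def intro: mult_left_mono)
      have b: "AE \<omega> in M. (\<lambda>i. w \<omega> * U i \<omega>) \<longlonglongrightarrow> w \<omega> * u \<omega>"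
        using lim by (intro AE_I2 tendsto_mult tendsto_const) auto
      show "integrable M (\<lambda>\<omega>. w \<omega> * u \<omega>) \<and> f u = (\<integral>\<omega>. w \<omega> * u \<omega> \<partial>M)"
        using integrable_monotone_convergence[OF I(1) a b c] integral_monotone_convergence[OF I(1) a b c]
        by auto
    qed
  qed
  show ?thesis
  proof (rule that[OF w(1)])
    fix y :: "'a \<Rightarrow> real" assume y: "y \<in> Lp G"
    then have [measurable]: "y \<in> borel_measurable G" by (rule Lp_measurable)
    let ?a = "\<lambda>\<omega>. max (y \<omega>) 0" and ?b = "\<lambda>\<omega>. max (- y \<omega>) 0"
    have a: "?a \<in> Lp G" and b: "?b \<in> Lp G"
      by (rule Lp_dominated[OF G _ y]; auto)+
    have eq: "y = ?a - ?b" by (auto simp: fun_eq_iff fun_diff_def)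
    have "f y = f ?a - f ?b"
      by (subst eq, rule linear_functional_on_diff[OF f W a b])
    moreover have A: "integrable M (\<lambda>\<omega>. w \<omega> * ?a \<omega>)" "f ?a = (\<integral>\<omega>. w \<omega> * ?a \<omega> \<partial>M)"
      and B: "integrable M (\<lambda>\<omega>. w \<omega> * ?b \<omega>)" "f ?b = (\<integral>\<omega>. w \<omega> * ?b \<omega> \<partial>M)"
      using nn[of ?a] nn[of ?b] a b Lp_measurable by auto
    moreover have "w \<omega> * y \<omega> = w \<omega> * ?a \<omega> - w \<omega> * ?b \<omega>" for \<omega> by (auto simp: max_def)
    ultimately show "integrable M (\<lambda>\<omega>. w \<omega> * y \<omega>) \<and> f y = (\<integral>\<omega>. w \<omega> * y \<omega> \<partial>M)"
      by (simp only: Bochner_Integration.integral_diff[OF A(1) B(1)]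
          Bochner_Integration.integrable_diff[OF A(1) B(1)])
  qed
qed

text \<open>A Jordan decomposition obtained from the Hahn-Banach theorem instead of from signed measures.
  Write \<open>y\<^sup>+\<close> for the positive part. The sublinear functional \<open>K (\<parallel>y\<^sup>+\<parallel> + \<parallel>z\<^sup>+\<parallel>) - f y\<close> on pairs is nonnegative
  on the antidiagonal \<open>z = - y\<close>, hence dominates a linear \<open>h\<close> that vanishes there. Then
  \<open>f\<^sub>2 y = h (0, y)\<close> and \<open>f\<^sub>1 y = h (y, 0) + f y\<close> have difference \<open>f\<close>, and both are dominated by
  \<open>K \<parallel>y\<^sup>+\<parallel>\<close>, which vanishes for \<open>y \<le> 0\<close>; so they are positive.\<close>

lemma bounded_functional_decomposition:
  fixes f :: "('a \<Rightarrow> real) \<Rightarrow> real"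
  assumes G: "subalgebra M G" and f: "linear_functional_on (Lp G) f"
    and bound: "\<And>y. y \<in> Lp G \<Longrightarrow> \<bar>f y\<bar> \<le> K * nrm y" and K: "0 \<le> K"
  obtains f1 f2 where "linear_functional_on (Lp G) f1" "linear_functional_on (Lp G) f2"
    "\<And>y. y \<in> Lp G \<Longrightarrow> f y = f1 y - f2 y"
    "\<And>y. y \<in> Lp G \<Longrightarrow> \<bar>f1 y\<bar> \<le> K * nrm y" "\<And>y. y \<in> Lp G \<Longrightarrow> \<bar>f2 y\<bar> \<le> K * nrm y"
    "\<And>y. y \<in> Lp G \<Longrightarrow> (\<And>\<omega>. 0 \<le> y \<omega>) \<Longrightarrow> 0 \<le> f1 y"
    "\<And>y. y \<in> Lp G \<Longrightarrow> (\<And>\<omega>. 0 \<le> y \<omega>) \<Longrightarrow> 0 \<le> f2 y"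
proof -
  let ?V = "Lp G :: ('a \<Rightarrow> real) set"
  have W: "subspace ?V" by (rule subspace_Lp[OF G])
  define np where "np y = nrm (\<lambda>\<omega>. max (y \<omega>) (0::real))" for y :: "'a \<Rightarrow> real"
  have mx: "(\<lambda>\<omega>. max (y \<omega>) 0) \<in> Lp G" if "y \<in> ?V" for y
    by (rule Lp_dominated[OF G _ that]) (use Lp_measurable[OF that] in auto)
  have np_add: "np (y + z) \<le> np y + np z" if "y \<in> ?V" "z \<in> ?V" for y z
  proof -
    have "np (y + z) \<le> nrm (\<lambda>\<omega>. max (y \<omega>) 0 + max (z \<omega>) 0)"
      unfolding np_def using that by (intro lp_norm_mono[of _ G] Lp_add mx G) auto
    also have "\<dots> \<le> np y + np z"
      unfolding np_def using that by (intro lp_norm_triangle Lp_subalgebra[OF G] mx)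
    finally show ?thesis .
  qed
  have np_scale: "np (c *\<^sub>R y) = c * np y" if "c > 0" for c y
  proof -
    have "(\<lambda>\<omega>. max (c * y \<omega>) 0) = (\<lambda>\<omega>. c *\<^sub>R max (y \<omega>) 0)"
      using that by (auto simp: fun_eq_iff max_def zero_le_mult_iff mult_le_0_iff)
    then show ?thesis
      using that lp_norm_scaleR[of c "\<lambda>\<omega>. max (y \<omega>) 0"] by (simp add: np_def scaleR_fun_def)
  qed
  have np_le: "np y \<le> nrm y" if "y \<in> ?V" for y
    unfolding np_def using that by (intro lp_norm_mono) auto
  have np_nonpos: "np y = 0" if "\<And>\<omega>. y \<omega> \<le> 0" for y
    using that by (simp add: np_def lp_norm_zero max_absorb2)
  define s where "s = (\<lambda>(y, z). K * (np y + np z) - f y)"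
  have sub: "sublinear_on (?V \<times> ?V) s"
    unfolding sublinear_on_def
  proof (intro conjI ballI allI impI)
    fix u v assume uv: "u \<in> ?V \<times> ?V" "v \<in> ?V \<times> ?V"
    obtain y z y' z' where e: "u = (y, z)" "v = (y', z')" by (metis surj_pair)
    have "K * (np (y + y') + np (z + z')) \<le> K * ((np y + np y') + (np z + np z'))"
      using uv e K np_add by (intro mult_left_mono add_mono) auto
    then show "s (u + v) \<le> s u + s v"
      using uv e linear_functional_on_add[OF f, of y y'] by (simp add: s_def algebra_simps)
  next
    fix u and c :: real assume "u \<in> ?V \<times> ?V" "c > 0"
    then show "s (c *\<^sub>R u) = c * s u"
      using linear_functional_on_scale[OF f] by (auto simp: s_def np_scale algebra_simps)
  qed
  define L where "L = {(y, - y) | y. y \<in> ?V}"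
  obtain h where h: "linear_functional_on (?V \<times> ?V) h" "\<And>u. u \<in> ?V \<times> ?V \<Longrightarrow> h u \<le> s u"
    "\<And>u. u \<in> L \<Longrightarrow> 0 \<le> h u"
  proof (rule hahn_banach_cone[OF sub, of L])
    show "subspace (?V \<times> ?V)" using W W by (rule subspace_Times)
    show "L \<subseteq> ?V \<times> ?V" using W by (auto simp: L_def subspace_neg)
    show "0 \<in> L" using W by (auto simp: L_def zero_prod_def subspace_0 intro!: exI[of _ 0])
    show "u + v \<in> L" if "u \<in> L" "v \<in> L" for u v
      using that W by (auto simp: L_def subspace_add)
    show "c *\<^sub>R u \<in> L" if "u \<in> L" "c > 0" for u and c :: real
      using that W by (auto simp: L_def subspace_scale)
    show "0 \<le> s u" if "u \<in> L" for u
    proof -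
      obtain y where y: "y \<in> ?V" "u = (y, - y)" using \<open>u \<in> L\<close> by (auto simp: L_def)
      have "nrm y \<le> nrm (\<lambda>\<omega>. max (y \<omega>) 0 + max ((- y) \<omega>) 0)"
        using y W by (intro lp_norm_mono[of _ G] Lp_add mx G subspace_neg) auto
      also have "\<dots> \<le> np y + np (- y)"
        unfolding np_def using y W by (intro lp_norm_triangle Lp_subalgebra[OF G] mx subspace_neg)
      finally have "K * nrm y \<le> K * (np y + np (- y))" using K by (rule mult_left_mono)
      then show ?thesis using bound[OF y(1)] by (simp add: s_def y(2))
    qed
  qed blast
  have z: "(0 :: 'a \<Rightarrow> real) \<in> ?V" using W by (rule subspace_0)
  define f2 where "f2 y = h (0, y)" for y
  define f1 where "f1 y = h (y, 0) + f y" for y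
  have sym: "h (y, 0) = f2 y" if "y \<in> ?V" for y
  proof -
    have y': "- y \<in> ?V" using W that by (rule subspace_neg)
    have "(y, - y) \<in> L" "(- y, - (- y)) \<in> L" using that y' unfolding L_def by blast+
    moreover have "(- y, - (- y)) = - (y, - y)" by simp
    ultimately have "0 \<le> h (y, - y)" "0 \<le> - h (y, - y)"
      using h(3) linear_functional_on_neg[OF h(1), of "(y, - y)"] that y' by fastforce+
    then have "h (y, - y) = 0" by simp
    moreover have "h (y, - y) = h (y, 0) + h (- (0, y))"
      using linear_functional_on_add[OF h(1), of "(y, 0)" "- (0, y)"] that y' z by simp
    ultimately show ?thesis
      using linear_functional_on_neg[OF h(1), of "(0, y)"] that z by (simp add: f2_def)
  qed
  have up1: "f1 y \<le> K * np y" and up2: "f2 y \<le> K * np y" if "y \<in> ?V" for y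
    using h(2)[of "(y, 0)"] h(2)[of "(0, y)"] that z linear_functional_on_zero[OF f W] np_nonpos[of 0]
    by (auto simp: f1_def f2_def s_def)
  have l2: "linear_functional_on ?V f2"
    unfolding linear_functional_on_def f2_def
    using linear_functional_on_add[OF h(1), of "(0, _)" "(0, _)"]
      linear_functional_on_scale[OF h(1), of "(0, _)"] z by auto
  have l1: "linear_functional_on ?V f1"
    using l2 f W unfolding linear_functional_on_def f1_def
    by (auto simp: sym subspace_add subspace_scale algebra_simps)
  have both: "\<bar>g y\<bar> \<le> K * nrm y" "(\<And>\<omega>. 0 \<le> y \<omega>) \<Longrightarrow> 0 \<le> g y"
    if g: "linear_functional_on ?V g" "\<And>y. y \<in> ?V \<Longrightarrow> g y \<le> K * np y" and y: "y \<in> ?V" for g y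
  proof -
    have y': "- y \<in> ?V" using W y by (rule subspace_neg)
    have n: "g (- y) = - g y" by (rule linear_functional_on_neg[OF g(1) y])
    have "K * np y \<le> K * nrm y" "K * np (- y) \<le> K * nrm (- y)"
      using np_le[OF y] np_le[OF y'] K by (auto intro: mult_left_mono)
    moreover have "nrm (- y) = nrm y" by (simp add: lp_norm_def)
    ultimately show "\<bar>g y\<bar> \<le> K * nrm y" using g(2)[OF y] g(2)[OF y'] n by simp
    show "0 \<le> g y" if "\<And>\<omega>. 0 \<le> y \<omega>" using g(2)[OF y'] n np_nonpos[of "- y"] that by simp
  qed
  show ?thesis
  proof (rule that[OF l1 l2])
    show "f y = f1 y - f2 y" if "y \<in> ?V" for y using sym[OF that] by (simp add: f1_def)
  qed (use both[OF l1 up1] both[OF l2 up2] in auto)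
qed

lemma conjugate_exponent_cases:
  fixes q :: ennreal
  assumes q: "1 / ennreal p + 1 / q = 1"
  obtains "p = 1" "q = \<infinity>" | "1 < p" "q = ennreal (p / (p - 1))"
proof (cases q)
  case top
  then have "1 / ennreal p = 1" using q by simp
  then have "ennreal (1 / p) = ennreal 1" using p_ge_1 by (simp add: divide_ennreal[symmetric])
  then have "p = 1" using p_ge_1 by simp
  then show ?thesis using that(1) top by simp
next
  case (real r)
  have "r \<noteq> 0"
  proof
    assume "r = 0"
    then have "1 / q = top" using real by (simp add: ennreal_divide_zero)
    then show False using q by simp
  qed
  then have r: "r > 0" using real by simp
  have "1 / ennreal p = ennreal (1 / p)" "1 / q = ennreal (1 / r)"
    using p_ge_1 r real by (simp_all add: divide_ennreal[symmetric])
  with q have "ennreal (1 / p + 1 / r) = ennreal 1" using p_ge_1 r by (simp add: ennreal_plus[symmetric] del: ennreal_plus)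
  then have "1 / p + 1 / r = 1" using p_ge_1 r by (subst (asm) ennreal_inj) auto
  then have "r + p = p * r" using p_ge_1 r by (simp add: field_simps)
  then have "r * (p - 1) = p" by (simp add: algebra_simps)
  moreover from this have "p \<noteq> 1" using p_ge_1 by auto
  ultimately show ?thesis using that(2) p_ge_1 real by (simp add: field_simps)
qed

text \<open>For \<open>p > 1\<close> with conjugate exponent \<open>r\<close> test \<open>w\<close> against the function \<open>sgn w \<bar>w\<bar>\<^sup>r\<^sup>-\<^sup>1\<close> that attains
  equality in Hoelder's inequality, truncated at \<open>n\<close> to lie in \<open>L\<^sub>p\<close>: the resulting bound
  \<open>\<integral> min(\<bar>w\<bar>, n)\<^sup>r \<le> K\<^sup>r\<close> is uniform in \<open>n\<close>. For \<open>p = 1\<close> test against \<open>sgn w\<close> on the event that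
  \<open>\<bar>w\<bar>\<close> exceeds \<open>K\<close>, which must then be null.\<close>

lemma density_in_Lq:
  fixes w :: "'a \<Rightarrow> real"
  assumes G: "subalgebra M G" and q: "1 / ennreal p + 1 / q = 1" and K: "0 \<le> K"
    and w: "w \<in> borel_measurable G"
    and bound: "\<And>y. y \<in> Lp G \<Longrightarrow> integrable M (\<lambda>\<omega>. w \<omega> * y \<omega>) \<and> \<bar>\<integral>\<omega>. w \<omega> * y \<omega> \<partial>M\<bar> \<le> K * nrm y"
  shows "w \<in> lp_space q M G"
proof -
  have [measurable]: "w \<in> borel_measurable M" by (rule measurable_from_subalg[OF G w])
  from q show ?thesis
  proof (cases rule: conjugate_exponent_cases)
    case 1
    define A where "A = {\<omega> \<in> space G. \<bar>w \<omega>\<bar> > K}"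
    have A: "A \<in> sets G" unfolding A_def using w by measurable
    then have [measurable]: "A \<in> sets M" using G by (auto simp: subalgebra_def)
    have sp: "space G = space M" using G by (simp add: subalgebra_def)
    define y where "y \<omega> = sgn (w \<omega>) * indicator A \<omega>" for \<omega>
    have yG: "y \<in> borel_measurable G" unfolding y_def using w A by measurable
    have y: "y \<in> Lp G"
      by (rule Lp_dominated[OF G yG Lp_const[of "1::real" G]]) (auto simp: y_def indicator_def sgn_real_def)
    have yI: "nrm y = (\<integral>\<omega>. indicator A \<omega> \<partial>M)"
    proof -
      have "norm (y \<omega>) = indicator A \<omega>" for \<omega>
        using K by (auto simp: y_def A_def indicator_def sgn_real_def)
      then show ?thesis using 1 by (simp add: lp_norm_def)
    qed
    have wy: "w \<omega> * y \<omega> = \<bar>w \<omega>\<bar> * indicator A \<omega>" for \<omega>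
      by (auto simp: y_def indicator_def sgn_real_def abs_if)
    have I: "integrable M (\<lambda>\<omega>. \<bar>w \<omega>\<bar> * indicator A \<omega>)"
      and le: "(\<integral>\<omega>. \<bar>w \<omega>\<bar> * indicator A \<omega> \<partial>M) \<le> K * (\<integral>\<omega>. indicator A \<omega> \<partial>M)"
      using bound[OF y] unfolding wy yI by auto
    have IA: "integrable M (indicator A :: 'a \<Rightarrow> real)" by (rule Lp_integrable[OF Lp_indicator[OF _ subalgebra_self]]) simp
    have "(\<integral>\<omega>. \<bar>w \<omega>\<bar> * indicator A \<omega> - K * indicator A \<omega> \<partial>M) \<le> 0"
      using le I IA by simp
    moreover have nn: "0 \<le> \<bar>w \<omega>\<bar> * indicator A \<omega> - K * indicator A \<omega>" for \<omega>
      by (auto simp: indicator_def A_def)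
    ultimately have "(\<integral>\<omega>. \<bar>w \<omega>\<bar> * indicator A \<omega> - K * indicator A \<omega> \<partial>M) = 0"
      by (intro antisym integral_nonneg_AE) auto
    then have "AE \<omega> in M. \<bar>w \<omega>\<bar> * indicator A \<omega> - K * indicator A \<omega> = 0"
      using I IA nn by (subst (asm) integral_nonneg_eq_0_iff_AE) auto
    then have "AE \<omega> in M. norm (w \<omega>) \<le> K"
      using AE_space by eventually_elim (auto simp: A_def indicator_def sp split: if_splits)
    then show ?thesis using w 1 by (auto simp: lp_space_def)
  next
    case 2
    define r where "r = p / (p - 1)"
    have r: "r > 1" "(r - 1) * p = r" using 2 by (auto simp: r_def field_simps)
    define a where "a n \<omega> = min \<bar>w \<omega>\<bar> (real n)" for n \<omega>
    have aG: "a n \<in> borel_measurable G" for n unfolding a_def using w by measurable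
    have aM [measurable]: "a n \<in> borel_measurable M" for n by (rule measurable_from_subalg[OF G aG])
    have a0: "0 \<le> a n \<omega>" for n \<omega> by (simp add: a_def)
    define y where "y n \<omega> = sgn (w \<omega>) * a n \<omega> powr (r - 1)" for n \<omega>
    have yG: "y n \<in> borel_measurable G" for n unfolding y_def using w aG by measurable
    have y: "y n \<in> Lp G" for n
    proof (rule Lp_dominated[OF G yG Lp_const[of "real n powr (r - 1)" G]])
      show "AE \<omega> in M. norm (y n \<omega>) \<le> norm (real n powr (r - 1))"
        using r by (intro AE_I2) (auto simp: y_def a_def abs_mult sgn_real_def intro: powr_mono2)
    qed
    have int_a: "integrable M (\<lambda>\<omega>. a n \<omega> powr r)" for n
    proof (rule Bochner_Integration.integrable_bound)
      show "integrable M (\<lambda>\<omega>. real n powr r)" by simp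
      show "AE \<omega> in M. norm (a n \<omega> powr r) \<le> norm (real n powr r)"
        using r by (intro AE_I2) (auto simp: a_def intro: powr_mono2)
    qed measurable
    define I where "I n = (\<integral>\<omega>. a n \<omega> powr r \<partial>M)" for n
    have I0: "0 \<le> I n" for n unfolding I_def by (intro integral_nonneg_AE) auto
    have nrm_y: "nrm (y n) = I n powr (1 / p)" for n
    proof -
      have "norm (y n \<omega>) powr p = a n \<omega> powr r" for \<omega>
      proof (cases "w \<omega> = 0")
        case True
        then show ?thesis using r by (simp add: y_def a_def)
      next
        case False
        then have "norm (y n \<omega>) = a n \<omega> powr (r - 1)" by (simp add: y_def abs_mult sgn_real_def)
        then show ?thesis by (simp add: powr_powr r(2))
      qed
      then show ?thesis by (simp add: lp_norm_def I_def)
    qed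
    have "I n \<le> K powr r" for n
    proof -
      have "a n \<omega> powr r \<le> w \<omega> * y n \<omega>" for \<omega>
      proof -
        have "a n \<omega> powr r = a n \<omega> * a n \<omega> powr (r - 1)"
          using a0[of n \<omega>] powr_mult_base[of "a n \<omega>" "r - 1"] by simp
        also have "\<dots> \<le> \<bar>w \<omega>\<bar> * a n \<omega> powr (r - 1)" by (intro mult_right_mono) (auto simp: a_def)
        also have "\<dots> = w \<omega> * y n \<omega>" by (auto simp: y_def sgn_real_def)
        finally show ?thesis .
      qed
      then have "I n \<le> (\<integral>\<omega>. w \<omega> * y n \<omega> \<partial>M)"
        unfolding I_def using bound[OF y] int_a by (intro integral_mono) auto
      also have "\<dots> \<le> K * nrm (y n)" using bound[OF y, of n] by (auto dest: abs_le_D1)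
      finally have le: "I n \<le> K * I n powr (1 / p)" by (simp add: nrm_y)
      show ?thesis
      proof (cases "I n = 0")
        case False
        then have pos: "I n > 0" using I0[of n] by simp
        have "I n = I n powr (1 / r) * I n powr (1 / p)"
        proof -
          have "1 / r + 1 / p = 1" using 2 by (simp add: r_def field_simps)
          then show ?thesis using pos by (simp add: powr_add[symmetric])
        qed
        with le pos have "I n powr (1 / r) \<le> K" by (metis mult_le_cancel_right_pos powr_gt_zero less_irrefl)
        then have "(I n powr (1 / r)) powr r \<le> K powr r" using r by (intro powr_mono2) auto
        then show ?thesis using pos r by (simp add: powr_powr)
      qed simp
    qed
    moreover have inc: "incseq I"
      unfolding incseq_def I_def using r
      by (intro allI impI integral_mono int_a) (auto simp: a_def intro!: powr_mono2)
    ultimately obtain l where l: "I \<longlonglongrightarrow> l" using incseq_convergent[OF inc, of "K powr r"] by metis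
    have "integrable M (\<lambda>\<omega>. \<bar>w \<omega>\<bar> powr r)"
    proof (rule integrable_monotone_convergence[OF int_a])
      show "AE \<omega> in M. mono (\<lambda>n. a n \<omega> powr r)"
        using r by (intro AE_I2) (auto simp: mono_def a_def intro!: powr_mono2)
      show "(\<lambda>n. \<integral>\<omega>. a n \<omega> powr r \<partial>M) \<longlonglongrightarrow> l" using l by (simp add: I_def[abs_def])
      show "AE \<omega> in M. (\<lambda>n. a n \<omega> powr r) \<longlonglongrightarrow> \<bar>w \<omega>\<bar> powr r"
      proof (rule AE_I2)
        fix \<omega>
        obtain N where N: "\<bar>w \<omega>\<bar> \<le> real N" using real_arch_simple by blast
        have "eventually (\<lambda>n. a n \<omega> powr r = \<bar>w \<omega>\<bar> powr r) sequentially"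
          using eventually_ge_at_top[of N] by eventually_elim (use N in \<open>auto simp: a_def min_def\<close>)
        then show "(\<lambda>n. a n \<omega> powr r) \<longlonglongrightarrow> \<bar>w \<omega>\<bar> powr r" by (rule tendsto_eventually)
      qed
    qed measurable
    then show ?thesis using w 2 r by (simp add: lp_space_def r_def[symmetric])
  qed
qed

lemma Lq_integrable:
  fixes w :: "'a \<Rightarrow> 'b::euclidean_space"
  assumes "subalgebra M G" "1 / ennreal p + 1 / q = 1" "w \<in> lp_space q M G"
  shows "integrable M w"
  using assms(2)
proof (cases rule: conjugate_exponent_cases)
  case 1
  then obtain C where "AE \<omega> in M. norm (w \<omega>) \<le> C" using assms(3) by (auto simp: lp_space_def)
  moreover have "w \<in> borel_measurable M"
    using assms by (intro measurable_from_subalg[OF assms(1)]) (simp add: lp_space_def)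
  ultimately show ?thesis by (intro integrable_const_bound[of _ C])
next
  case 2
  interpret r: lp_exponent M "p / (p - 1)" by unfold_locales (use 2 in \<open>simp add: field_simps\<close>)
  show ?thesis using assms 2 by (intro r.Lp_integrable r.Lp_subalgebra[of G]) auto
qed

lemma Lq_sum_scaleR:
  fixes w :: "'i \<Rightarrow> 'a \<Rightarrow> real" and b :: "'i \<Rightarrow> 'b::euclidean_space"
  assumes G: "subalgebra M G" and q: "1 / ennreal p + 1 / q = 1" and I: "finite I"
    and w: "\<And>i. i \<in> I \<Longrightarrow> w i \<in> lp_space q M G"
  shows "(\<lambda>\<omega>. \<Sum>i\<in>I. w i \<omega> *\<^sub>R b i) \<in> lp_space q M G"
  using q
proof (cases rule: conjugate_exponent_cases)
  case 1
  have "\<exists>C. AE \<omega> in M. norm (w i \<omega>) \<le> C" if "i \<in> I" for i using w[OF that] 1 by (simp add: lp_space_def)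
  then obtain C where C: "\<And>i. i \<in> I \<Longrightarrow> AE \<omega> in M. norm (w i \<omega>) \<le> C i" by metis
  have "AE \<omega> in M. \<forall>i\<in>I. norm (w i \<omega>) \<le> C i" using C I by (simp add: AE_ball_countable countable_finite)
  then have "AE \<omega> in M. norm (\<Sum>i\<in>I. w i \<omega> *\<^sub>R b i) \<le> (\<Sum>i\<in>I. C i * norm (b i))"
    by eventually_elim (auto intro!: sum_norm_le mult_right_mono)
  moreover have "(\<lambda>\<omega>. \<Sum>i\<in>I. w i \<omega> *\<^sub>R b i) \<in> borel_measurable G"
    using w by (intro borel_measurable_sum borel_measurable_scaleR) (auto simp: lp_space_def)
  ultimately show ?thesis using 1 by (auto simp: lp_space_def)
next
  case 2
  interpret r: lp_exponent M "p / (p - 1)" by unfold_locales (use 2 in \<open>simp add: field_simps\<close>)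
  show ?thesis
    unfolding 2
  proof (intro r.Lp_sum G)
    fix i assume i: "i \<in> I"
    have wi: "w i \<in> r.Lp G" using w[OF i] 2 by simp
    have "(\<lambda>\<omega>. norm (b i) *\<^sub>R w i \<omega>) \<in> r.Lp G" using wi by (rule r.Lp_scaleR)
    moreover have "(\<lambda>\<omega>. w i \<omega> *\<^sub>R b i) \<in> borel_measurable G" using r.Lp_measurable[OF wi] by measurable
    ultimately show "(\<lambda>\<omega>. w i \<omega> *\<^sub>R b i) \<in> r.Lp G"
      by (intro r.Lp_dominated[OF G]) (auto simp: abs_mult mult.commute)
  qed
qed

text \<open>Riesz representation: split into positive functionals, represent each by a density, and work
  coordinate by coordinate.\<close>

theorem Lp_functional_representation:
  fixes f :: "('a \<Rightarrow> 'b::euclidean_space) \<Rightarrow> real"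
  assumes G: "subalgebra M G" and q: "1 / ennreal p + 1 / q = 1"
    and f: "linear_functional_on (Lp G) f" and K: "0 \<le> K"
    and bound: "\<And>y. y \<in> Lp G \<Longrightarrow> \<bar>f y\<bar> \<le> K * nrm y"
  obtains w where "w \<in> lp_space q M G"
    "\<And>y. y \<in> Lp G \<Longrightarrow> integrable M (\<lambda>\<omega>. w \<omega> \<bullet> y \<omega>) \<and> f y = pairing M w y"
proof -
  have scalar: "\<exists>w. w \<in> lp_space q M G \<and>
      (\<forall>y \<in> Lp G. integrable M (\<lambda>\<omega>. w \<omega> * y \<omega>) \<and> g y = (\<integral>\<omega>. w \<omega> * y \<omega> \<partial>M))"
    if g: "linear_functional_on (Lp G) g" and C: "0 \<le> C"
      and gb: "\<And>y. y \<in> Lp G \<Longrightarrow> \<bar>g y\<bar> \<le> C * nrm y" for g :: "('a \<Rightarrow> real) \<Rightarrow> real" and C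
  proof -
    obtain g1 g2 where lin: "linear_functional_on (Lp G) g1" "linear_functional_on (Lp G) g2"
      and g12: "\<And>y. y \<in> Lp G \<Longrightarrow> g y = g1 y - g2 y"
      and bnd: "\<And>y. y \<in> Lp G \<Longrightarrow> \<bar>g1 y\<bar> \<le> C * nrm y" "\<And>y. y \<in> Lp G \<Longrightarrow> \<bar>g2 y\<bar> \<le> C * nrm y"
      and pos: "\<And>y. y \<in> Lp G \<Longrightarrow> (\<And>\<omega>. 0 \<le> y \<omega>) \<Longrightarrow> 0 \<le> g1 y"
        "\<And>y. y \<in> Lp G \<Longrightarrow> (\<And>\<omega>. 0 \<le> y \<omega>) \<Longrightarrow> 0 \<le> g2 y"
      by (rule bounded_functional_decomposition[OF G g gb C]) (assumption+, blast)
    obtain w1 :: "'a \<Rightarrow> real" where w1: "w1 \<in> borel_measurable G"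
      "\<And>y. y \<in> Lp G \<Longrightarrow> integrable M (\<lambda>\<omega>. w1 \<omega> * y \<omega>) \<and> g1 y = (\<integral>\<omega>. w1 \<omega> * y \<omega> \<partial>M)"
      using positive_functional_representation[OF G lin(1) bnd(1) pos(1)] by blast
    obtain w2 :: "'a \<Rightarrow> real" where w2: "w2 \<in> borel_measurable G"
      "\<And>y. y \<in> Lp G \<Longrightarrow> integrable M (\<lambda>\<omega>. w2 \<omega> * y \<omega>) \<and> g2 y = (\<integral>\<omega>. w2 \<omega> * y \<omega> \<partial>M)"
      using positive_functional_representation[OF G lin(2) bnd(2) pos(2)] by blast
    define w where "w \<omega> = w1 \<omega> - w2 \<omega>" for \<omega>
    have wG: "w \<in> borel_measurable G" unfolding w_def using w1(1) w2(1) by measurable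
    have rep: "integrable M (\<lambda>\<omega>. w \<omega> * y \<omega>) \<and> g y = (\<integral>\<omega>. w \<omega> * y \<omega> \<partial>M)" if "y \<in> Lp G" for y
      using w1(2)[OF that] w2(2)[OF that] g12[OF that] by (simp add: w_def left_diff_distrib)
    have "w \<in> lp_space q M G"
      using rep gb by (intro density_in_Lq[OF G q C wG]) auto
    with rep show ?thesis by blast
  qed
  have sc: "(\<lambda>\<omega>. u \<omega> *\<^sub>R b) \<in> Lp G" if "b \<in> Basis" "u \<in> Lp G" for b :: 'b and u :: "'a \<Rightarrow> real"
    by (rule Lp_dominated[OF G _ that(2)]) (use that Lp_measurable[OF that(2)] in auto)
  have "\<exists>w. w \<in> lp_space q M G \<and> (\<forall>u \<in> Lp G. integrable M (\<lambda>\<omega>. w \<omega> * u \<omega>)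
      \<and> f (\<lambda>\<omega>. u \<omega> *\<^sub>R b) = (\<integral>\<omega>. w \<omega> * u \<omega> \<partial>M))" if b: "b \<in> Basis" for b
  proof (rule scalar[OF _ K])
    show "linear_functional_on (Lp G) (\<lambda>u. f (\<lambda>\<omega>. u \<omega> *\<^sub>R b))"
      unfolding linear_functional_on_def
    proof (intro conjI ballI allI)
      fix u v :: "'a \<Rightarrow> real" assume "u \<in> Lp G" "v \<in> Lp G"
      then show "f (\<lambda>\<omega>. (u + v) \<omega> *\<^sub>R b) = f (\<lambda>\<omega>. u \<omega> *\<^sub>R b) + f (\<lambda>\<omega>. v \<omega> *\<^sub>R b)"
        using linear_functional_on_add[OF f sc[OF b] sc[OF b]] by (simp add: plus_fun_def scaleR_add_left)
    next
      fix u :: "'a \<Rightarrow> real" and c assume "u \<in> Lp G"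
      then show "f (\<lambda>\<omega>. (c *\<^sub>R u) \<omega> *\<^sub>R b) = c * f (\<lambda>\<omega>. u \<omega> *\<^sub>R b)"
        using linear_functional_on_scale[OF f sc[OF b], of u c] by (simp add: scaleR_fun_def)
    qed
    show "\<bar>f (\<lambda>\<omega>. u \<omega> *\<^sub>R b)\<bar> \<le> K * nrm u" if "u \<in> Lp G" for u :: "'a \<Rightarrow> real"
      using bound[OF sc[OF b that]] b by (simp add: lp_norm_def)
  qed
  then obtain w where w: "\<And>b. b \<in> Basis \<Longrightarrow> w b \<in> lp_space q M G"
    and wr: "\<And>b u. b \<in> Basis \<Longrightarrow> u \<in> Lp G \<Longrightarrow> integrable M (\<lambda>\<omega>. w b \<omega> * u \<omega>)
      \<and> f (\<lambda>\<omega>. u \<omega> *\<^sub>R b) = (\<integral>\<omega>. w b \<omega> * u \<omega> \<partial>M)" by metis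
  show ?thesis
  proof (rule that)
    show "(\<lambda>\<omega>. \<Sum>b\<in>Basis. w b \<omega> *\<^sub>R b) \<in> lp_space q M G"
      using w by (intro Lq_sum_scaleR[OF G q]) auto
    fix y :: "'a \<Rightarrow> 'b" assume y: "y \<in> Lp G"
    have yb: "(\<lambda>\<omega>. y \<omega> \<bullet> b) \<in> Lp G" if "b \<in> Basis" for b
      by (rule Lp_dominated[OF G _ y]) (use that Lp_measurable[OF y] in \<open>auto simp: Basis_le_norm\<close>)
    have ip: "(\<Sum>b\<in>Basis. w b \<omega> *\<^sub>R b) \<bullet> y \<omega> = (\<Sum>b\<in>Basis. w b \<omega> * (y \<omega> \<bullet> b))" for \<omega>
      by (subst inner_sum_left) (auto intro!: sum.cong simp: inner_commute)
    have "(\<Sum>b\<in>Basis. (\<lambda>\<omega>. (y \<omega> \<bullet> b) *\<^sub>R b)) = y"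
      by (rule ext) (simp add: sum_fun_apply euclidean_representation)
    then have "f y = f (\<Sum>b\<in>Basis. (\<lambda>\<omega>. (y \<omega> \<bullet> b) *\<^sub>R b))" by simp
    also have "\<dots> = (\<Sum>b\<in>Basis. f (\<lambda>\<omega>. (y \<omega> \<bullet> b) *\<^sub>R b))"
      using sc yb by (intro linear_functional_on_sum[OF f subspace_Lp[OF G]]) auto
    also have "\<dots> = (\<Sum>b\<in>Basis. \<integral>\<omega>. w b \<omega> * (y \<omega> \<bullet> b) \<partial>M)"
      using wr yb by (intro sum.cong) auto
    also have "\<dots> = (\<integral>\<omega>. (\<Sum>b\<in>Basis. w b \<omega> * (y \<omega> \<bullet> b)) \<partial>M)"
      using wr yb by (subst Bochner_Integration.integral_sum) auto
    finally have "f y = pairing M (\<lambda>\<omega>. \<Sum>b\<in>Basis. w b \<omega> *\<^sub>R b) y" by (simp add: pairing_def ip)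
    moreover have "integrable M (\<lambda>\<omega>. \<Sum>b\<in>Basis. w b \<omega> * (y \<omega> \<bullet> b))"
      using wr yb by (intro Bochner_Integration.integrable_sum) auto
    ultimately show "integrable M (\<lambda>\<omega>. (\<Sum>b\<in>Basis. w b \<omega> *\<^sub>R b) \<bullet> y \<omega>)
        \<and> f y = pairing M (\<lambda>\<omega>. \<Sum>b\<in>Basis. w b \<omega> *\<^sub>R b) y" by (simp add: ip)
  qed
qed

end

section \<open>Measurable selection of zeros\<close>

text \<open>Being at distance less than \<open>c\<close> from a nonempty set means that the set meets an open ball, which
  is exactly the kind of event whose measurability is assumed of a multifunction.\<close>

lemma borel_measurable_infdist_const:
  fixes Y :: "'a \<Rightarrow> 'b::euclidean_space set"
  assumes Y: "measurable_multifunction G Y"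
  shows "(\<lambda>\<omega>. infdist \<eta> (Y \<omega>)) \<in> borel_measurable G"
proof (rule borel_measurableI_less)
  fix c :: real
  have hit: "{\<omega> \<in> space G. Y \<omega> \<inter> U \<noteq> {}} \<in> sets G" if "open U" for U
    using Y that by (simp add: measurable_multifunction_def)
  \<comment> \<open>The distance to the empty set is 0 by convention; hence the second alternative.\<close>
  have iff: "infdist \<eta> S < c \<longleftrightarrow> S \<inter> ball \<eta> c \<noteq> {} \<or> (S \<inter> UNIV = {} \<and> 0 < c)" for S :: "'b set"
  proof (cases "S = {}")
    case False
    have "infdist \<eta> S < c \<longleftrightarrow> (\<exists>y\<in>S. dist \<eta> y < c)"
      unfolding infdist_notempty[OF False]
      by (rule cINF_less_iff[OF False]) (auto intro: bdd_belowI2[of _ 0])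
    then show ?thesis using False by auto
  qed (simp add: infdist_def)
  have "{\<omega> \<in> space G. infdist \<eta> (Y \<omega>) < c} =
      {\<omega> \<in> space G. Y \<omega> \<inter> ball \<eta> c \<noteq> {}} \<union>
      (if 0 < c then space G - {\<omega> \<in> space G. Y \<omega> \<inter> UNIV \<noteq> {}} else {})"
    unfolding iff by auto
  also have "\<dots> \<in> sets G" using hit[of "ball \<eta> c"] hit[of UNIV] by auto
  finally show "{\<omega> \<in> space G. infdist \<eta> (Y \<omega>) < c} \<in> sets G" .
qed

text \<open>The distance function is 1-Lipschitz, so the random point may be replaced by points of a countable
  dense set at the cost of the distance to them.\<close>

lemma borel_measurable_infdist_multifunction:
  fixes Y :: "'a \<Rightarrow> 'b::euclidean_space set"
  assumes Y: "measurable_multifunction G Y" and y: "y \<in> borel_measurable G"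
  shows "(\<lambda>\<omega>. infdist (y \<omega>) (Y \<omega>)) \<in> borel_measurable G"
proof (rule borel_measurableI_less)
  fix c :: real
  obtain D :: "'b set" where D: "countable D" "\<And>X. open X \<Longrightarrow> X \<noteq> {} \<Longrightarrow> \<exists>d\<in>D. d \<in> X"
    using countable_dense_setE by blast
  have iff: "infdist u S < c \<longleftrightarrow> (\<exists>d\<in>D. dist u d + infdist d S < c)" for u :: 'b and S
  proof
    assume "infdist u S < c"
    then obtain d where d: "d \<in> D" "dist u d < (c - infdist u S) / 2"
      using D(2)[of "ball u ((c - infdist u S) / 2)"] by auto
    have "infdist d S \<le> infdist u S + dist d u" by (rule infdist_triangle)
    with d show "\<exists>d\<in>D. dist u d + infdist d S < c" by (intro bexI[of _ d]) (auto simp: dist_commute)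
  next
    assume "\<exists>d\<in>D. dist u d + infdist d S < c"
    then show "infdist u S < c" by (metis add.commute infdist_triangle le_less_trans)
  qed
  have "{\<omega> \<in> space G. dist (y \<omega>) d + infdist d (Y \<omega>) < c} \<in> sets G" for d
    using y borel_measurable_infdist_const[OF Y, of d] by measurable
  then have "(\<Union>d\<in>D. {\<omega> \<in> space G. dist (y \<omega>) d + infdist d (Y \<omega>) < c}) \<in> sets G"
    using D(1) by (intro sets.countable_UN') auto
  also have "(\<Union>d\<in>D. {\<omega> \<in> space G. dist (y \<omega>) d + infdist d (Y \<omega>) < c}) = {\<omega> \<in> space G. infdist (y \<omega>) (Y \<omega>) < c}"
    unfolding iff by auto
  finally show "{\<omega> \<in> space G. infdist (y \<omega>) (Y \<omega>) < c} \<in> sets G" .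
qed

lemma geometric_steps_convergent:
  fixes x :: "nat \<Rightarrow> 'b::banach"
  assumes "\<And>k. norm (x (Suc k) - x k) \<le> c * (1/2) ^ k"
  shows "convergent x"
proof -
  have "summable (\<lambda>k. x (Suc k) - x k)"
  proof (rule summable_comparison_test'[where N = 0])
    show "summable (\<lambda>k. c * (1/2) ^ k :: real)" by (intro summable_mult summable_geometric) simp
  qed (rule assms)
  then have "convergent (\<lambda>n. \<Sum>k<n. x (Suc k) - x k)" by (simp add: summable_iff_convergent)
  then have "convergent (\<lambda>n. (x n - x 0) + x 0)"
    by (intro convergent_add convergent_const) (simp add: sum_lessThan_telescope)
  then show ?thesis by simp
qed

text \<open>Whether a small ball meets the zero set of \<open>h(\<sqdot>, \<omega>)\<close> can be decided by looking at the values of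
  \<open>h\<close> on a countable dense set only, and is therefore a measurable event. Choosing at each step the
  first dense point whose ball of radius \<open>2\<^sup>-\<^sup>k\<close> meets the zero set and that is close to the previous
  choice gives measurable approximations that converge to a zero.\<close>

lemma measurable_zero_selection:
  fixes h :: "'b::euclidean_space \<Rightarrow> 'a \<Rightarrow> real"
  assumes meas: "\<And>\<xi>. h \<xi> \<in> borel_measurable G" and nonneg: "\<And>\<xi> \<omega>. 0 \<le> h \<xi> \<omega>"
    and zero: "AE \<omega> in M. continuous_on UNIV (\<lambda>\<xi>. h \<xi> \<omega>) \<and> (\<exists>\<xi>. h \<xi> \<omega> = 0)"
  obtains z where "z \<in> borel_measurable G" "AE \<omega> in M. h (z \<omega>) \<omega> = 0"
proof -
  obtain D :: "'b set" where D: "countable D" "\<And>X. open X \<Longrightarrow> X \<noteq> {} \<Longrightarrow> \<exists>d\<in>D. d \<in> X"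
    using countable_dense_setE by blast
  then have "D \<noteq> {}" by force
  define d where "d = from_nat_into D"
  have dense: "\<exists>m. d m \<in> X" if "open X" "X \<noteq> {}" for X
    using D that \<open>D \<noteq> {}\<close> unfolding d_def by (metis from_nat_into_surj)
  define hit where "hit i r \<omega> \<longleftrightarrow> (\<forall>j::nat. \<exists>m. dist (d i) (d m) < r \<and> h (d m) \<omega> < 1 / real (Suc j))"
    for i \<omega> and r :: real
  have hit_meas [measurable]: "Measurable.pred G (hit i r)" for i r
    unfolding hit_def using meas by measurable
  define idx where "idx = rec_nat (\<lambda>\<omega>. LEAST i. hit i 1 \<omega>)
     (\<lambda>k g \<omega>. LEAST i. hit i ((1/2) ^ Suc k) \<omega> \<and> dist (d i) (d (g \<omega>)) \<le> 2 * (1/2) ^ k)"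
  have idx0: "idx 0 = (\<lambda>\<omega>. LEAST i. hit i 1 \<omega>)" by (simp add: idx_def)
  have idxS: "idx (Suc k) = (\<lambda>\<omega>. LEAST i. hit i ((1/2) ^ Suc k) \<omega> \<and> dist (d i) (d (idx k \<omega>)) \<le> 2 * (1/2) ^ k)" for k
    by (simp add: idx_def)
  have idx_meas [measurable]: "idx k \<in> measurable G (count_space UNIV)" for k
  proof (induction k)
    case 0
    show ?case unfolding idx0 by measurable
  next
    case (Suc k)
    note Suc [measurable]
    show ?case unfolding idxS by measurable
  qed
  define z where "z \<omega> = lim (\<lambda>k. d (idx k \<omega>))" for \<omega>
  have dm: "(\<lambda>\<omega>. d (idx k \<omega>)) \<in> borel_measurable G" for k
    by (rule measurable_compose[OF idx_meas]) simp
  have zm: "z \<in> borel_measurable G"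
    unfolding z_def by (intro borel_measurable_lim_metric dm)
  have "h (z \<omega>) \<omega> = 0" if cont: "continuous_on UNIV (\<lambda>\<xi>. h \<xi> \<omega>)" and ex: "\<exists>\<xi>. h \<xi> \<omega> = 0" for \<omega>
  proof -
    have hitD: "\<exists>\<xi>\<in>cball (d i) r. h \<xi> \<omega> = 0" if "hit i r \<omega>" for i r
    proof -
      have ne: "cball (d i) r \<noteq> {}" 
      proof -
        obtain m where "dist (d i) (d m) < r" using \<open>hit i r \<omega>\<close> unfolding hit_def by blast
        then show ?thesis using zero_le_dist[of "d i" "d m"] by (simp add: not_less del: zero_le_dist)
      qed
      obtain \<xi> where \<xi>: "\<xi> \<in> cball (d i) r" "\<And>\<xi>'. \<xi>' \<in> cball (d i) r \<Longrightarrow> h \<xi> \<omega> \<le> h \<xi>' \<omega>"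
        using continuous_attains_inf[OF compact_cball ne continuous_on_subset[OF cont]] by auto
      have "h \<xi> \<omega> \<le> 1 / real (Suc j)" for j
      proof -
        obtain m where "dist (d i) (d m) < r" "h (d m) \<omega> < 1 / real (Suc j)"
          using \<open>hit i r \<omega>\<close> unfolding hit_def by blast
        then show ?thesis using \<xi>(2)[of "d m"] by simp
      qed
      then have "h \<xi> \<omega> \<le> 0"
        using LIMSEQ_le_const[OF LIMSEQ_inverse_real_of_nat] by (auto simp: inverse_eq_divide)
      then show ?thesis using \<xi>(1) nonneg[of \<xi> \<omega>] by (intro bexI[of _ \<xi>]) auto
    qed
    have hitI: "hit i r \<omega>" if "h \<xi> \<omega> = 0" "dist (d i) \<xi> < r" for i r \<xi>
      unfolding hit_def
    proof
      fix j
      have "open (ball (d i) r \<inter> {\<xi>. h \<xi> \<omega> < 1 / real (Suc j)})"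
        using cont by (intro open_Int open_ball open_Collect_less continuous_on_const)
      moreover have "\<xi> \<in> ball (d i) r \<inter> {\<xi>. h \<xi> \<omega> < 1 / real (Suc j)}" using that by simp
      ultimately show "\<exists>m. dist (d i) (d m) < r \<and> h (d m) \<omega> < 1 / real (Suc j)"
        using dense by fastforce
    qed
    have approx: "\<exists>i. dist (d i) \<xi> < r" if "r > 0" for \<xi> r
      using dense[of "ball \<xi> r"] that by (auto simp: dist_commute)
    have step: "hit (idx (Suc k) \<omega>) ((1/2) ^ Suc k) \<omega> \<and> dist (d (idx (Suc k) \<omega>)) (d (idx k \<omega>)) \<le> 2 * (1/2) ^ k"
      if now: "hit (idx k \<omega>) ((1/2) ^ k) \<omega>" for k
    proof -
      obtain \<xi> where \<xi>: "dist (d (idx k \<omega>)) \<xi> \<le> (1/2) ^ k" "h \<xi> \<omega> = 0" using hitD[OF now] by auto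
      obtain i where i: "dist (d i) \<xi> < (1/2) ^ Suc k" using approx[of "(1/2) ^ Suc k" \<xi>] by auto
      have "dist (d i) (d (idx k \<omega>)) \<le> dist (d i) \<xi> + dist (d (idx k \<omega>)) \<xi>" by (rule dist_triangle2)
      also have "\<dots> \<le> 2 * (1/2) ^ k" using \<xi>(1) i[unfolded power_Suc] zero_le_power[of "1/2::real" k] by linarith
      finally have "hit i ((1/2) ^ Suc k) \<omega> \<and> dist (d i) (d (idx k \<omega>)) \<le> 2 * (1/2) ^ k"
        using hitI[OF \<xi>(2) i] by simp
      then show ?thesis unfolding idxS by (rule LeastI)
    qed
    have hk: "hit (idx k \<omega>) ((1/2) ^ k) \<omega>" for k
    proof (induction k)
      case 0
      obtain \<xi> where "h \<xi> \<omega> = 0" using ex by blast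
      then obtain i where "hit i 1 \<omega>" using approx[of 1 \<xi>] hitI by (metis zero_less_one)
      then show ?case unfolding idx0 by (auto intro: LeastI)
    qed (use step in blast)
    have "convergent (\<lambda>k. d (idx k \<omega>))"
      by (rule geometric_steps_convergent[of _ 2]) (use step[OF hk, THEN conjunct2] in \<open>simp only: dist_norm\<close>)
    then have lim: "(\<lambda>k. d (idx k \<omega>)) \<longlonglongrightarrow> z \<omega>" by (simp add: z_def convergent_LIMSEQ_iff)
    have "\<exists>\<xi>. dist (d (idx k \<omega>)) \<xi> \<le> (1/2) ^ k \<and> h \<xi> \<omega> = 0" for k
      using hitD[OF hk[of k]] by auto
    then obtain \<xi> where \<xi>: "\<And>k. dist (d (idx k \<omega>)) (\<xi> k) \<le> (1/2) ^ k" "\<And>k. h (\<xi> k) \<omega> = 0" by metis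
    have "(\<lambda>k. \<xi> k - d (idx k \<omega>)) \<longlonglongrightarrow> 0"
    proof (rule Lim_null_comparison)
      show "eventually (\<lambda>k. norm (\<xi> k - d (idx k \<omega>)) \<le> (1/2) ^ k) sequentially"
        using \<xi>(1) unfolding dist_norm by (intro always_eventually allI) (subst norm_minus_commute)
      show "(\<lambda>k. (1/2::real) ^ k) \<longlonglongrightarrow> 0" by (rule LIMSEQ_power_zero) simp
    qed
    from tendsto_add[OF this lim] have "\<xi> \<longlonglongrightarrow> z \<omega>" by simp
    then have "(\<lambda>k. h (\<xi> k) \<omega>) \<longlonglongrightarrow> h (z \<omega>) \<omega>"
      using continuous_on_tendsto_compose[OF cont, of \<xi> "z \<omega>" sequentially] by simp
    then show ?thesis using \<xi>(2) by (simp add: LIMSEQ_const_iff)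
  qed
  then have "AE \<omega> in M. h (z \<omega>) \<omega> = 0" using zero by (elim eventually_mono) blast
  with zm show ?thesis by (rule that)
qed

section \<open>Recourse and the distance to feasible policies\<close>

lemma block_upd_diff:
  fixes \<xi> \<eta> :: "'b::real_normed_vector"
  shows
  "block_upd \<zeta> t \<xi> - block_upd \<zeta> t \<eta> = axis t (\<xi> - \<eta>)"
  by (auto simp: block_upd_def axis_def vec_eq_iff)

lemma norm_axis: "norm (axis t v :: ('b::real_normed_vector)^'t) = norm v"
proof -
  have "norm (axis t v :: 'b^'t) = sqrt (\<Sum>s\<in>UNIV. if s = t then (norm v)\<^sup>2 else 0)"
    unfolding norm_vec_def L2_set_def by (intro arg_cong[where f = sqrt] sum.cong) (auto simp: axis_def)
  then show ?thesis by simp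
qed

lemma block_upd_self: "block_upd \<zeta> t (\<zeta> $ t) = \<zeta>"
  by (auto simp: block_upd_def vec_eq_iff)

locale recourse_problem = lp_exponent M p for M :: "'a measure" and p +
  fixes \<F> :: "'t::{finite,linorder} \<Rightarrow> 'a measure"
    and f :: "'t \<Rightarrow> (real^'n, 't) vec \<Rightarrow> 'a \<Rightarrow> real^'m"
    and f' :: "'t \<Rightarrow> (real^'n, 't) vec \<Rightarrow> 'a \<Rightarrow> (real^'n, 't) vec \<Rightarrow>\<^sub>L (real^'m)"
    and F :: "('a \<Rightarrow> (real^'n, 't) vec) \<Rightarrow> ('a \<Rightarrow> (real^'m, 't) vec)"
    and Y :: "'t \<Rightarrow> 'a \<Rightarrow> (real^'m) set"
    and X :: "'t \<Rightarrow> 'a \<Rightarrow> (real^'n) set"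
  assumes sub: "\<And>t. subalgebra M (\<F> t)"
    and filtration: "\<And>s t. s \<le> t \<Longrightarrow> sets (\<F> s) \<subseteq> sets (\<F> t)"
    and causal: "causal_operator (ennreal p) M \<F> f F"
    and smooth: "smooth_bounded_jacobian (ennreal p) M \<F> f f'"
    and Y: "\<And>t. measurable_multifunction (\<F> t) (Y t)"
      "\<And>t \<omega>. \<omega> \<in> space M \<Longrightarrow> convex (Y t \<omega>) \<and> closed (Y t \<omega>)"
    and X: "\<And>t. measurable_multifunction (\<F> t) (X t)"
      "\<And>t \<omega>. \<omega> \<in> space M \<Longrightarrow> convex (X t \<omega>) \<and> closed (X t \<omega>)"
    and recourse: "complete_subregular_recourse M f Y X"
begin

lemma space_F: "space (\<F> t) = space M"
  using sub by (simp add: subalgebra_def)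

lemma borel_measurable_later:
  "x \<in> borel_measurable (\<F> s) \<Longrightarrow> s \<le> t \<Longrightarrow> x \<in> borel_measurable (\<F> t)"
  using filtration space_F by (intro measurable_from_subalg[of "\<F> t" "\<F> s"]) (auto simp: subalgebra_def)

lemma AE_all_stages: "(\<And>t::'t. AE \<omega> in M. P t \<omega>) \<Longrightarrow> AE \<omega> in M. \<forall>t. P t \<omega>"
  by (rule eventually_all_finite)

lemma causality:
  "\<omega> \<in> space M \<Longrightarrow> (\<And>s. s \<le> t \<Longrightarrow> \<xi> $ s = \<xi>' $ s) \<Longrightarrow> f t \<xi> \<omega> = f t \<xi>' \<omega>"
  using causal unfolding causal_operator_def by blast

lemma F_adapted: "x \<in> adapted \<F> \<Longrightarrow> F x \<in> adapted \<F>"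
  using causal by (simp add: causal_operator_def)

lemma AE_F: "x \<in> adapted \<F> \<Longrightarrow> AE \<omega> in M. F x \<omega> $ t = f t (x \<omega>) \<omega>"
  using causal by (simp add: causal_operator_def)

text \<open>Superposition with \<open>f t\<close> preserves measurability of arguments measurable at stage \<open>t\<close>; by causality
  the later blocks, which are not, may be replaced by zero.\<close>

lemma f_measurable:
  assumes "\<And>s. s \<le> t \<Longrightarrow> (\<lambda>\<omega>. x \<omega> $ s) \<in> borel_measurable (\<F> s)"
  shows "(\<lambda>\<omega>. f t (x \<omega>) \<omega>) \<in> borel_measurable (\<F> t)"
proof -
  define y where "y \<omega> = (\<chi> s. if s \<le> t then x \<omega> $ s else 0)" for \<omega>
  have "(\<lambda>\<omega>. y \<omega> $ s) \<in> borel_measurable (\<F> t)" for s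
    using assms[of s] borel_measurable_later[of _ s t] by (cases "s \<le> t") (auto simp: y_def)
  then have "y \<in> borel_measurable (\<F> t)" by (rule borel_measurable_vec)
  then have "(\<lambda>\<omega>. f t (y \<omega>) \<omega>) \<in> borel_measurable (\<F> t)"
    using causal by (simp add: causal_operator_def superpositionally_measurable_def)
  moreover have "f t (y \<omega>) \<omega> = f t (x \<omega>) \<omega>" if "\<omega> \<in> space (\<F> t)" for \<omega>
    using that by (intro causality) (auto simp: y_def space_F)
  ultimately show ?thesis by (simp cong: measurable_cong)
qed

lemma AE_has_derivative:
  "AE \<omega> in M. \<forall>t \<xi>. ((\<lambda>\<xi>. f t \<xi> \<omega>) has_derivative blinfun_apply (f' t \<xi> \<omega>)) (at \<xi>)"
proof (rule AE_all_stages)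
  fix t
  have "AE \<omega> in M. (\<forall>\<xi>. ((\<lambda>\<xi>. f t \<xi> \<omega>) has_derivative blinfun_apply (f' t \<xi> \<omega>)) (at \<xi>)) \<and>
        continuous_on UNIV (\<lambda>\<xi>. f' t \<xi> \<omega>)"
    using smooth by (simp add: smooth_bounded_jacobian_def)
  then show "AE \<omega> in M. \<forall>\<xi>. ((\<lambda>\<xi>. f t \<xi> \<omega>) has_derivative blinfun_apply (f' t \<xi> \<omega>)) (at \<xi>)"
    by eventually_elim blast
qed

lemma jacobian_bound:
  obtains C where "0 \<le> C" "AE \<omega> in M. \<forall>t \<xi>. norm (f' t \<xi> \<omega>) \<le> C"
proof -
  have "\<forall>t. \<exists>C. AE \<omega> in M. \<forall>\<xi>. norm (f' t \<xi> \<omega>) \<le> C"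
    using smooth by (simp add: smooth_bounded_jacobian_def)
  then obtain C where C: "\<And>t. AE \<omega> in M. \<forall>\<xi>. norm (f' t \<xi> \<omega>) \<le> C t" by metis
  have le: "C t \<le> (\<Sum>t\<in>UNIV. \<bar>C t\<bar>)" for t
    using member_le_sum[of t UNIV "\<lambda>t. \<bar>C t\<bar>"] by auto
  have "AE \<omega> in M. \<forall>t. \<forall>\<xi>. norm (f' t \<xi> \<omega>) \<le> C t" by (rule AE_all_stages[OF C])
  then have "AE \<omega> in M. \<forall>t \<xi>. norm (f' t \<xi> \<omega>) \<le> (\<Sum>t\<in>UNIV. \<bar>C t\<bar>)"
    by eventually_elim (use le order_trans in blast)
  moreover have "0 \<le> (\<Sum>t\<in>UNIV. \<bar>C t\<bar>)" by (simp add: sum_nonneg)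
  ultimately show ?thesis by (intro that)
qed

lemma f_lipschitz:
  obtains C where "0 \<le> C" "AE \<omega> in M. \<forall>t \<xi> \<xi>'. norm (f t \<xi> \<omega> - f t \<xi>' \<omega>) \<le> C * norm (\<xi> - \<xi>')"
proof -
  obtain C where C: "0 \<le> C" "AE \<omega> in M. \<forall>t \<xi>. norm (f' t \<xi> \<omega>) \<le> C" by (rule jacobian_bound)
  have "AE \<omega> in M. \<forall>t \<xi> \<xi>'. norm (f t \<xi> \<omega> - f t \<xi>' \<omega>) \<le> C * norm (\<xi> - \<xi>')"
    using C(2) AE_has_derivative
  proof eventually_elim
    case (elim \<omega>)
    show ?case
    proof (intro allI)
      fix t \<xi> \<xi>'
      show "norm (f t \<xi> \<omega> - f t \<xi>' \<omega>) \<le> C * norm (\<xi> - \<xi>')"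
      proof (rule differentiable_bound[where S = UNIV])
        show "((\<lambda>\<xi>. f t \<xi> \<omega>) has_derivative blinfun_apply (f' t x \<omega>)) (at x within UNIV)" for x
          using elim(2) by simp
        show "onorm (blinfun_apply (f' t x \<omega>)) \<le> C" for x
          using elim(1) by (simp add: norm_blinfun.rep_eq)
      qed auto
    qed
  qed
  with C(1) show ?thesis by (rule that)
qed

lemma recourse_constant:
  obtains C where "0 \<le> C" "AE \<omega> in M. \<forall>t \<zeta>. (\<forall>s<t. \<zeta> $ s \<in> X s \<omega>) \<longrightarrow>
        (\<forall>\<eta>. \<exists>\<xi>. f t (block_upd \<zeta> t \<xi>) \<omega> \<in> Y t \<omega> \<and> \<xi> \<in> X t \<omega> \<and>
           norm (\<xi> - \<eta>) \<le> C * (infdist (f t (block_upd \<zeta> t \<eta>) \<omega>) (Y t \<omega>) + infdist \<eta> (X t \<omega>)))"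
proof -
  obtain C where C: "\<And>t. AE \<omega> in M. \<forall>\<zeta>. (\<forall>s<t. \<zeta> $ s \<in> X s \<omega>) \<longrightarrow>
        (\<forall>\<eta>. \<exists>\<xi>. f t (block_upd \<zeta> t \<xi>) \<omega> \<in> Y t \<omega> \<and> \<xi> \<in> X t \<omega> \<and>
           norm (\<xi> - \<eta>) \<le> C * (infdist (f t (block_upd \<zeta> t \<eta>) \<omega>) (Y t \<omega>) + infdist \<eta> (X t \<omega>)))"
    using recourse unfolding complete_subregular_recourse_def by blast
  have "AE \<omega> in M. \<forall>t \<zeta>. (\<forall>s<t. \<zeta> $ s \<in> X s \<omega>) \<longrightarrow>
        (\<forall>\<eta>. \<exists>\<xi>. f t (block_upd \<zeta> t \<xi>) \<omega> \<in> Y t \<omega> \<and> \<xi> \<in> X t \<omega> \<and>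
           norm (\<xi> - \<eta>) \<le> C * (infdist (f t (block_upd \<zeta> t \<eta>) \<omega>) (Y t \<omega>) + infdist \<eta> (X t \<omega>)))"
    by (rule AE_all_stages) (rule C)
  then have "AE \<omega> in M. \<forall>t \<zeta>. (\<forall>s<t. \<zeta> $ s \<in> X s \<omega>) \<longrightarrow>
        (\<forall>\<eta>. \<exists>\<xi>. f t (block_upd \<zeta> t \<xi>) \<omega> \<in> Y t \<omega> \<and> \<xi> \<in> X t \<omega> \<and>
           norm (\<xi> - \<eta>) \<le> max C 0 * (infdist (f t (block_upd \<zeta> t \<eta>) \<omega>) (Y t \<omega>) + infdist \<eta> (X t \<omega>)))"
  proof eventually_elim
    case (elim \<omega>)
    show ?case
    proof (intro allI impI)
      fix t \<zeta> \<eta> assume "\<forall>s<t. \<zeta> $ s \<in> X s \<omega>"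
      then obtain \<xi> where \<xi>: "f t (block_upd \<zeta> t \<xi>) \<omega> \<in> Y t \<omega>" "\<xi> \<in> X t \<omega>"
        "norm (\<xi> - \<eta>) \<le> C * (infdist (f t (block_upd \<zeta> t \<eta>) \<omega>) (Y t \<omega>) + infdist \<eta> (X t \<omega>))"
        using elim by blast
      have "C * (infdist (f t (block_upd \<zeta> t \<eta>) \<omega>) (Y t \<omega>) + infdist \<eta> (X t \<omega>))
          \<le> max C 0 * (infdist (f t (block_upd \<zeta> t \<eta>) \<omega>) (Y t \<omega>) + infdist \<eta> (X t \<omega>))"
        by (intro mult_right_mono add_nonneg_nonneg infdist_nonneg) simp
      with \<xi> show "\<exists>\<xi>. f t (block_upd \<zeta> t \<xi>) \<omega> \<in> Y t \<omega> \<and> \<xi> \<in> X t \<omega> \<and>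
          norm (\<xi> - \<eta>) \<le> max C 0 * (infdist (f t (block_upd \<zeta> t \<eta>) \<omega>) (Y t \<omega>) + infdist \<eta> (X t \<omega>))"
        by (meson order_trans)
    qed
  qed
  then show ?thesis by (intro that[of "max C 0"]) auto
qed

definition repairs :: "'t set \<Rightarrow> real \<Rightarrow> ('a \<Rightarrow> (real^'n, 't) vec) \<Rightarrow> ('t \<Rightarrow> 'a \<Rightarrow> real^'m)
    \<Rightarrow> ('t \<Rightarrow> 'a \<Rightarrow> real^'n) \<Rightarrow> ('a \<Rightarrow> (real^'n, 't) vec) \<Rightarrow> bool" where
  "repairs A K x s r z \<longleftrightarrow>
     (\<forall>t. (\<lambda>\<omega>. z \<omega> $ t) \<in> borel_measurable (\<F> t)) \<and>
     (\<forall>t \<omega>. t \<notin> A \<longrightarrow> z \<omega> $ t = x \<omega> $ t) \<and>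
     (AE \<omega> in M. \<forall>t\<in>A. f t (z \<omega>) \<omega> \<in> Y t \<omega> \<and> z \<omega> $ t \<in> X t \<omega>) \<and>
     (AE \<omega> in M. norm (z \<omega> - x \<omega>)
        \<le> K * (\<Sum>t\<in>UNIV. norm (f t (x \<omega>) \<omega> - s t \<omega>) + norm (x \<omega> $ t - r t \<omega>)))"

text \<open>Induction over the stages. Having repaired all stages before \<open>b\<close>, recourse provides a
  correction at stage \<open>b\<close> whose size is controlled by the violation at \<open>b\<close>, and Lipschitz continuity
  of \<open>f b\<close> bounds that violation by the original one and the earlier corrections. The corrections are
  zeros of the sum of the two distances and the excess over the admissible size, and are
  therefore selected measurably.\<close>

lemma stagewise_repair:
  assumes "finite A" "\<And>a s. a \<in> A \<Longrightarrow> s \<le> a \<Longrightarrow> s \<in> A"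
  shows "\<exists>K\<ge>0. \<forall>x s r. (\<forall>t. (\<lambda>\<omega>. x \<omega> $ t) \<in> borel_measurable (\<F> t)) \<longrightarrow>
      (\<forall>t. s t \<in> borel_measurable (\<F> t) \<and> (AE \<omega> in M. s t \<omega> \<in> Y t \<omega>)) \<longrightarrow>
      (\<forall>t. r t \<in> borel_measurable (\<F> t) \<and> (AE \<omega> in M. r t \<omega> \<in> X t \<omega>)) \<longrightarrow>
      (\<exists>z. repairs A K x s r z)"
  using assms
proof (induction A rule: finite_linorder_max_induct)
  case empty
  show ?case by (intro exI[of _ 0]) (auto simp: repairs_def intro!: exI)
next
  case (insert b A)
  have down: "s \<in> A" if "a \<in> A" "s \<le> a" for a s
  proof -
    have "s \<in> insert b A" using insert.prems[of a s] that by blast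
    moreover have "s \<noteq> b" using insert.hyps(2) that by auto
    ultimately show ?thesis by blast
  qed
  have before: "A = {..<b}"
  proof
    show "{..<b} \<subseteq> A"
    proof
      fix s assume s: "s \<in> {..<b}"
      then have "s \<in> insert b A" using insert.prems[of b s] by auto
      then show "s \<in> A" using s by auto
    qed
  qed (use insert.hyps(2) in auto)
  obtain K where K: "K \<ge> 0"
    and IH: "\<forall>x s r. (\<forall>t. (\<lambda>\<omega>. x \<omega> $ t) \<in> borel_measurable (\<F> t)) \<longrightarrow>
      (\<forall>t. s t \<in> borel_measurable (\<F> t) \<and> (AE \<omega> in M. s t \<omega> \<in> Y t \<omega>)) \<longrightarrow>
      (\<forall>t. r t \<in> borel_measurable (\<F> t) \<and> (AE \<omega> in M. r t \<omega> \<in> X t \<omega>)) \<longrightarrow>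
      (\<exists>z. repairs A K x s r z)"
    by (rule exE[OF insert.IH]) (erule (1) down, elim conjE, rule that, assumption+)
  obtain L where L: "0 \<le> L" "AE \<omega> in M. \<forall>t \<xi> \<xi>'. norm (f t \<xi> \<omega> - f t \<xi>' \<omega>) \<le> L * norm (\<xi> - \<xi>')"
    by (rule f_lipschitz)
  obtain C where C: "0 \<le> C" "AE \<omega> in M. \<forall>t \<zeta>. (\<forall>s<t. \<zeta> $ s \<in> X s \<omega>) \<longrightarrow>
        (\<forall>\<eta>. \<exists>\<xi>. f t (block_upd \<zeta> t \<xi>) \<omega> \<in> Y t \<omega> \<and> \<xi> \<in> X t \<omega> \<and>
           norm (\<xi> - \<eta>) \<le> C * (infdist (f t (block_upd \<zeta> t \<eta>) \<omega>) (Y t \<omega>) + infdist \<eta> (X t \<omega>)))"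
    by (rule recourse_constant)
  show ?case
  proof (intro exI[of _ "K + C * (L * K + 1)"] conjI allI impI)
    show "0 \<le> K + C * (L * K + 1)" using K L(1) C(1) by simp
    fix x :: "'a \<Rightarrow> (real^'n, 't) vec" and s :: "'t \<Rightarrow> 'a \<Rightarrow> real^'m" and r :: "'t \<Rightarrow> 'a \<Rightarrow> real^'n"
    assume x: "\<forall>t. (\<lambda>\<omega>. x \<omega> $ t) \<in> borel_measurable (\<F> t)"
      and s: "\<forall>t. s t \<in> borel_measurable (\<F> t) \<and> (AE \<omega> in M. s t \<omega> \<in> Y t \<omega>)"
      and r: "\<forall>t. r t \<in> borel_measurable (\<F> t) \<and> (AE \<omega> in M. r t \<omega> \<in> X t \<omega>)"
    define B where "B \<omega> = (\<Sum>t\<in>UNIV. norm (f t (x \<omega>) \<omega> - s t \<omega>) + norm (x \<omega> $ t - r t \<omega>))" for \<omega>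
    obtain z where zm: "\<And>t. (\<lambda>\<omega>. z \<omega> $ t) \<in> borel_measurable (\<F> t)"
      and zx: "\<And>t \<omega>. t \<notin> A \<Longrightarrow> z \<omega> $ t = x \<omega> $ t"
      and zA: "AE \<omega> in M. \<forall>t\<in>A. f t (z \<omega>) \<omega> \<in> Y t \<omega> \<and> z \<omega> $ t \<in> X t \<omega>"
      and zB: "AE \<omega> in M. norm (z \<omega> - x \<omega>) \<le> K * B \<omega>"
      using IH[THEN spec, THEN spec, THEN spec, THEN mp, THEN mp, THEN mp, OF x s r]
      unfolding repairs_def B_def by blast
    have zb: "z \<omega> $ b = x \<omega> $ b" for \<omega> using zx[of b] before by simp
    define \<rho> where "\<rho> \<omega> = C * (norm (f b (z \<omega>) \<omega> - s b \<omega>) + norm (x \<omega> $ b - r b \<omega>))" for \<omega>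
    define h where "h \<xi> \<omega> = infdist \<xi> (X b \<omega>) + infdist (f b (block_upd (z \<omega>) b \<xi>) \<omega>) (Y b \<omega>)
        + max 0 (norm (\<xi> - x \<omega> $ b) - \<rho> \<omega>)" for \<xi> \<omega>
    have ne: "AE \<omega> in M. s b \<omega> \<in> Y b \<omega>" "AE \<omega> in M. r b \<omega> \<in> X b \<omega>"
      using s r by blast+
    obtain w where w: "w \<in> borel_measurable (\<F> b)" "AE \<omega> in M. h (w \<omega>) \<omega> = 0"
    proof (rule measurable_zero_selection[of h "\<F> b" M])
      fix \<xi>
      have [measurable]: "(\<lambda>\<omega>. f b (z \<omega>) \<omega>) \<in> borel_measurable (\<F> b)" by (intro f_measurable zm)
      have [measurable]: "s b \<in> borel_measurable (\<F> b)" "r b \<in> borel_measurable (\<F> b)"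
        "(\<lambda>\<omega>. x \<omega> $ b) \<in> borel_measurable (\<F> b)" using s r x by blast+
      have [measurable]: "\<rho> \<in> borel_measurable (\<F> b)" unfolding \<rho>_def by measurable
      have [measurable]: "(\<lambda>\<omega>. infdist \<xi> (X b \<omega>)) \<in> borel_measurable (\<F> b)"
        by (rule borel_measurable_infdist_const[OF X(1)])
      have "(\<lambda>\<omega>. f b (block_upd (z \<omega>) b \<xi>) \<omega>) \<in> borel_measurable (\<F> b)"
        using zm by (intro f_measurable) (auto simp: block_upd_def)
      then have [measurable]: "(\<lambda>\<omega>. infdist (f b (block_upd (z \<omega>) b \<xi>) \<omega>) (Y b \<omega>)) \<in> borel_measurable (\<F> b)"
        by (rule borel_measurable_infdist_multifunction[OF Y(1)])
      show "h \<xi> \<in> borel_measurable (\<F> b)" unfolding h_def by measurable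
    next
      show "0 \<le> h \<xi> \<omega>" for \<xi> \<omega> by (auto simp: h_def infdist_nonneg)
    next
      show "AE \<omega> in M. continuous_on UNIV (\<lambda>\<xi>. h \<xi> \<omega>) \<and> (\<exists>\<xi>. h \<xi> \<omega> = 0)"
        using ne zA L(2) C(2)
      proof eventually_elim
        case (elim \<omega>)
        have "L-lipschitz_on UNIV (\<lambda>\<xi>. f b (block_upd (z \<omega>) b \<xi>) \<omega>)"
        proof (rule lipschitz_onI)
          fix \<xi> \<eta>
          have "norm (f b (block_upd (z \<omega>) b \<xi>) \<omega> - f b (block_upd (z \<omega>) b \<eta>) \<omega>)
              \<le> L * norm (block_upd (z \<omega>) b \<xi> - block_upd (z \<omega>) b \<eta>)" using elim(4) by blast
          then show "dist (f b (block_upd (z \<omega>) b \<xi>) \<omega>) (f b (block_upd (z \<omega>) b \<eta>) \<omega>) \<le> L * dist \<xi> \<eta>"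
            by (simp add: dist_norm block_upd_diff norm_axis)
        qed (rule L(1))
        then have "continuous_on UNIV (\<lambda>\<xi>. f b (block_upd (z \<omega>) b \<xi>) \<omega>)"
          by (rule lipschitz_on_continuous_on)
        then have "continuous_on UNIV (\<lambda>\<xi>. h \<xi> \<omega>)"
          unfolding h_def by (intro continuous_intros continuous_on_infdist)
        moreover have "\<exists>\<xi>. h \<xi> \<omega> = 0"
        proof -
          have "\<forall>s<b. z \<omega> $ s \<in> X s \<omega>" using elim(3) before by auto
          then obtain \<xi> where \<xi>: "f b (block_upd (z \<omega>) b \<xi>) \<omega> \<in> Y b \<omega>" "\<xi> \<in> X b \<omega>"
            "norm (\<xi> - x \<omega> $ b) \<le> C * (infdist (f b (block_upd (z \<omega>) b (x \<omega> $ b)) \<omega>) (Y b \<omega>) + infdist (x \<omega> $ b) (X b \<omega>))"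
            using elim(5) by blast
          have "block_upd (z \<omega>) b (x \<omega> $ b) = z \<omega>" using block_upd_self zb by metis
          then have "norm (\<xi> - x \<omega> $ b) \<le> C * (infdist (f b (z \<omega>) \<omega>) (Y b \<omega>) + infdist (x \<omega> $ b) (X b \<omega>))"
            using \<xi>(3) by simp
          also have "\<dots> \<le> \<rho> \<omega>"
            unfolding \<rho>_def using elim(1,2) C(1)
            by (intro mult_left_mono add_mono) (auto simp: dist_norm[symmetric] intro: infdist_le)
          finally show ?thesis using \<xi>(1,2) by (intro exI[of _ \<xi>]) (simp add: h_def)
        qed
        ultimately show ?case by blast
      qed
    qed blast
    define z' where "z' \<omega> = block_upd (z \<omega>) b (w \<omega>)" for \<omega>
    have "(\<lambda>\<omega>. z' \<omega> $ t) \<in> borel_measurable (\<F> t)" for t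
      using zm[of t] w(1) by (cases "t = b") (auto simp: z'_def block_upd_def)
    moreover have "z' \<omega> $ t = x \<omega> $ t" if "t \<notin> insert b A" for t \<omega>
      using that zx by (simp add: z'_def block_upd_def)
    moreover have "AE \<omega> in M. \<forall>t\<in>insert b A. f t (z' \<omega>) \<omega> \<in> Y t \<omega> \<and> z' \<omega> $ t \<in> X t \<omega>"
      using w(2) zA ne AE_space
    proof eventually_elim
      case (elim \<omega>)
      have "infdist (w \<omega>) (X b \<omega>) = 0" "infdist (f b (z' \<omega>) \<omega>) (Y b \<omega>) = 0"
        using elim(1) infdist_nonneg[of "w \<omega>" "X b \<omega>"] infdist_nonneg[of "f b (z' \<omega>) \<omega>" "Y b \<omega>"]
        by (auto simp: h_def z'_def)
      then have "w \<omega> \<in> X b \<omega>" "f b (z' \<omega>) \<omega> \<in> Y b \<omega>"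
        using X(2)[OF elim(5)] Y(2)[OF elim(5)] elim(3,4) in_closed_iff_infdist_zero by blast+
      moreover have "f t (z' \<omega>) \<omega> \<in> Y t \<omega> \<and> z' \<omega> $ t \<in> X t \<omega>" if "t \<in> A" for t
      proof -
        have eq: "z' \<omega> $ s = z \<omega> $ s" if "s \<le> t" for s
          using \<open>t \<in> A\<close> that before by (auto simp: z'_def block_upd_def)
        then have "f t (z' \<omega>) \<omega> = f t (z \<omega>) \<omega>" by (intro causality elim)
        then show ?thesis using elim(2) \<open>t \<in> A\<close> eq by simp
      qed
      ultimately show ?case by (auto simp: z'_def block_upd_def)
    qed
    moreover have "AE \<omega> in M. norm (z' \<omega> - x \<omega>) \<le> (K + C * (L * K + 1)) * B \<omega>"
      using w(2) zB L(2)
    proof eventually_elim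
      case (elim \<omega>)
      have "norm (w \<omega> - x \<omega> $ b) \<le> \<rho> \<omega>"
        using elim(1) infdist_nonneg[of "w \<omega>" "X b \<omega>"] infdist_nonneg[of "f b (z' \<omega>) \<omega>" "Y b \<omega>"]
        by (auto simp: h_def z'_def)
      also have "\<rho> \<omega> \<le> C * (L * (K * B \<omega>) + B \<omega>)"
      proof -
        have "norm (f b (z \<omega>) \<omega> - s b \<omega>) \<le> norm (f b (z \<omega>) \<omega> - f b (x \<omega>) \<omega>) + norm (f b (x \<omega>) \<omega> - s b \<omega>)"
          using norm_triangle_ineq[of "f b (z \<omega>) \<omega> - f b (x \<omega>) \<omega>" "f b (x \<omega>) \<omega> - s b \<omega>"] by simp
        moreover have "norm (f b (z \<omega>) \<omega> - f b (x \<omega>) \<omega>) \<le> L * (K * B \<omega>)"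
          using elim(2,3) L(1) by (meson mult_left_mono order_trans)
        moreover have "norm (f b (x \<omega>) \<omega> - s b \<omega>) + norm (x \<omega> $ b - r b \<omega>) \<le> B \<omega>"
          unfolding B_def by (rule member_le_sum) auto
        ultimately show ?thesis unfolding \<rho>_def using C(1) by (intro mult_left_mono) auto
      qed
      finally have 1: "norm (w \<omega> - x \<omega> $ b) \<le> C * (L * (K * B \<omega>) + B \<omega>)" .
      have "z' \<omega> = z \<omega> + axis b (w \<omega> - x \<omega> $ b)"
        using zb[of \<omega>] by (auto simp: z'_def block_upd_def axis_def vec_eq_iff)
      then have "norm (z' \<omega> - x \<omega>) \<le> norm (z \<omega> - x \<omega>) + norm (axis b (w \<omega> - x \<omega> $ b) :: (real^'n, 't) vec)"
        using norm_triangle_ineq[of "z \<omega> - x \<omega>" "axis b (w \<omega> - x \<omega> $ b)"] by (simp add: algebra_simps)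
      also have "\<dots> \<le> K * B \<omega> + C * (L * (K * B \<omega>) + B \<omega>)"
        using elim(2) 1 by (intro add_mono) (auto simp: norm_axis)
      finally show ?case by (simp add: algebra_simps)
    qed
    ultimately show "\<exists>z. repairs (insert b A) (K + C * (L * K + 1)) x s r z"
      unfolding repairs_def B_def by blast
  qed
qed

lemma f_Lp:
  assumes x: "x \<in> adapted \<F>" shows "(\<lambda>\<omega>. f t (x \<omega>) \<omega>) \<in> Lp (\<F> t)"
proof (rule Lp_dominated[OF sub])
  show "(\<lambda>\<omega>. f t (x \<omega>) \<omega>) \<in> borel_measurable (\<F> t)"
    using x by (intro f_measurable Lp_measurable) (simp add: adapted_iff)
  show "(\<lambda>\<omega>. F x \<omega> $ t) \<in> Lp (\<F> t)" using F_adapted[OF x] by (simp add: adapted_iff)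
  show "AE \<omega> in M. norm (f t (x \<omega>) \<omega>) \<le> norm (F x \<omega> $ t)"
    using AE_F[OF x, of t] by eventually_elim simp
qed

abbreviation "selections S t \<equiv> lp_selections (ennreal p) M (\<F> t) (S t)"
abbreviation "feasible \<equiv> feasible_policies (ennreal p) M \<F> F Y X"

text \<open>The almost sure estimate integrates to one in \<open>L\<^sub>p\<close>. The violation of the constraints is measured
  by comparison with selections \<open>s\<close> and \<open>r\<close> that can be chosen freely; later they vary along
  straight lines in the constraint sets.\<close>

theorem feasible_error_bound:
  obtains K where "0 \<le> K"
    "\<And>x s r. x \<in> adapted \<F> \<Longrightarrow> (\<And>t. s t \<in> selections Y t) \<Longrightarrow> (\<And>t. r t \<in> selections X t) \<Longrightarrow>
      \<exists>z\<in>feasible. nrm (\<lambda>\<omega>. z \<omega> - x \<omega>)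
        \<le> K * (\<Sum>t\<in>UNIV. nrm (\<lambda>\<omega>. f t (x \<omega>) \<omega> - s t \<omega>) + nrm (\<lambda>\<omega>. x \<omega> $ t - r t \<omega>))"
proof -
  obtain K where K: "0 \<le> K" and main: "\<forall>x s r. (\<forall>t. (\<lambda>\<omega>. x \<omega> $ t) \<in> borel_measurable (\<F> t)) \<longrightarrow>
      (\<forall>t. s t \<in> borel_measurable (\<F> t) \<and> (AE \<omega> in M. s t \<omega> \<in> Y t \<omega>)) \<longrightarrow>
      (\<forall>t. r t \<in> borel_measurable (\<F> t) \<and> (AE \<omega> in M. r t \<omega> \<in> X t \<omega>)) \<longrightarrow>
      (\<exists>z. repairs UNIV K x s r z)"
    using stagewise_repair[of "UNIV :: 't set"] by auto
  show ?thesis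
  proof (rule that[OF K])
    fix x :: "'a \<Rightarrow> (real^'n, 't) vec" and s :: "'t \<Rightarrow> 'a \<Rightarrow> real^'m" and r :: "'t \<Rightarrow> 'a \<Rightarrow> real^'n"
    assume x: "x \<in> adapted \<F>" and s: "\<And>t. s t \<in> selections Y t" and r: "\<And>t. r t \<in> selections X t"
    have sL: "s t \<in> Lp (\<F> t)" and sY: "AE \<omega> in M. s t \<omega> \<in> Y t \<omega>"
      and rL: "r t \<in> Lp (\<F> t)" and rX: "AE \<omega> in M. r t \<omega> \<in> X t \<omega>" for t
      using s[of t] r[of t] by (auto simp: lp_selections_def)
    have xL: "(\<lambda>\<omega>. x \<omega> $ t) \<in> Lp (\<F> t)" for t using x by (simp add: adapted_iff)
    define B where "B \<omega> = (\<Sum>t\<in>UNIV. norm (f t (x \<omega>) \<omega> - s t \<omega>) + norm (x \<omega> $ t - r t \<omega>))" for \<omega>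
    obtain z where zm: "\<And>t. (\<lambda>\<omega>. z \<omega> $ t) \<in> borel_measurable (\<F> t)"
      and zA: "AE \<omega> in M. \<forall>t. f t (z \<omega>) \<omega> \<in> Y t \<omega> \<and> z \<omega> $ t \<in> X t \<omega>"
      and zB: "AE \<omega> in M. norm (z \<omega> - x \<omega>) \<le> K * B \<omega>"
      using main[rule_format, of x s r] Lp_measurable[OF xL] Lp_measurable[OF sL] Lp_measurable[OF rL] sY rX
      unfolding repairs_def B_def by auto
    have "(\<lambda>\<omega>. norm (f t (x \<omega>) \<omega> - s t \<omega>)) \<in> Lp (\<F> t)" for t
      by (intro Lp_norm_function Lp_diff f_Lp x sL sub)
    then have term1: "(\<lambda>\<omega>. norm (f t (x \<omega>) \<omega> - s t \<omega>)) \<in> Lp M" for t by (rule Lp_subalgebra[OF sub])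
    have "(\<lambda>\<omega>. norm (x \<omega> $ t - r t \<omega>)) \<in> Lp (\<F> t)" for t
      by (intro Lp_norm_function Lp_diff xL rL sub)
    then have term2: "(\<lambda>\<omega>. norm (x \<omega> $ t - r t \<omega>)) \<in> Lp M" for t by (rule Lp_subalgebra[OF sub])
    have BL: "B \<in> Lp M"
      unfolding B_def by (intro Lp_sum Lp_add term1 term2 subalgebra_self)
    have B0: "0 \<le> B \<omega>" for \<omega> by (simp add: B_def sum_nonneg)
    have KB: "(\<lambda>\<omega>. K *\<^sub>R B \<omega>) \<in> Lp M" using BL by (rule Lp_scaleR)
    have zL: "(\<lambda>\<omega>. z \<omega> $ t) \<in> Lp (\<F> t)" for t
    proof -
      have m: "(\<lambda>\<omega>. z \<omega> $ t - x \<omega> $ t) \<in> borel_measurable (\<F> t)"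
        using zm[of t] Lp_measurable[OF xL, of t] by (rule borel_measurable_diff)
      have "AE \<omega> in M. norm (z \<omega> $ t - x \<omega> $ t) \<le> norm (K *\<^sub>R B \<omega>)"
        using zB
      proof eventually_elim
        case (elim \<omega>)
        have "norm ((z \<omega> - x \<omega>) $ t) \<le> norm (z \<omega> - x \<omega>)" by (rule Finite_Cartesian_Product.norm_nth_le)
        then show ?case using elim K B0[of \<omega>] by (simp add: abs_mult)
      qed
      then have "(\<lambda>\<omega>. z \<omega> $ t - x \<omega> $ t) \<in> Lp (\<F> t)" by (rule Lp_dominated[OF sub m KB])
      from Lp_add[OF this xL sub] show ?thesis by simp
    qed
    then have z: "z \<in> adapted \<F>" by (simp add: adapted_iff)
    have "z \<in> feasible"
      unfolding feasible_policies_def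
    proof (intro CollectI conjI z allI)
      fix t
      show "AE \<omega> in M. z \<omega> $ t \<in> X t \<omega>" using zA by eventually_elim blast
      show "AE \<omega> in M. F z \<omega> $ t \<in> Y t \<omega>" using zA AE_F[OF z, of t] by eventually_elim simp
    qed
    moreover have "nrm (\<lambda>\<omega>. z \<omega> - x \<omega>)
        \<le> K * (\<Sum>t\<in>UNIV. nrm (\<lambda>\<omega>. f t (x \<omega>) \<omega> - s t \<omega>) + nrm (\<lambda>\<omega>. x \<omega> $ t - r t \<omega>))"
    proof -
      have "nrm (\<lambda>\<omega>. z \<omega> - x \<omega>) \<le> nrm (\<lambda>\<omega>. K *\<^sub>R B \<omega>)"
        using zB K B0 by (intro lp_norm_mono[OF KB]) (auto simp: abs_mult)
      also have "\<dots> = K * nrm B" using K by (simp add: lp_norm_scaleR del: real_scaleR_def)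
      also have "nrm B \<le> (\<Sum>t\<in>UNIV. nrm (\<lambda>\<omega>. norm (f t (x \<omega>) \<omega> - s t \<omega>) + norm (x \<omega> $ t - r t \<omega>)))"
        unfolding B_def by (intro lp_norm_sum Lp_add term1 term2 subalgebra_self) auto
      also have "\<dots> \<le> (\<Sum>t\<in>UNIV. nrm (\<lambda>\<omega>. norm (f t (x \<omega>) \<omega> - s t \<omega>)) + nrm (\<lambda>\<omega>. norm (x \<omega> $ t - r t \<omega>)))"
        by (intro sum_mono lp_norm_triangle term1 term2)
      finally show ?thesis using K by (simp add: lp_norm_norm mult_left_mono)
    qed
    ultimately show "\<exists>z\<in>feasible. nrm (\<lambda>\<omega>. z \<omega> - x \<omega>)
        \<le> K * (\<Sum>t\<in>UNIV. nrm (\<lambda>\<omega>. f t (x \<omega>) \<omega> - s t \<omega>) + nrm (\<lambda>\<omega>. x \<omega> $ t - r t \<omega>))" by blast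
  qed
qed

end

section \<open>Linearization of the causal operator\<close>

lemma has_derivative_directional_quotient:
  fixes g :: "'b::real_normed_vector \<Rightarrow> 'c::real_normed_vector"
  assumes g: "(g has_derivative g') (at x)" and \<tau>: "\<tau> \<longlonglongrightarrow> 0" and pos: "\<And>k. 0 < \<tau> k"
  shows "(\<lambda>k. inverse (\<tau> k) *\<^sub>R (g (x + \<tau> k *\<^sub>R v) - g x)) \<longlonglongrightarrow> g' v"
proof -
  interpret g': bounded_linear g' using g by (rule has_derivative_bounded_linear)
  show ?thesis
  proof (cases "v = 0")
    case True
    then show ?thesis by (simp add: g'.zero)
  next
    case False
    have "((\<lambda>h. norm (g (x + h) - g x - g' h) / norm h) \<longlongrightarrow> 0) (at 0)"
      using g by (simp add: has_derivative_at)
    moreover have "filterlim (\<lambda>k. \<tau> k *\<^sub>R v) (at 0) sequentially"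
      unfolding filterlim_at using tendsto_scaleR[OF \<tau> tendsto_const[of v]] pos False
      by (auto simp: less_imp_neq[symmetric])
    ultimately have "(\<lambda>k. norm (g (x + \<tau> k *\<^sub>R v) - g x - g' (\<tau> k *\<^sub>R v)) / norm (\<tau> k *\<^sub>R v)) \<longlonglongrightarrow> 0"
      by (rule filterlim_compose)
    from tendsto_mult_right[OF this, of "norm v"]
    have lim: "(\<lambda>k. norm (g (x + \<tau> k *\<^sub>R v) - g x - g' (\<tau> k *\<^sub>R v)) / norm (\<tau> k *\<^sub>R v) * norm v) \<longlonglongrightarrow> 0"
      by simp
    have eq: "norm (inverse (\<tau> k) *\<^sub>R (g (x + \<tau> k *\<^sub>R v) - g x) - g' v)
        = norm (g (x + \<tau> k *\<^sub>R v) - g x - g' (\<tau> k *\<^sub>R v)) / norm (\<tau> k *\<^sub>R v) * norm v" for k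
    proof -
      have "inverse (\<tau> k) *\<^sub>R (g (x + \<tau> k *\<^sub>R v) - g x) - g' v
          = inverse (\<tau> k) *\<^sub>R (g (x + \<tau> k *\<^sub>R v) - g x - g' (\<tau> k *\<^sub>R v))"
        using pos[of k] by (simp add: g'.scaleR scaleR_diff_right)
      then show ?thesis using pos[of k] False by (simp add: divide_inverse abs_of_pos)
    qed
    have "(\<lambda>k. inverse (\<tau> k) *\<^sub>R (g (x + \<tau> k *\<^sub>R v) - g x) - g' v) \<longlonglongrightarrow> 0"
      using lim unfolding eq[symmetric] by (rule tendsto_norm_zero_cancel)
    then show ?thesis by (simp add: LIM_zero_iff)
  qed
qed

lemma borel_measurable_component:
  fixes y :: "'a \<Rightarrow> ('b::euclidean_space)^'i::finite"
  assumes "y \<in> borel_measurable G" shows "(\<lambda>\<omega>. y \<omega> $ i) \<in> borel_measurable G"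
proof -
  have "(\<lambda>v :: 'b^'i. v $ i) \<in> borel_measurable borel"
    by (intro borel_measurable_continuous_onI continuous_on_component continuous_on_id)
  from measurable_compose[OF assms this] show ?thesis .
qed

lemma has_derivative_block_upd:
  fixes \<zeta> :: "(real^'n)^'i::finite"
  shows "(block_upd \<zeta> l has_derivative axis l) (at u)"
proof -
  have "bounded_linear (axis l :: real^'n \<Rightarrow> (real^'n)^'i)"
    by (intro linear_conv_bounded_linear[THEN iffD1] linearI) (auto simp: axis_def vec_eq_iff)
  then have "((\<lambda>u. block_upd \<zeta> l 0 + axis l u) has_derivative (\<lambda>h. 0 + axis l h)) (at u)"
    by (intro has_derivative_add has_derivative_const bounded_linear_imp_has_derivative)
  moreover have "block_upd \<zeta> l = (\<lambda>u. block_upd \<zeta> l 0 + axis l u)"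
    by (auto simp: block_upd_def axis_def vec_eq_iff fun_eq_iff)
  ultimately show ?thesis by simp
qed

lemma sum_axis: "(\<Sum>s\<in>UNIV. axis s (v $ s)) = (v :: 'b::real_normed_vector^'i::finite)"
  by (simp add: vec_eq_iff axis_def sum_component)

context recourse_problem
begin

text \<open>The partial Jacobians of \<open>f t\<close> along \<open>x\<close> exist almost surely only. Limits of difference
  quotients along the coordinate directions agree with them almost surely and are measurable at
  stage \<open>t\<close>, hence serve as measurable versions. The step of the quotients is \<open>1 / (k + 1)\<close>.\<close>

definition jac :: "('a \<Rightarrow> (real^'n, 't) vec) \<Rightarrow> 't \<Rightarrow> 't \<Rightarrow> 'a \<Rightarrow> real^'n^'m" where
  "jac x t l \<omega> = (\<chi> i j. lim (\<lambda>k. inverse (inverse (real (Suc k))) *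
      (f t (x \<omega> + inverse (real (Suc k)) *\<^sub>R axis l (axis j 1)) \<omega> - f t (x \<omega>) \<omega>) $ i))"

lemma jac_measurable:
  assumes x: "x \<in> adapted \<F>"
  shows "(\<lambda>\<omega>. jac x t l \<omega> $ i $ j) \<in> borel_measurable (\<F> t)"
proof -
  have xm: "(\<lambda>\<omega>. x \<omega> $ s) \<in> borel_measurable (\<F> s)" for s
    using x by (intro Lp_measurable) (simp add: adapted_iff)
  have "(\<lambda>\<omega>. f t (x \<omega> + c *\<^sub>R axis l (axis j 1)) \<omega>) \<in> borel_measurable (\<F> t)" for c
    using xm by (intro f_measurable) simp
  moreover have "(\<lambda>\<omega>. f t (x \<omega>) \<omega>) \<in> borel_measurable (\<F> t)" by (intro f_measurable xm)
  ultimately have "(\<lambda>\<omega>. (f t (x \<omega> + c *\<^sub>R axis l (axis j 1)) \<omega> - f t (x \<omega>) \<omega>) $ i) \<in> borel_measurable (\<F> t)" for c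
    by (intro borel_measurable_component borel_measurable_diff)
  then show ?thesis
    unfolding jac_def vec_lambda_beta
    by (intro borel_measurable_lim_metric borel_measurable_times borel_measurable_const)
qed

lemma jac_causal:
  assumes "t < l" "\<omega> \<in> space M" shows "jac x t l \<omega> = 0"
proof -
  have "f t (x \<omega> + c *\<^sub>R axis l w) \<omega> = f t (x \<omega>) \<omega>" for c w
    using assms by (intro causality) (auto simp: axis_def)
  then show ?thesis by (simp add: jac_def vec_eq_iff)
qed

lemma AE_jac:
  "AE \<omega> in M. \<forall>t l. jac x t l \<omega> = partial_jacobian f x t l \<omega>
      \<and> (\<forall>h. jac x t l \<omega> *v h = f' t (x \<omega>) \<omega> (axis l h))"
  using AE_has_derivative
proof eventually_elim
  case (elim \<omega>)
  show ?case
  proof (intro allI)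
    fix t l
    let ?D = "\<lambda>h. f' t (x \<omega>) \<omega> (axis l h)"
    have D: "((\<lambda>\<xi>. f t \<xi> \<omega>) has_derivative f' t (x \<omega>) \<omega>) (at (x \<omega>))" using elim by blast
    have "((\<lambda>\<xi>. f t \<xi> \<omega>) has_derivative f' t (x \<omega>) \<omega>) (at (block_upd (x \<omega>) l (x \<omega> $ l)))"
      using D by (simp add: block_upd_self)
    from has_derivative_compose[OF has_derivative_block_upd this]
    have P: "((\<lambda>u. f t (block_upd (x \<omega>) l u) \<omega>) has_derivative ?D) (at (x \<omega> $ l))" .
    have pj: "partial_jacobian f x t l \<omega> = matrix ?D"
      unfolding partial_jacobian_def jacobian_def using frechet_derivative_at[OF P] by simp
    have "jac x t l \<omega> $ i $ j = matrix ?D $ i $ j" for i j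
    proof -
      have "(\<lambda>k. inverse (inverse (real (Suc k))) *\<^sub>R
          (f t (x \<omega> + inverse (real (Suc k)) *\<^sub>R axis l (axis j 1)) \<omega> - f t (x \<omega>) \<omega>)) \<longlonglongrightarrow> ?D (axis j 1)"
        by (rule has_derivative_directional_quotient[OF D LIMSEQ_inverse_real_of_nat]) simp
      then have "(\<lambda>k. (inverse (inverse (real (Suc k))) *\<^sub>R
          (f t (x \<omega> + inverse (real (Suc k)) *\<^sub>R axis l (axis j 1)) \<omega> - f t (x \<omega>) \<omega>)) $ i) \<longlonglongrightarrow> ?D (axis j 1) $ i"
        by (rule tendsto_vec_nth)
      then have "(\<lambda>k. inverse (inverse (real (Suc k))) *
          (f t (x \<omega> + inverse (real (Suc k)) *\<^sub>R axis l (axis j 1)) \<omega> - f t (x \<omega>) \<omega>) $ i) \<longlonglongrightarrow> ?D (axis j 1) $ i"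
        by (simp only: vector_scaleR_component real_scaleR_def)
      from limI[OF this] show ?thesis unfolding jac_def matrix_def vec_lambda_beta .
    qed
    then have eq: "jac x t l \<omega> = matrix ?D" by (simp add: vec_eq_iff)
    have "linear ?D" using P by (rule has_derivative_linear)
    then show "jac x t l \<omega> = partial_jacobian f x t l \<omega> \<and> (\<forall>h. jac x t l \<omega> *v h = ?D h)"
      using eq pj by (simp add: matrix_works)
  qed
qed

lemma AE_jac_bound:
  obtains C where "0 \<le> C" "AE \<omega> in M. \<forall>t l i j. \<bar>jac x t l \<omega> $ i $ j\<bar> \<le> C"
proof -
  obtain C where C: "0 \<le> C" "AE \<omega> in M. \<forall>t \<xi>. norm (f' t \<xi> \<omega>) \<le> C" by (rule jacobian_bound)
  have "AE \<omega> in M. \<forall>t l i j. \<bar>jac x t l \<omega> $ i $ j\<bar> \<le> C"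
    using C(2) AE_jac[of x]
  proof eventually_elim
    case (elim \<omega>)
    show ?case
    proof (intro allI)
      fix t l i j
      have "jac x t l \<omega> $ i $ j = (jac x t l \<omega> *v axis j 1) $ i"
        by (simp add: matrix_vector_mul_component inner_axis)
      also have "\<dots> = f' t (x \<omega>) \<omega> (axis l (axis j 1)) $ i" using elim(2) by metis
      finally have "\<bar>jac x t l \<omega> $ i $ j\<bar> \<le> norm (f' t (x \<omega>) \<omega> (axis l (axis j 1)))"
        using component_le_norm_cart by metis
      also have "\<dots> \<le> norm (f' t (x \<omega>) \<omega>) * norm (axis l (axis j 1) :: (real^'n, 't) vec)"
        by (rule norm_blinfun)
      also have "\<dots> \<le> C" using elim(1) by (simp add: norm_axis)
      finally show "\<bar>jac x t l \<omega> $ i $ j\<bar> \<le> C" .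
    qed
  qed
  with C(1) show ?thesis by (rule that)
qed

text \<open>The linearization of the superposition operator at \<open>x\<close>, in terms of the measurable versions of the
  partial Jacobians. The sum may run over all stages because blocks after \<open>t\<close> contribute zero.\<close>

definition lin :: "('a \<Rightarrow> (real^'n, 't) vec) \<Rightarrow> 't \<Rightarrow> ('a \<Rightarrow> (real^'n, 't) vec) \<Rightarrow> 'a \<Rightarrow> real^'m" where
  "lin x t d \<omega> = (\<Sum>l\<in>UNIV. jac x t l \<omega> *v (d \<omega> $ l))"

lemma lin_add: "lin x t (\<lambda>\<omega>. d \<omega> + e \<omega>) = (\<lambda>\<omega>. lin x t d \<omega> + lin x t e \<omega>)"
  by (simp add: lin_def matrix_vector_right_distrib sum.distrib fun_eq_iff)

lemma lin_scaleR: "lin x t (\<lambda>\<omega>. c *\<^sub>R d \<omega>) = (\<lambda>\<omega>. c *\<^sub>R lin x t d \<omega>)"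
  by (simp add: lin_def matrix_vector_mult_scaleR scaleR_sum_right fun_eq_iff)

lemma AE_lin: "AE \<omega> in M. \<forall>t. lin x t d \<omega> = f' t (x \<omega>) \<omega> (d \<omega>)"
  using AE_jac[of x]
proof eventually_elim
  case (elim \<omega>)
  show ?case
  proof
    fix t
    have "f' t (x \<omega>) \<omega> (d \<omega>) = f' t (x \<omega>) \<omega> (\<Sum>l\<in>UNIV. axis l (d \<omega> $ l))" by (simp add: sum_axis)
    also have "\<dots> = (\<Sum>l\<in>UNIV. f' t (x \<omega>) \<omega> (axis l (d \<omega> $ l)))" by (rule blinfun.sum_right)
    also have "\<dots> = lin x t d \<omega>" unfolding lin_def using elim by (intro sum.cong refl) metis
    finally show "lin x t d \<omega> = f' t (x \<omega>) \<omega> (d \<omega>)" by simp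
  qed
qed

lemma lin_measurable:
  assumes x: "x \<in> adapted \<F>" and d: "d \<in> adapted \<F>"
  shows "lin x t d \<in> borel_measurable (\<F> t)"
proof (rule borel_measurable_vec)
  fix i
  have "(\<lambda>\<omega>. \<Sum>l\<in>UNIV. \<Sum>j\<in>UNIV. (if l \<le> t then jac x t l \<omega> $ i $ j * (d \<omega> $ l $ j) else 0)) \<in> borel_measurable (\<F> t)"
  proof (intro borel_measurable_sum)
    fix l and j :: 'n
    show "(\<lambda>\<omega>. if l \<le> t then jac x t l \<omega> $ i $ j * (d \<omega> $ l $ j) else 0) \<in> borel_measurable (\<F> t)"
    proof (cases "l \<le> t")
      case True
      have "(\<lambda>\<omega>. d \<omega> $ l) \<in> borel_measurable (\<F> t)"
        using d by (intro borel_measurable_later[OF Lp_measurable True]) (simp add: adapted_iff)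
      then have "(\<lambda>\<omega>. d \<omega> $ l $ j) \<in> borel_measurable (\<F> t)" by (rule borel_measurable_component)
      then show ?thesis using True jac_measurable[OF x] by simp
    qed simp
  qed
  moreover have "(\<Sum>l\<in>UNIV. \<Sum>j\<in>UNIV. (if l \<le> t then jac x t l \<omega> $ i $ j * (d \<omega> $ l $ j) else 0)) = lin x t d \<omega> $ i"
    if "\<omega> \<in> space (\<F> t)" for \<omega>
  proof -
    have "(\<Sum>j\<in>UNIV. (if l \<le> t then jac x t l \<omega> $ i $ j * (d \<omega> $ l $ j) else 0)) = (jac x t l \<omega> *v (d \<omega> $ l)) $ i" for l
    proof (cases "l \<le> t")
      case False
      then have "jac x t l \<omega> = 0" using that by (intro jac_causal) (simp_all add: space_F)
      then show ?thesis using False by (simp add: matrix_vector_mult_def)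
    qed (simp add: matrix_vector_mult_def)
    then show ?thesis by (simp only: lin_def sum_component)
  qed
  ultimately show "(\<lambda>\<omega>. lin x t d \<omega> $ i) \<in> borel_measurable (\<F> t)"
    by (simp cong: measurable_cong)
qed

lemma AE_lin_bound:
  obtains C where "0 \<le> C" "\<And>d. AE \<omega> in M. \<forall>t. norm (lin x t d \<omega>) \<le> C * norm (d \<omega>)"
proof -
  obtain C where C: "0 \<le> C" "AE \<omega> in M. \<forall>t \<xi>. norm (f' t \<xi> \<omega>) \<le> C" by (rule jacobian_bound)
  have "AE \<omega> in M. \<forall>t. norm (lin x t d \<omega>) \<le> C * norm (d \<omega>)" for d
    using C(2) AE_lin[of x d]
  proof eventually_elim
    case (elim \<omega>)
    show ?case
    proof
      fix t
      have "norm (lin x t d \<omega>) \<le> norm (f' t (x \<omega>) \<omega>) * norm (d \<omega>)" using elim(2) norm_blinfun by simp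
      also have "\<dots> \<le> C * norm (d \<omega>)" using elim(1) by (intro mult_right_mono) auto
      finally show "norm (lin x t d \<omega>) \<le> C * norm (d \<omega>)" .
    qed
  qed
  with C(1) show ?thesis by (rule that)
qed

lemma lin_Lp:
  assumes x: "x \<in> adapted \<F>" and d: "d \<in> adapted \<F>"
  shows "lin x t d \<in> Lp (\<F> t)"
proof -
  obtain C where C: "0 \<le> C" "\<And>d. AE \<omega> in M. \<forall>t. norm (lin x t d \<omega>) \<le> C * norm (d \<omega>)"
    using AE_lin_bound[of x] by blast
  have "AE \<omega> in M. norm (lin x t d \<omega>) \<le> norm (C *\<^sub>R d \<omega>)"
    using C(2)[of d] by eventually_elim (simp add: C(1))
  then show ?thesis
    by (rule Lp_dominated[OF sub lin_measurable[OF x d] Lp_scaleR[OF adapted_Lp[OF sub d]]])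
qed

text \<open>The superposition operator is directionally differentiable in \<open>L\<^sub>p\<close>: the difference quotients
  converge almost surely and are dominated by a multiple of \<open>\<parallel>d\<parallel>\<close>.\<close>

lemma linearization_error:
  assumes x: "x \<in> adapted \<F>" and d: "d \<in> adapted \<F>" and \<tau>: "\<tau> \<longlonglongrightarrow> 0" and pos: "\<And>k. 0 < \<tau> k"
  shows "(\<lambda>k. nrm (\<lambda>\<omega>. inverse (\<tau> k) *\<^sub>R (f t (x \<omega> + \<tau> k *\<^sub>R d \<omega>) \<omega> - f t (x \<omega>) \<omega>) - lin x t d \<omega>)) \<longlonglongrightarrow> 0"
proof -
  have xd: "(\<lambda>\<omega>. x \<omega> + c *\<^sub>R d \<omega>) \<in> adapted \<F>" for c
    using x d by (auto simp: adapted_iff intro!: Lp_add Lp_scaleR sub)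
  obtain C where C: "0 \<le> C" "AE \<omega> in M. \<forall>t \<xi> \<xi>'. norm (f t \<xi> \<omega> - f t \<xi>' \<omega>) \<le> C * norm (\<xi> - \<xi>')"
    by (rule f_lipschitz)
  obtain C' where C': "0 \<le> C'" "\<And>d. AE \<omega> in M. \<forall>t. norm (lin x t d \<omega>) \<le> C' * norm (d \<omega>)"
    using AE_lin_bound[of x] by blast
  show ?thesis
  proof (rule lp_norm_dominated_convergence)
    fix k
    have "(\<lambda>\<omega>. inverse (\<tau> k) *\<^sub>R (f t (x \<omega> + \<tau> k *\<^sub>R d \<omega>) \<omega> - f t (x \<omega>) \<omega>) - lin x t d \<omega>) \<in> Lp (\<F> t)"
      by (intro Lp_diff Lp_scaleR f_Lp xd x lin_Lp d sub)
    then show "(\<lambda>\<omega>. inverse (\<tau> k) *\<^sub>R (f t (x \<omega> + \<tau> k *\<^sub>R d \<omega>) \<omega> - f t (x \<omega>) \<omega>) - lin x t d \<omega>) \<in> borel_measurable M"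
      by (intro Lp_measurable Lp_subalgebra[OF sub])
    show "AE \<omega> in M. norm (inverse (\<tau> k) *\<^sub>R (f t (x \<omega> + \<tau> k *\<^sub>R d \<omega>) \<omega> - f t (x \<omega>) \<omega>) - lin x t d \<omega>)
        \<le> norm ((C + C') *\<^sub>R d \<omega>)"
      using C(2) C'(2)[of d]
    proof eventually_elim
      case (elim \<omega>)
      have "norm (f t (x \<omega> + \<tau> k *\<^sub>R d \<omega>) \<omega> - f t (x \<omega>) \<omega>) \<le> C * norm (\<tau> k *\<^sub>R d \<omega>)"
        using elim(1)[THEN spec, THEN spec, THEN spec, of t "x \<omega> + \<tau> k *\<^sub>R d \<omega>" "x \<omega>"] by simp
      then have "inverse (\<tau> k) * norm (f t (x \<omega> + \<tau> k *\<^sub>R d \<omega>) \<omega> - f t (x \<omega>) \<omega>)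
          \<le> inverse (\<tau> k) * (C * norm (\<tau> k *\<^sub>R d \<omega>))"
        using pos[of k] by (intro mult_left_mono) auto
      also have "\<dots> = C * norm (d \<omega>)" using pos[of k] by simp
      finally have "norm (inverse (\<tau> k) *\<^sub>R (f t (x \<omega> + \<tau> k *\<^sub>R d \<omega>) \<omega> - f t (x \<omega>) \<omega>)) \<le> C * norm (d \<omega>)"
        using pos[of k] by simp
      then have "norm (inverse (\<tau> k) *\<^sub>R (f t (x \<omega> + \<tau> k *\<^sub>R d \<omega>) \<omega> - f t (x \<omega>) \<omega>) - lin x t d \<omega>)
          \<le> C * norm (d \<omega>) + C' * norm (d \<omega>)"
        using elim(2) by (intro order_trans[OF norm_triangle_ineq4] add_mono) auto
      then show ?case using C(1) C'(1) by (simp add: distrib_right)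
    qed
    show "(\<lambda>\<omega>. (C + C') *\<^sub>R d \<omega>) \<in> Lp M" by (intro Lp_scaleR adapted_Lp[OF sub d])
  next
    show "AE \<omega> in M. (\<lambda>k. inverse (\<tau> k) *\<^sub>R (f t (x \<omega> + \<tau> k *\<^sub>R d \<omega>) \<omega> - f t (x \<omega>) \<omega>) - lin x t d \<omega>) \<longlonglongrightarrow> 0"
      using AE_has_derivative AE_lin[of x d]
    proof eventually_elim
      case (elim \<omega>)
      have "((\<lambda>\<xi>. f t \<xi> \<omega>) has_derivative f' t (x \<omega>) \<omega>) (at (x \<omega>))" using elim(1) by blast
      from has_derivative_directional_quotient[OF this \<tau> pos, of "d \<omega>"]
      show ?case using elim(2) by (simp add: LIM_zero)
    qed
  qed
qed

end

section \<open>Feasible directions of decomposable convex sets\<close>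

context lp_exponent
begin

text \<open>The step length does not depend on \<open>\<omega>\<close>, so for \<open>a\<close> in \<open>L\<^sub>p\<close> these are the directions into the convex set of
  \<open>L\<^sub>p\<close> selections of \<open>S\<close>, the positive multiples of \<open>z - a\<close> for selections \<open>z\<close>; a functional is normal to
  this set at \<open>a\<close> precisely if it is nonpositive on them.\<close>

definition feasible_directions ::
    "'a measure \<Rightarrow> ('a \<Rightarrow> 'b::euclidean_space set) \<Rightarrow> ('a \<Rightarrow> 'b) \<Rightarrow> ('a \<Rightarrow> 'b) set" where
  "feasible_directions G S a = {y \<in> Lp G. \<exists>\<delta>>0. AE \<omega> in M. a \<omega> + \<delta> *\<^sub>R y \<omega> \<in> S \<omega>}"

lemma feasible_directions_Lp: "y \<in> feasible_directions G S a \<Longrightarrow> y \<in> Lp G"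
  by (simp add: feasible_directions_def)

lemma feasible_directions_zero:
  "AE \<omega> in M. a \<omega> \<in> S \<omega> \<Longrightarrow> 0 \<in> feasible_directions G S a"
  by (auto simp: feasible_directions_def zero_fun_def Lp_zero intro!: exI[of _ 1])

lemma feasible_directions_scaleR:
  assumes "y \<in> feasible_directions G S a" "c > 0" shows "c *\<^sub>R y \<in> feasible_directions G S a"
proof -
  obtain \<delta> where \<delta>: "\<delta> > 0" "AE \<omega> in M. a \<omega> + \<delta> *\<^sub>R y \<omega> \<in> S \<omega>"
    using assms by (auto simp: feasible_directions_def)
  have "AE \<omega> in M. a \<omega> + (\<delta> / c) *\<^sub>R (c *\<^sub>R y \<omega>) \<in> S \<omega>" using \<delta>(2) assms(2) by simp
  then show ?thesis using assms \<delta>(1)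
    unfolding feasible_directions_def scaleR_fun_def
    by (auto intro!: Lp_scaleR exI[of _ "\<delta> / c"])
qed

lemma feasible_directions_add:
  assumes G: "subalgebra M G" and S: "\<And>\<omega>. \<omega> \<in> space M \<Longrightarrow> convex (S \<omega>)"
    and y: "y \<in> feasible_directions G S a" and z: "z \<in> feasible_directions G S a"
  shows "y + z \<in> feasible_directions G S a"
proof -
  obtain \<delta> \<epsilon> where \<delta>: "\<delta> > 0" "AE \<omega> in M. a \<omega> + \<delta> *\<^sub>R y \<omega> \<in> S \<omega>"
    and \<epsilon>: "\<epsilon> > 0" "AE \<omega> in M. a \<omega> + \<epsilon> *\<^sub>R z \<omega> \<in> S \<omega>"
    using y z by (auto simp: feasible_directions_def)
  \<comment> \<open>With this step, \<open>a + \<gamma> (y + z)\<close> is a convex combination of \<open>a + \<delta> y\<close> and \<open>a + \<epsilon> z\<close>.\<close>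
  define \<gamma> where "\<gamma> = \<delta> * \<epsilon> / (\<delta> + \<epsilon>)"
  have "AE \<omega> in M. a \<omega> + \<gamma> *\<^sub>R (y \<omega> + z \<omega>) \<in> S \<omega>"
    using \<delta>(2) \<epsilon>(2) AE_space
  proof eventually_elim
    case (elim \<omega>)
    let ?u = "\<epsilon> / (\<delta> + \<epsilon>)" and ?v = "\<delta> / (\<delta> + \<epsilon>)"
    have uv: "?u + ?v = 1" "0 \<le> ?u" "0 \<le> ?v"
      using \<delta>(1) \<epsilon>(1) by (simp_all add: add_divide_distrib[symmetric] add.commute)
    have "?u *\<^sub>R (a \<omega> + \<delta> *\<^sub>R y \<omega>) + ?v *\<^sub>R (a \<omega> + \<epsilon> *\<^sub>R z \<omega>) \<in> S \<omega>"
      using uv by (intro convexD[OF S[OF elim(3)] elim(1,2)])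
    also have "?u *\<^sub>R (a \<omega> + \<delta> *\<^sub>R y \<omega>) + ?v *\<^sub>R (a \<omega> + \<epsilon> *\<^sub>R z \<omega>)
        = (?u + ?v) *\<^sub>R a \<omega> + \<gamma> *\<^sub>R (y \<omega> + z \<omega>)"
      by (simp only: scaleR_add_left scaleR_add_right scaleR_scaleR) (simp add: \<gamma>_def mult.commute)
    finally show ?case by (simp only: uv scaleR_one)
  qed
  moreover have "\<gamma> > 0" using \<delta>(1) \<epsilon>(1) by (simp add: \<gamma>_def)
  ultimately show ?thesis
    using y z Lp_add[OF _ _ G] by (auto simp: feasible_directions_def plus_fun_def)
qed

lemma feasible_directions_step:
  assumes S: "\<And>\<omega>. \<omega> \<in> space M \<Longrightarrow> convex (S \<omega>)" and a: "AE \<omega> in M. a \<omega> \<in> S \<omega>"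
    and y: "y \<in> feasible_directions G S a"
  obtains \<delta> where "\<delta> > 0" "\<And>\<tau>. 0 \<le> \<tau> \<Longrightarrow> \<tau> \<le> \<delta> \<Longrightarrow> AE \<omega> in M. a \<omega> + \<tau> *\<^sub>R y \<omega> \<in> S \<omega>"
proof -
  obtain \<delta> where \<delta>: "\<delta> > 0" "AE \<omega> in M. a \<omega> + \<delta> *\<^sub>R y \<omega> \<in> S \<omega>"
    using y by (auto simp: feasible_directions_def)
  have "AE \<omega> in M. a \<omega> + \<tau> *\<^sub>R y \<omega> \<in> S \<omega>" if \<tau>: "0 \<le> \<tau>" "\<tau> \<le> \<delta>" for \<tau>
    using \<delta>(2) a AE_space
  proof eventually_elim
    case (elim \<omega>)
    have "(1 - \<tau> / \<delta>) *\<^sub>R a \<omega> + (\<tau> / \<delta>) *\<^sub>R (a \<omega> + \<delta> *\<^sub>R y \<omega>) \<in> S \<omega>"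
      using \<tau> \<delta>(1) by (intro convexD[OF S[OF elim(3)] elim(2,1)]) auto
    also have "(1 - \<tau> / \<delta>) *\<^sub>R a \<omega> + (\<tau> / \<delta>) *\<^sub>R (a \<omega> + \<delta> *\<^sub>R y \<omega>) = a \<omega> + \<tau> *\<^sub>R y \<omega>"
      using \<delta>(1) by (simp add: algebra_simps)
    finally show ?case .
  qed
  with \<delta>(1) show ?thesis by (rule that)
qed

lemma feasible_directions_selection:
  assumes "subalgebra M G" "a \<in> Lp G" "z \<in> lp_selections (ennreal p) M G S"
  shows "(\<lambda>\<omega>. z \<omega> - a \<omega>) \<in> feasible_directions G S a"
  using assms by (auto simp: feasible_directions_def lp_selections_def intro!: Lp_diff exI[of _ 1])

end

section \<open>The Clarke derivative of a Lipschitz function\<close>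

context lp_exponent
begin

abbreviation diff_quotient ::
    "(('a \<Rightarrow> ('b::euclidean_space)^'t::finite) \<Rightarrow> real) \<Rightarrow> ('a \<Rightarrow> 'b^'t) \<Rightarrow> ('a \<Rightarrow> 'b^'t) \<Rightarrow> real \<Rightarrow> real" where
  "diff_quotient \<phi> y d \<tau> \<equiv> (\<phi> (\<lambda>\<omega>. y \<omega> + \<tau> *\<^sub>R d \<omega>) - \<phi> y) / \<tau>"

lemma clarke_derivative_le:
  assumes "\<epsilon> > 0"
    and "\<And>y \<tau>. y \<in> adapted \<F> \<Longrightarrow> nrm (\<lambda>\<omega>. y \<omega> - x \<omega>) < \<epsilon> \<Longrightarrow> 0 < \<tau> \<Longrightarrow> \<tau> < \<epsilon> \<Longrightarrow>
      diff_quotient \<phi> y d \<tau> \<le> c"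
  shows "clarke_derivative p M \<F> \<phi> x d \<le> ereal c"
  unfolding clarke_derivative_def
  by (rule INF_lower2[of \<epsilon>]) (use assms in \<open>auto intro!: SUP_least\<close>)

lemma clarke_derivative_less:
  assumes "clarke_derivative p M \<F> \<phi> x d < ereal c"
  obtains \<epsilon> where "\<epsilon> > 0"
    "\<And>y \<tau>. y \<in> adapted \<F> \<Longrightarrow> nrm (\<lambda>\<omega>. y \<omega> - x \<omega>) < \<epsilon> \<Longrightarrow> 0 < \<tau> \<Longrightarrow> \<tau> < \<epsilon> \<Longrightarrow>
      diff_quotient \<phi> y d \<tau> \<le> c"
proof -
  obtain \<epsilon> where \<epsilon>: "\<epsilon> > 0" and less: "(SUP (y, \<tau>) \<in> {(y, \<tau>). y \<in> adapted \<F> \<and>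
      nrm (\<lambda>\<omega>. y \<omega> - x \<omega>) < \<epsilon> \<and> 0 < \<tau> \<and> \<tau> < \<epsilon>}.
      ereal (diff_quotient \<phi> y d \<tau>)) < ereal c" (is "(SUP (y, \<tau>) \<in> ?N. ?q y \<tau>) < _")
    using assms unfolding clarke_derivative_def INF_less_iff by auto
  show ?thesis
  proof (rule that[OF \<epsilon>])
    fix y \<tau> assume "y \<in> adapted \<F>" "nrm (\<lambda>\<omega>. y \<omega> - x \<omega>) < \<epsilon>" "0 < \<tau>" "\<tau> < \<epsilon>"
    then have "(y, \<tau>) \<in> ?N" by simp
    then have "?q y \<tau> \<le> (SUP (y, \<tau>) \<in> ?N. ?q y \<tau>)" by (rule SUP_upper2) simp
    then have "?q y \<tau> < ereal c" using less by (rule le_less_trans)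
    then show "diff_quotient \<phi> y d \<tau> \<le> c" by simp
  qed
qed

lemma clarke_derivative_ge:
  assumes "\<And>\<epsilon>. \<epsilon> > 0 \<Longrightarrow> \<exists>y \<tau>. y \<in> adapted \<F> \<and> nrm (\<lambda>\<omega>. y \<omega> - x \<omega>) < \<epsilon> \<and> 0 < \<tau> \<and> \<tau> < \<epsilon> \<and>
      c \<le> diff_quotient \<phi> y d \<tau>"
  shows "ereal c \<le> clarke_derivative p M \<F> \<phi> x d"
  unfolding clarke_derivative_def
proof (rule INF_greatest)
  fix \<epsilon> :: real assume "\<epsilon> \<in> {0<..}"
  then have "\<epsilon> > 0" by simp
  from assms[OF this] obtain y \<tau> where y: "y \<in> adapted \<F>" "nrm (\<lambda>\<omega>. y \<omega> - x \<omega>) < \<epsilon>" "0 < \<tau>" "\<tau> < \<epsilon>"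
    "c \<le> diff_quotient \<phi> y d \<tau>" by blast
  then show "ereal c \<le> (SUP (y, \<tau>) \<in> {(y, \<tau>). y \<in> adapted \<F> \<and>
      nrm (\<lambda>\<omega>. y \<omega> - x \<omega>) < \<epsilon> \<and> 0 < \<tau> \<and> \<tau> < \<epsilon>}.
      ereal (diff_quotient \<phi> y d \<tau>))"
    by (intro SUP_upper2[of "(y, \<tau>)"]) auto
qed

end

text \<open>The Lipschitz constant bounds all difference quotients in the direction \<open>d\<close> by \<open>L \<parallel>d\<parallel>\<close>, so the
  Clarke derivative is finite and real arithmetic can replace extended real arithmetic.\<close>

locale lipschitz_functional = lp_exponent M p for M :: "'a measure" and p +
  fixes \<F> :: "'t::finite \<Rightarrow> 'a measure"
    and \<phi> :: "('a \<Rightarrow> ('b::euclidean_space)^'t) \<Rightarrow> real" and x :: "'a \<Rightarrow> 'b^'t" and L :: real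
  assumes sub: "\<And>t. subalgebra M (\<F> t)"
    and x: "x \<in> adapted \<F>" and L: "0 \<le> L"
    and lipschitz: "\<And>y z. y \<in> adapted \<F> \<Longrightarrow> z \<in> adapted \<F> \<Longrightarrow> \<bar>\<phi> y - \<phi> z\<bar> \<le> L * nrm (\<lambda>\<omega>. y \<omega> - z \<omega>)"
begin

lemma adapted_step: "y \<in> adapted \<F> \<Longrightarrow> d \<in> adapted \<F> \<Longrightarrow> (\<lambda>\<omega>. y \<omega> + \<tau> *\<^sub>R d \<omega>) \<in> adapted \<F>"
  by (auto simp: adapted_iff intro!: Lp_add Lp_scaleR sub)

lemma in_Lp: "y \<in> adapted \<F> \<Longrightarrow> y \<in> Lp M"
  by (rule adapted_Lp[OF sub])

lemma quotient_bound:
  assumes "y \<in> adapted \<F>" "d \<in> adapted \<F>" "0 < \<tau>"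
  shows "\<bar>diff_quotient \<phi> y d \<tau>\<bar> \<le> L * nrm d"
  using lipschitz[OF adapted_step[OF assms(1,2)] assms(1), of \<tau>] assms(3)
  by (simp add: lp_norm_scaleR divide_le_eq mult_ac abs_divide)

lemma quotient_le:
  assumes "y \<in> adapted \<F>" "d \<in> adapted \<F>" "0 < \<tau>"
  shows "diff_quotient \<phi> y d \<tau> \<le> L * nrm d"
  using quotient_bound[OF assms] by (rule abs_le_D1)

abbreviation "clarke d \<equiv> real_of_ereal (clarke_derivative p M \<F> \<phi> x d)"

lemma clarke_real:
  assumes d: "d \<in> adapted \<F>" shows "clarke_derivative p M \<F> \<phi> x d = ereal (clarke d)"
proof -
  have "clarke_derivative p M \<F> \<phi> x d \<le> ereal (L * nrm d)"
    by (rule clarke_derivative_le[of 1]) (use quotient_le[OF _ d] in auto)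
  moreover have "ereal (- (L * nrm d)) \<le> clarke_derivative p M \<F> \<phi> x d"
  proof (rule clarke_derivative_ge)
    fix \<epsilon> :: real assume "\<epsilon> > 0"
    then show "\<exists>y \<tau>. y \<in> adapted \<F> \<and> nrm (\<lambda>\<omega>. y \<omega> - x \<omega>) < \<epsilon> \<and> 0 < \<tau> \<and> \<tau> < \<epsilon> \<and>
        - (L * nrm d) \<le> diff_quotient \<phi> y d \<tau>"
      using x quotient_bound[OF x d, of "\<epsilon>/2", THEN abs_le_D2]
      by (intro exI[of _ x] exI[of _ "\<epsilon>/2"] conjI) (simp_all add: lp_norm_zero del: divide_divide_eq_left)
  qed
  ultimately show ?thesis by (cases "clarke_derivative p M \<F> \<phi> x d") auto
qed

lemma clarke_le_real:
  assumes "d \<in> adapted \<F>" "\<epsilon> > 0"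
    and "\<And>y \<tau>. y \<in> adapted \<F> \<Longrightarrow> nrm (\<lambda>\<omega>. y \<omega> - x \<omega>) < \<epsilon> \<Longrightarrow> 0 < \<tau> \<Longrightarrow> \<tau> < \<epsilon> \<Longrightarrow>
      diff_quotient \<phi> y d \<tau> \<le> c"
  shows "clarke d \<le> c"
proof -
  have "clarke_derivative p M \<F> \<phi> x d \<le> ereal c"
    by (rule clarke_derivative_le[OF assms(2)]) (rule assms(3))
  then show ?thesis using clarke_real[OF assms(1)] by (metis ereal_less_eq(3))
qed

lemma clarke_ge_real:
  assumes "d \<in> adapted \<F>"
    and "\<And>\<epsilon>. \<epsilon> > 0 \<Longrightarrow> \<exists>y \<tau>. y \<in> adapted \<F> \<and> nrm (\<lambda>\<omega>. y \<omega> - x \<omega>) < \<epsilon> \<and> 0 < \<tau> \<and> \<tau> < \<epsilon> \<and>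
      c \<le> diff_quotient \<phi> y d \<tau>"
  shows "c \<le> clarke d"
proof -
  have "ereal c \<le> clarke_derivative p M \<F> \<phi> x d"
    by (rule clarke_derivative_ge) (rule assms(2))
  then show ?thesis using clarke_real[OF assms(1)] by (metis ereal_less_eq(3))
qed

lemma clarke_upper_bound: "d \<in> adapted \<F> \<Longrightarrow> clarke d \<le> L * nrm d"
  by (rule clarke_le_real[of _ 1]) (use quotient_le in auto)

lemma clarke_neighbourhood:
  assumes "d \<in> adapted \<F>" "clarke d < c"
  obtains \<epsilon> where "\<epsilon> > 0"
    "\<And>y \<tau>. y \<in> adapted \<F> \<Longrightarrow> nrm (\<lambda>\<omega>. y \<omega> - x \<omega>) < \<epsilon> \<Longrightarrow> 0 < \<tau> \<Longrightarrow> \<tau> < \<epsilon> \<Longrightarrow>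
      diff_quotient \<phi> y d \<tau> \<le> c"
proof -
  have "clarke_derivative p M \<F> \<phi> x d < ereal c"
    using assms(2) clarke_real[OF assms(1)] by (metis less_ereal.simps(1))
  from clarke_derivative_less[OF this] that show ?thesis by blast
qed

text \<open>Moving from \<open>y\<close> along \<open>d + e\<close> is moving along \<open>d\<close> and then, from a nearby point, along \<open>e\<close>; the
  base point varies in the definition of the Clarke derivative precisely so that this makes it
  subadditive.\<close>

lemma clarke_subadditive:
  assumes d: "d \<in> adapted \<F>" and e: "e \<in> adapted \<F>"
  shows "clarke (d + e) \<le> clarke d + clarke e"
proof (rule field_le_epsilon)
  fix \<eta> :: real assume \<eta>: "\<eta> > 0"
  obtain \<alpha> where \<alpha>: "\<alpha> > 0" "\<And>y \<tau>. y \<in> adapted \<F> \<Longrightarrow> nrm (\<lambda>\<omega>. y \<omega> - x \<omega>) < \<alpha> \<Longrightarrow> 0 < \<tau> \<Longrightarrow> \<tau> < \<alpha> \<Longrightarrow>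
      diff_quotient \<phi> y d \<tau> \<le> clarke d + \<eta> / 2"
    using clarke_neighbourhood[OF d, of "clarke d + \<eta> / 2"] \<eta> by auto
  obtain \<beta> where \<beta>: "\<beta> > 0" "\<And>y \<tau>. y \<in> adapted \<F> \<Longrightarrow> nrm (\<lambda>\<omega>. y \<omega> - x \<omega>) < \<beta> \<Longrightarrow> 0 < \<tau> \<Longrightarrow> \<tau> < \<beta> \<Longrightarrow>
      diff_quotient \<phi> y e \<tau> \<le> clarke e + \<eta> / 2"
    using clarke_neighbourhood[OF e, of "clarke e + \<eta> / 2"] \<eta> by auto
  define \<epsilon> where "\<epsilon> = min \<alpha> (\<beta> / (1 + nrm d))"
  have n: "0 \<le> nrm d" by (rule lp_norm_nonneg)
  have \<epsilon>: "\<epsilon> > 0" using \<alpha>(1) \<beta>(1) n by (simp add: \<epsilon>_def add_pos_nonneg)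
  have \<epsilon>\<beta>: "\<epsilon> + \<epsilon> * nrm d \<le> \<beta>"
  proof -
    have "\<epsilon> * (1 + nrm d) \<le> \<beta> / (1 + nrm d) * (1 + nrm d)" using n by (intro mult_right_mono) (auto simp: \<epsilon>_def)
    also have "\<beta> / (1 + nrm d) * (1 + nrm d) = \<beta>" using n by (simp add: add_nonneg_eq_0_iff)
    finally show ?thesis by (simp add: distrib_left)
  qed
  show "clarke (d + e) \<le> clarke d + clarke e + \<eta>"
  proof (rule clarke_le_real[OF _ \<epsilon>])
    show "d + e \<in> adapted \<F>" using subspace_add[OF subspace_adapted[OF sub] d e] .
    fix y \<tau> assume y: "y \<in> adapted \<F>" "nrm (\<lambda>\<omega>. y \<omega> - x \<omega>) < \<epsilon>" and \<tau>: "0 < \<tau>" "\<tau> < \<epsilon>"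
    define z where "z \<omega> = y \<omega> + \<tau> *\<^sub>R d \<omega>" for \<omega>
    have z: "z \<in> adapted \<F>" unfolding z_def by (rule adapted_step[OF y(1) d])
    have "nrm (\<lambda>\<omega>. z \<omega> - x \<omega>) = nrm (\<lambda>\<omega>. (y \<omega> - x \<omega>) + \<tau> *\<^sub>R d \<omega>)" by (simp add: z_def algebra_simps)
    also have "\<dots> \<le> nrm (\<lambda>\<omega>. y \<omega> - x \<omega>) + nrm (\<lambda>\<omega>. \<tau> *\<^sub>R d \<omega>)"
      by (intro lp_norm_triangle Lp_diff Lp_scaleR in_Lp y d x subalgebra_self)
    also have "\<dots> < \<epsilon> + \<epsilon> * nrm d"
      using y(2) \<tau> n by (intro add_less_le_mono) (auto simp: lp_norm_scaleR intro: mult_right_mono)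
    finally have zx: "nrm (\<lambda>\<omega>. z \<omega> - x \<omega>) < \<beta>" using \<epsilon>\<beta> by simp
    have "\<epsilon> \<le> \<epsilon> + \<epsilon> * nrm d" using \<epsilon> n by simp
    then have \<tau>\<beta>: "\<tau> < \<beta>" using \<tau>(2) \<epsilon>\<beta> by linarith
    have y\<alpha>: "nrm (\<lambda>\<omega>. y \<omega> - x \<omega>) < \<alpha>" "\<tau> < \<alpha>" using y(2) \<tau>(2) by (auto simp: \<epsilon>_def)
    have "(\<lambda>\<omega>. y \<omega> + \<tau> *\<^sub>R (d + e) \<omega>) = (\<lambda>\<omega>. z \<omega> + \<tau> *\<^sub>R e \<omega>)"
      by (simp add: z_def scaleR_add_right fun_eq_iff add.assoc)
    then have "(\<phi> (\<lambda>\<omega>. y \<omega> + \<tau> *\<^sub>R (d + e) \<omega>) - \<phi> y) / \<tau>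
        = (\<phi> (\<lambda>\<omega>. z \<omega> + \<tau> *\<^sub>R e \<omega>) - \<phi> z) / \<tau> + diff_quotient \<phi> y d \<tau>"
      by (simp add: z_def[abs_def] diff_divide_distrib)
    also have "\<dots> \<le> (clarke e + \<eta> / 2) + (clarke d + \<eta> / 2)"
      using \<beta>(2)[OF z zx \<tau>(1) \<tau>\<beta>] \<alpha>(2)[OF y(1) y\<alpha>(1) \<tau>(1) y\<alpha>(2)] by (rule add_mono)
    finally show "(\<phi> (\<lambda>\<omega>. y \<omega> + \<tau> *\<^sub>R (d + e) \<omega>) - \<phi> y) / \<tau> \<le> clarke d + clarke e + \<eta>" by simp
  qed
qed

lemma clarke_scale_le:
  assumes d: "d \<in> adapted \<F>" and c: "c > 0"
  shows "clarke (c *\<^sub>R d) \<le> c * clarke d"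
proof (rule field_le_epsilon)
  fix \<eta> :: real assume \<eta>: "\<eta> > 0"
  obtain \<alpha> where \<alpha>: "\<alpha> > 0" "\<And>y \<tau>. y \<in> adapted \<F> \<Longrightarrow> nrm (\<lambda>\<omega>. y \<omega> - x \<omega>) < \<alpha> \<Longrightarrow> 0 < \<tau> \<Longrightarrow> \<tau> < \<alpha> \<Longrightarrow>
      diff_quotient \<phi> y d \<tau> \<le> clarke d + \<eta> / c"
    using clarke_neighbourhood[OF d, of "clarke d + \<eta> / c"] \<eta> c by auto
  show "clarke (c *\<^sub>R d) \<le> c * clarke d + \<eta>"
  proof (rule clarke_le_real)
    show "c *\<^sub>R d \<in> adapted \<F>" using subspace_scale[OF subspace_adapted[OF sub] d] .
    show "0 < min \<alpha> (\<alpha> / c)" using \<alpha>(1) c by simp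
    fix y \<tau> assume y: "y \<in> adapted \<F>" "nrm (\<lambda>\<omega>. y \<omega> - x \<omega>) < min \<alpha> (\<alpha> / c)"
      and \<tau>: "0 < \<tau>" "\<tau> < min \<alpha> (\<alpha> / c)"
    have "\<tau> * c < \<alpha>" using \<tau>(2) c by (simp add: less_divide_eq)
    then have "(\<phi> (\<lambda>\<omega>. y \<omega> + (\<tau> * c) *\<^sub>R d \<omega>) - \<phi> y) / (\<tau> * c) \<le> clarke d + \<eta> / c"
      using y \<tau>(1) c by (intro \<alpha>(2)) auto
    then have "c * ((\<phi> (\<lambda>\<omega>. y \<omega> + (\<tau> * c) *\<^sub>R d \<omega>) - \<phi> y) / (\<tau> * c)) \<le> c * (clarke d + \<eta> / c)"
      using c by (intro mult_left_mono) auto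
    also have "c * ((\<phi> (\<lambda>\<omega>. y \<omega> + (\<tau> * c) *\<^sub>R d \<omega>) - \<phi> y) / (\<tau> * c))
        = (\<phi> (\<lambda>\<omega>. y \<omega> + \<tau> *\<^sub>R (c *\<^sub>R d) \<omega>) - \<phi> y) / \<tau>"
      using c by (simp add: scaleR_fun_def)
    also have "c * (clarke d + \<eta> / c) = c * clarke d + \<eta>" using c by (simp add: distrib_left)
    finally show "(\<phi> (\<lambda>\<omega>. y \<omega> + \<tau> *\<^sub>R (c *\<^sub>R d) \<omega>) - \<phi> y) / \<tau> \<le> c * clarke d + \<eta>" .
  qed
qed

lemma clarke_sublinear: "sublinear_on (adapted \<F>) clarke"
  unfolding sublinear_on_def
proof (intro conjI ballI allI impI)
  fix d :: "'a \<Rightarrow> 'b^'t" and c :: real assume d: "d \<in> adapted \<F>" and c: "c > 0"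
  have cd: "c *\<^sub>R d \<in> adapted \<F>" using subspace_scale[OF subspace_adapted[OF sub] d] .
  have "clarke (inverse c *\<^sub>R (c *\<^sub>R d)) \<le> inverse c * clarke (c *\<^sub>R d)"
    using c by (intro clarke_scale_le cd) simp
  then have "clarke d \<le> inverse c * clarke (c *\<^sub>R d)" using c by simp
  then have "c * clarke d \<le> clarke (c *\<^sub>R d)" using c by (simp add: field_simps)
  with clarke_scale_le[OF d c] show "clarke (c *\<^sub>R d) = c * clarke d" by simp
qed (rule clarke_subadditive)

end

section \<open>Exact penalization at a local minimum\<close>

context lp_exponent
begin

definition embed :: "'t::finite \<Rightarrow> ('a \<Rightarrow> 'b::euclidean_space) \<Rightarrow> 'a \<Rightarrow> 'b^'t" where
  "embed t u \<omega> = axis t (u \<omega>)"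

lemma embed_component: "embed t u \<omega> $ s = (if s = t then u \<omega> else 0)"
  by (simp add: embed_def axis_def)

lemma embed_adapted: "u \<in> Lp (\<F> t) \<Longrightarrow> embed t u \<in> adapted \<F>"
  unfolding adapted_iff
proof
  fix s assume "u \<in> Lp (\<F> t)"
  then show "(\<lambda>\<omega>. embed t u \<omega> $ s) \<in> Lp (\<F> s)"
    by (cases "s = t") (auto simp: embed_component Lp_zero)
qed

lemma lp_norm_embed: "nrm (embed t u) = nrm u"
  by (simp add: lp_norm_def embed_def norm_axis)

lemma sum_embed: "(\<Sum>t\<in>UNIV. embed t (\<lambda>\<omega>. d \<omega> $ t)) = d"
  by (rule ext) (simp add: sum_fun_apply embed_def sum_axis)

text \<open>The space of adapted processes is the direct sum of its blocks, and block \<open>t\<close> is a Lebesgue space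
  over the information of stage \<open>t\<close>; hence the components of the representing process are again
  adapted.\<close>

lemma adapted_functional_representation:
  fixes \<F> :: "'t::finite \<Rightarrow> 'a measure" and h :: "('a \<Rightarrow> ('b::euclidean_space)^'t) \<Rightarrow> real"
  assumes sub: "\<And>t. subalgebra M (\<F> t)" and q: "1 / ennreal p + 1 / q = 1"
    and h: "linear_functional_on (adapted \<F>) h" and C: "0 \<le> C"
    and bound: "\<And>t u. u \<in> Lp (\<F> t) \<Longrightarrow> \<bar>h (embed t u)\<bar> \<le> C * nrm u"
  obtains w where "\<And>t. w t \<in> lp_space q M (\<F> t)"
    "\<And>t u. u \<in> Lp (\<F> t) \<Longrightarrow> integrable M (\<lambda>\<omega>. w t \<omega> \<bullet> u \<omega>)"
    "\<And>t u. u \<in> Lp (\<F> t) \<Longrightarrow> h (embed t u) = pairing M (w t) u"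
    "\<And>d. d \<in> adapted \<F> \<Longrightarrow> h d = (\<Sum>t\<in>UNIV. pairing M (w t) (\<lambda>\<omega>. d \<omega> $ t))"
proof -
  have W: "subspace (adapted \<F> :: ('a \<Rightarrow> 'b^'t) set)" by (rule subspace_adapted[OF sub])
  have "\<exists>w. w \<in> lp_space q M (\<F> t) \<and>
      (\<forall>u\<in>Lp (\<F> t). integrable M (\<lambda>\<omega>. w \<omega> \<bullet> u \<omega>) \<and> h (embed t u) = pairing M w u)" for t
  proof -
    have "linear_functional_on (Lp (\<F> t)) (\<lambda>u. h (embed t u))"
      unfolding linear_functional_on_def
    proof (intro conjI ballI allI)
      fix u v :: "'a \<Rightarrow> 'b" assume uv: "u \<in> Lp (\<F> t)" "v \<in> Lp (\<F> t)"
      have "embed t (u + v) = embed t u + (embed t v :: 'a \<Rightarrow> 'b^'t)"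
        by (simp add: fun_eq_iff vec_eq_iff embed_component)
      then show "h (embed t (u + v)) = h (embed t u) + h (embed t v)"
        using linear_functional_on_add[OF h embed_adapted[where \<F> = \<F>, OF uv(1)] embed_adapted[where \<F> = \<F>, OF uv(2)]] by simp
    next
      fix u :: "'a \<Rightarrow> 'b" and c assume u: "u \<in> Lp (\<F> t)"
      have "embed t (c *\<^sub>R u) = c *\<^sub>R (embed t u :: 'a \<Rightarrow> 'b^'t)"
        by (simp add: fun_eq_iff vec_eq_iff embed_component scaleR_fun_def)
      then show "h (embed t (c *\<^sub>R u)) = c * h (embed t u)"
        using linear_functional_on_scale[OF h embed_adapted[where \<F> = \<F>, OF u]] by simp
    qed
    then show ?thesis
    proof (rule Lp_functional_representation[OF sub q _ C])
      show "\<bar>h (embed t u)\<bar> \<le> C * nrm u" if "u \<in> Lp (\<F> t)" for u using that by (rule bound)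
    qed blast
  qed
  then have "\<forall>t. \<exists>w. w \<in> lp_space q M (\<F> t) \<and>
      (\<forall>u\<in>Lp (\<F> t). integrable M (\<lambda>\<omega>. w \<omega> \<bullet> u \<omega>) \<and> h (embed t u) = pairing M w u)" ..
  from choice[OF this] obtain w where "\<forall>t. w t \<in> lp_space q M (\<F> t) \<and>
      (\<forall>u\<in>Lp (\<F> t). integrable M (\<lambda>\<omega>. w t \<omega> \<bullet> u \<omega>) \<and> h (embed t u) = pairing M (w t) u)" ..
  then have w: "w t \<in> lp_space q M (\<F> t)"
    "u \<in> Lp (\<F> t) \<Longrightarrow> integrable M (\<lambda>\<omega>. w t \<omega> \<bullet> u \<omega>)"
    "u \<in> Lp (\<F> t) \<Longrightarrow> h (embed t u) = pairing M (w t) u" for t u by blast+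
  show ?thesis
  proof (rule that[of w])
    fix d :: "'a \<Rightarrow> 'b^'t" assume d: "d \<in> adapted \<F>"
    then have dt: "(\<lambda>\<omega>. d \<omega> $ t) \<in> Lp (\<F> t)" for t by (simp add: adapted_iff)
    have "h d = h (\<Sum>t\<in>UNIV. embed t (\<lambda>\<omega>. d \<omega> $ t))" by (simp add: sum_embed)
    also have "\<dots> = (\<Sum>t\<in>UNIV. h (embed t (\<lambda>\<omega>. d \<omega> $ t)))"
      using dt by (intro linear_functional_on_sum[OF h W] embed_adapted)
    finally show "h d = (\<Sum>t\<in>UNIV. pairing M (w t) (\<lambda>\<omega>. d \<omega> $ t))" using w(3)[OF dt] by simp
  qed (use w in auto)
qed

end

locale optimal_policy = recourse_problem M p \<F> f f' F Y X
  for M :: "'a measure" and p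
    and \<F> :: "'t::{finite,linorder} \<Rightarrow> 'a measure"
    and f :: "'t \<Rightarrow> (real^'n, 't) vec \<Rightarrow> 'a \<Rightarrow> real^'m"
    and f' F Y X +
  fixes \<phi> :: "('a \<Rightarrow> (real^'n, 't) vec) \<Rightarrow> real" and xh :: "'a \<Rightarrow> (real^'n, 't) vec" and q :: ennreal
  assumes conjugate: "1 / ennreal p + 1 / q = 1"
    and lipschitz: "lp_lipschitz p M \<F> \<phi>"
    and local_min: "lp_local_minimum p M \<phi> (feasible_policies (ennreal p) M \<F> F Y X) xh"
begin

lemma xh: "xh \<in> adapted \<F>"
  using local_min by (simp add: lp_local_minimum_def feasible_policies_def)

lemma xh_Lp: "(\<lambda>\<omega>. xh \<omega> $ t) \<in> Lp (\<F> t)"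
  using xh by (simp add: adapted_iff)

abbreviation "fh t \<equiv> \<lambda>\<omega>. f t (xh \<omega>) \<omega>"
abbreviation "dirY t \<equiv> feasible_directions (\<F> t) (Y t) (fh t)"
abbreviation "dirX t \<equiv> feasible_directions (\<F> t) (X t) (\<lambda>\<omega>. xh \<omega> $ t)"

lemma xh_X: "AE \<omega> in M. xh \<omega> $ t \<in> X t \<omega>"
  using local_min by (simp add: lp_local_minimum_def feasible_policies_def)

lemma fh_Y: "AE \<omega> in M. fh t \<omega> \<in> Y t \<omega>"
proof -
  have "AE \<omega> in M. F xh \<omega> $ t \<in> Y t \<omega>"
    using local_min by (simp add: lp_local_minimum_def feasible_policies_def)
  then show ?thesis using AE_F[OF xh, of t] by eventually_elim simp
qed

lemma convex_Y: "\<omega> \<in> space M \<Longrightarrow> convex (Y t \<omega>)" and convex_X: "\<omega> \<in> space M \<Longrightarrow> convex (X t \<omega>)"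
  using Y(2) X(2) by auto

lemma lipschitz_constant:
  obtains L where "lipschitz_functional M p \<F> \<phi> xh L"
proof -
  obtain L where L: "\<forall>x \<in> adapted \<F>. \<forall>y \<in> adapted \<F>. \<bar>\<phi> x - \<phi> y\<bar> \<le> L * nrm (\<lambda>\<omega>. x \<omega> - y \<omega>)"
    using lipschitz unfolding lp_lipschitz_def by blast
  have "lipschitz_functional M p \<F> \<phi> xh (max L 0)"
  proof unfold_locales
    fix y z :: "'a \<Rightarrow> (real^'n, 't) vec" assume "y \<in> adapted \<F>" "z \<in> adapted \<F>"
    then have "\<bar>\<phi> y - \<phi> z\<bar> \<le> L * nrm (\<lambda>\<omega>. y \<omega> - z \<omega>)" using L by blast
    also have "\<dots> \<le> max L 0 * nrm (\<lambda>\<omega>. y \<omega> - z \<omega>)" by (intro mult_right_mono lp_norm_nonneg) simp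
    finally show "\<bar>\<phi> y - \<phi> z\<bar> \<le> max L 0 * nrm (\<lambda>\<omega>. y \<omega> - z \<omega>)" .
  qed (use sub xh in auto)
  then show ?thesis by (rule that)
qed

abbreviation "clarke d \<equiv> real_of_ereal (clarke_derivative p M \<F> \<phi> xh d)"

text \<open>Exact penalization. Perturb \<open>xh\<close> by \<open>\<tau> d\<close> and compare with the points \<open>fh + \<tau> y\<close> and
  \<open>xh + \<tau> v\<close> of the constraint sets: the error bound produces a feasible policy at a distance
  of order \<open>\<tau> (\<Sum> \<parallel>A d - y\<parallel> + \<parallel>d - v\<parallel>) + o(\<tau>)\<close> from the perturbed one, and there \<open>\<phi>\<close> is not smaller
  than at \<open>xh\<close>.\<close>

lemma penalized_optimality:
  obtains N where "0 \<le> N"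
    "\<And>d y v. d \<in> adapted \<F> \<Longrightarrow> (\<And>t. y t \<in> dirY t) \<Longrightarrow> (\<And>t. v t \<in> dirX t) \<Longrightarrow>
      0 \<le> clarke d + N * (\<Sum>t\<in>UNIV. nrm (\<lambda>\<omega>. lin xh t d \<omega> - y t \<omega>) + nrm (\<lambda>\<omega>. d \<omega> $ t - v t \<omega>))"
proof -
  obtain K where K: "0 \<le> K"
    "\<And>x s r. x \<in> adapted \<F> \<Longrightarrow> (\<And>t. s t \<in> selections Y t) \<Longrightarrow> (\<And>t. r t \<in> selections X t) \<Longrightarrow>
      \<exists>z\<in>feasible. nrm (\<lambda>\<omega>. z \<omega> - x \<omega>)
        \<le> K * (\<Sum>t\<in>UNIV. nrm (\<lambda>\<omega>. f t (x \<omega>) \<omega> - s t \<omega>) + nrm (\<lambda>\<omega>. x \<omega> $ t - r t \<omega>))"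
    using feasible_error_bound by blast
  obtain L where "lipschitz_functional M p \<F> \<phi> xh L" by (rule lipschitz_constant)
  then interpret \<phi>: lipschitz_functional M p \<F> \<phi> xh L .
  obtain \<epsilon>0 where \<epsilon>0: "\<epsilon>0 > 0" "\<And>y. y \<in> feasible \<Longrightarrow> nrm (\<lambda>\<omega>. y \<omega> - xh \<omega>) < \<epsilon>0 \<Longrightarrow> \<phi> xh \<le> \<phi> y"
    using local_min unfolding lp_local_minimum_def by blast
  show ?thesis
  proof (rule that[of "L * K"])
    show "0 \<le> L * K" using \<phi>.L K(1) by simp
    fix d :: "'a \<Rightarrow> (real^'n, 't) vec" and y :: "'t \<Rightarrow> 'a \<Rightarrow> real^'m" and v :: "'t \<Rightarrow> 'a \<Rightarrow> real^'n"
    assume d: "d \<in> adapted \<F>" and y: "\<And>t. y t \<in> dirY t" and v: "\<And>t. v t \<in> dirX t"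
    have "\<forall>t. \<exists>\<delta>>0. \<forall>\<tau>. 0 \<le> \<tau> \<longrightarrow> \<tau> \<le> \<delta> \<longrightarrow> (AE \<omega> in M. fh t \<omega> + \<tau> *\<^sub>R y t \<omega> \<in> Y t \<omega>)"
      by (intro allI) (rule feasible_directions_step[OF convex_Y fh_Y y], assumption, blast)
    from choice[OF this] obtain \<delta>Y
      where "\<forall>t. \<delta>Y t > 0 \<and> (\<forall>\<tau>. 0 \<le> \<tau> \<longrightarrow> \<tau> \<le> \<delta>Y t \<longrightarrow> (AE \<omega> in M. fh t \<omega> + \<tau> *\<^sub>R y t \<omega> \<in> Y t \<omega>))" ..
    then have \<delta>Y: "\<delta>Y t > 0" "0 \<le> \<tau> \<Longrightarrow> \<tau> \<le> \<delta>Y t \<Longrightarrow> AE \<omega> in M. fh t \<omega> + \<tau> *\<^sub>R y t \<omega> \<in> Y t \<omega>" for t \<tau>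
      by blast+
    have "\<forall>t. \<exists>\<delta>>0. \<forall>\<tau>. 0 \<le> \<tau> \<longrightarrow> \<tau> \<le> \<delta> \<longrightarrow> (AE \<omega> in M. xh \<omega> $ t + \<tau> *\<^sub>R v t \<omega> \<in> X t \<omega>)"
      by (intro allI) (rule feasible_directions_step[OF convex_X xh_X v], assumption, blast)
    from choice[OF this] obtain \<delta>X
      where "\<forall>t. \<delta>X t > 0 \<and> (\<forall>\<tau>. 0 \<le> \<tau> \<longrightarrow> \<tau> \<le> \<delta>X t \<longrightarrow> (AE \<omega> in M. xh \<omega> $ t + \<tau> *\<^sub>R v t \<omega> \<in> X t \<omega>))" ..
    then have \<delta>X: "\<delta>X t > 0" "0 \<le> \<tau> \<Longrightarrow> \<tau> \<le> \<delta>X t \<Longrightarrow> AE \<omega> in M. xh \<omega> $ t + \<tau> *\<^sub>R v t \<omega> \<in> X t \<omega>" for t \<tau>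
      by blast+
    \<comment> \<open>A common step length for all stages and both kinds of constraints.\<close>
    define \<delta> where "\<delta> = Min (range (\<lambda>t. min (\<delta>Y t) (\<delta>X t)))"
    have \<delta>: "\<delta> > 0" unfolding \<delta>_def using \<delta>Y(1) \<delta>X(1) by (subst Min_gr_iff) auto
    have \<delta>min: "\<delta> \<le> min (\<delta>Y t) (\<delta>X t)" for t unfolding \<delta>_def by (intro Min_le) auto
    have \<delta>le: "\<delta> \<le> \<delta>Y t" "\<delta> \<le> \<delta>X t" for t using \<delta>min[of t] by auto
    define \<tau> where "\<tau> k = \<delta> * inverse (real (Suc k))" for k
    have \<tau>pos: "\<tau> k > 0" for k using \<delta> by (simp add: \<tau>_def)
    have \<tau>le: "\<tau> k \<le> \<delta>" for k
      using mult_left_mono[of "inverse (real (Suc k))" 1 \<delta>] \<delta> by (simp add: \<tau>_def inverse_le_1_iff)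
    have \<tau>lim: "\<tau> \<longlonglongrightarrow> 0"
      using tendsto_mult_right_zero[OF LIMSEQ_inverse_real_of_nat, of \<delta>] by (simp add: \<tau>_def[abs_def])
    define x where "x k = (\<lambda>\<omega>. xh \<omega> + \<tau> k *\<^sub>R d \<omega>)" for k
    have x: "x k \<in> adapted \<F>" for k unfolding x_def by (rule \<phi>.adapted_step[OF xh d])
    \<comment> \<open>The remainder of the linearization at stage \<open>t\<close>, relative to the step.\<close>
    define e where "e k t = (\<lambda>\<omega>. inverse (\<tau> k) *\<^sub>R (f t (x k \<omega>) \<omega> - fh t \<omega>) - lin xh t d \<omega>)" for k t
    define R where "R = (\<Sum>t\<in>UNIV. nrm (\<lambda>\<omega>. lin xh t d \<omega> - y t \<omega>) + nrm (\<lambda>\<omega>. d \<omega> $ t - v t \<omega>))"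
    define E where "E k = (\<Sum>t\<in>UNIV. nrm (e k t))" for k
    have "(\<lambda>k. nrm (e k t)) \<longlonglongrightarrow> 0" for t
      unfolding e_def x_def by (rule linearization_error[OF xh d \<tau>lim \<tau>pos])
    then have Elim: "E \<longlonglongrightarrow> 0" unfolding E_def[abs_def] by (rule tendsto_null_sum)
    have yL: "y t \<in> Lp (\<F> t)" and vL: "v t \<in> Lp (\<F> t)" for t
      using y v by (auto intro: feasible_directions_Lp)
    have "\<exists>z\<in>feasible. nrm (\<lambda>\<omega>. z \<omega> - x k \<omega>) \<le> \<tau> k * (K * (E k + R))" for k
    proof -
      have s: "(\<lambda>\<omega>. fh t \<omega> + \<tau> k *\<^sub>R y t \<omega>) \<in> selections Y t" for t
        using \<delta>Y(2)[OF less_imp_le[OF \<tau>pos[of k]] order_trans[OF \<tau>le[of k] \<delta>le(1)[of t]]]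
        by (auto simp: lp_selections_def intro!: Lp_add f_Lp xh Lp_scaleR yL sub)
      have r: "(\<lambda>\<omega>. xh \<omega> $ t + \<tau> k *\<^sub>R v t \<omega>) \<in> selections X t" for t
        using \<delta>X(2)[OF less_imp_le[OF \<tau>pos[of k]] order_trans[OF \<tau>le[of k] \<delta>le(2)[of t]]]
        by (auto simp: lp_selections_def intro!: Lp_add xh_Lp Lp_scaleR vL sub)
      obtain z where z: "z \<in> feasible" "nrm (\<lambda>\<omega>. z \<omega> - x k \<omega>)
          \<le> K * (\<Sum>t\<in>UNIV. nrm (\<lambda>\<omega>. f t (x k \<omega>) \<omega> - (fh t \<omega> + \<tau> k *\<^sub>R y t \<omega>))
            + nrm (\<lambda>\<omega>. x k \<omega> $ t - (xh \<omega> $ t + \<tau> k *\<^sub>R v t \<omega>)))"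
        using K(2)[OF x s r] by blast
      have 1: "nrm (\<lambda>\<omega>. f t (x k \<omega>) \<omega> - (fh t \<omega> + \<tau> k *\<^sub>R y t \<omega>))
          \<le> \<tau> k * (nrm (e k t) + nrm (\<lambda>\<omega>. lin xh t d \<omega> - y t \<omega>))" for t
      proof -
        have "f t (x k \<omega>) \<omega> - (fh t \<omega> + \<tau> k *\<^sub>R y t \<omega>) = \<tau> k *\<^sub>R (e k t \<omega> + (lin xh t d \<omega> - y t \<omega>))" for \<omega>
          using \<tau>pos[of k] by (simp add: e_def scaleR_diff_right scaleR_add_right)
        then have "nrm (\<lambda>\<omega>. f t (x k \<omega>) \<omega> - (fh t \<omega> + \<tau> k *\<^sub>R y t \<omega>))
            = \<tau> k * nrm (\<lambda>\<omega>. e k t \<omega> + (lin xh t d \<omega> - y t \<omega>))"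
          using \<tau>pos[of k] by (simp only: lp_norm_scaleR abs_of_pos)
        moreover have "e k t \<in> Lp (\<F> t)" unfolding e_def by (intro Lp_diff Lp_scaleR f_Lp x xh lin_Lp d sub)
        moreover have "(\<lambda>\<omega>. lin xh t d \<omega> - y t \<omega>) \<in> Lp (\<F> t)" by (intro Lp_diff lin_Lp xh d yL sub)
        ultimately show ?thesis
          using lp_norm_triangle[of "e k t" "\<lambda>\<omega>. lin xh t d \<omega> - y t \<omega>"] Lp_subalgebra[OF sub] \<tau>pos[of k]
          by (auto intro!: mult_left_mono)
      qed
      have 2: "nrm (\<lambda>\<omega>. x k \<omega> $ t - (xh \<omega> $ t + \<tau> k *\<^sub>R v t \<omega>)) = \<tau> k * nrm (\<lambda>\<omega>. d \<omega> $ t - v t \<omega>)" for t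
      proof -
        have "x k \<omega> $ t - (xh \<omega> $ t + \<tau> k *\<^sub>R v t \<omega>) = \<tau> k *\<^sub>R (d \<omega> $ t - v t \<omega>)" for \<omega>
          by (simp add: x_def scaleR_diff_right)
        then show ?thesis using \<tau>pos[of k] by (simp only: lp_norm_scaleR abs_of_pos)
      qed
      have "(\<Sum>t\<in>UNIV. nrm (\<lambda>\<omega>. f t (x k \<omega>) \<omega> - (fh t \<omega> + \<tau> k *\<^sub>R y t \<omega>))
            + nrm (\<lambda>\<omega>. x k \<omega> $ t - (xh \<omega> $ t + \<tau> k *\<^sub>R v t \<omega>)))
          \<le> (\<Sum>t\<in>UNIV. \<tau> k * (nrm (e k t) + nrm (\<lambda>\<omega>. lin xh t d \<omega> - y t \<omega>)) + \<tau> k * nrm (\<lambda>\<omega>. d \<omega> $ t - v t \<omega>))"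
        using 1 2 by (intro sum_mono add_mono) auto
      also have "\<dots> = \<tau> k * (E k + R)"
        by (simp add: E_def R_def sum.distrib sum_distrib_left distrib_left)
      finally have "nrm (\<lambda>\<omega>. z \<omega> - x k \<omega>) \<le> K * (\<tau> k * (E k + R))"
        using z(2) K(1) by (meson mult_left_mono order_trans)
      then show ?thesis using z(1) by (intro bexI[of _ z]) (simp_all add: mult.left_commute)
    qed
    then obtain z where z: "\<And>k. z k \<in> feasible" "\<And>k. nrm (\<lambda>\<omega>. z k \<omega> - x k \<omega>) \<le> \<tau> k * (K * (E k + R))"
      by metis
    have zA: "z k \<in> adapted \<F>" for k using z(1)[of k] by (simp add: feasible_policies_def)
    have near: "nrm (\<lambda>\<omega>. z k \<omega> - xh \<omega>) \<le> \<tau> k * (K * (E k + R) + nrm d)" for k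
    proof -
      have "nrm (\<lambda>\<omega>. z k \<omega> - xh \<omega>) = nrm (\<lambda>\<omega>. (z k \<omega> - x k \<omega>) + \<tau> k *\<^sub>R d \<omega>)" by (simp add: x_def)
      also have "\<dots> \<le> nrm (\<lambda>\<omega>. z k \<omega> - x k \<omega>) + nrm (\<lambda>\<omega>. \<tau> k *\<^sub>R d \<omega>)"
        by (intro lp_norm_triangle Lp_diff Lp_scaleR \<phi>.in_Lp zA x d subalgebra_self)
      finally show ?thesis using z(2)[of k] \<tau>pos[of k] by (simp add: lp_norm_scaleR distrib_left)
    qed
    have "(\<lambda>k. \<tau> k * (K * (E k + R) + nrm d)) \<longlonglongrightarrow> 0 * (K * (0 + R) + nrm d)"
      by (intro tendsto_intros \<tau>lim Elim)
    then have ev1: "eventually (\<lambda>k. \<tau> k * (K * (E k + R) + nrm d) < \<epsilon>0) sequentially"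
      using \<epsilon>0(1) by (auto dest: order_tendstoD)
    have quot: "- (L * (K * (E k + R))) \<le> (\<phi> (x k) - \<phi> xh) / \<tau> k"
      if "\<tau> k * (K * (E k + R) + nrm d) < \<epsilon>0" for k
    proof -
      have "\<phi> xh \<le> \<phi> (z k)" using near[of k] that by (intro \<epsilon>0(2) z(1)) simp
      moreover have "\<bar>\<phi> (z k) - \<phi> (x k)\<bar> \<le> L * nrm (\<lambda>\<omega>. z k \<omega> - x k \<omega>)" by (rule \<phi>.lipschitz[OF zA x])
      moreover have "L * nrm (\<lambda>\<omega>. z k \<omega> - x k \<omega>) \<le> L * (\<tau> k * (K * (E k + R)))"
        using z(2) \<phi>.L by (rule mult_left_mono)
      ultimately have "- (L * (K * (E k + R))) * \<tau> k \<le> \<phi> (x k) - \<phi> xh" by (simp add: mult_ac abs_le_iff)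
      then show ?thesis using \<tau>pos[of k] by (simp add: le_divide_eq)
    qed
    have "- (L * (K * R)) \<le> clarke d"
    proof (rule field_le_epsilon)
      fix \<eta> :: real assume \<eta>: "\<eta> > 0"
      have "(\<lambda>k. L * (K * E k)) \<longlonglongrightarrow> L * (K * 0)" by (intro tendsto_intros Elim)
      then have ev2: "eventually (\<lambda>k. L * (K * E k) < \<eta>) sequentially" using \<eta> by (auto dest: order_tendstoD)
      have "- (L * (K * R)) - \<eta> \<le> clarke d"
      proof (rule \<phi>.clarke_ge_real[OF d])
        fix \<epsilon> :: real assume \<epsilon>: "\<epsilon> > 0"
        have "eventually (\<lambda>k. \<tau> k < \<epsilon>) sequentially" using \<tau>lim \<epsilon> by (auto dest: order_tendstoD)
        with ev1 ev2 have "eventually (\<lambda>k. \<tau> k < \<epsilon> \<and> L * (K * E k) < \<eta>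
            \<and> \<tau> k * (K * (E k + R) + nrm d) < \<epsilon>0) sequentially" by eventually_elim auto
        then obtain k where k: "\<tau> k < \<epsilon>" "L * (K * E k) < \<eta>" "\<tau> k * (K * (E k + R) + nrm d) < \<epsilon>0"
          using eventually_happens'[OF sequentially_bot] by blast
        have "- (L * (K * R)) - \<eta> \<le> - (L * (K * (E k + R)))" using k(2) by (simp add: distrib_left)
        also note quot[OF k(3)]
        finally show "\<exists>y \<tau>. y \<in> adapted \<F> \<and> nrm (\<lambda>\<omega>. y \<omega> - xh \<omega>) < \<epsilon> \<and> 0 < \<tau> \<and> \<tau> < \<epsilon> \<and>
            - (L * (K * R)) - \<eta> \<le> diff_quotient \<phi> y d \<tau>"
          using k(1) \<epsilon> xh \<tau>pos by (intro exI[of _ xh] exI[of _ "\<tau> k"]) (simp add: lp_norm_zero x_def)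
      qed
      then show "- (L * (K * R)) \<le> clarke d + \<eta>" by simp
    qed
    then show "0 \<le> clarke d + L * K * (\<Sum>t\<in>UNIV. nrm (\<lambda>\<omega>. lin xh t d \<omega> - y t \<omega>) + nrm (\<lambda>\<omega>. d \<omega> $ t - v t \<omega>))"
      by (simp add: R_def)
  qed
qed

end

section \<open>Multipliers and the adjoint equation\<close>

lemma borel_measurable_completion_AE_eq:
  fixes u v :: "'a \<Rightarrow> 'b::topological_space"
  assumes v: "v \<in> borel_measurable M" and eq: "AE \<omega> in M. u \<omega> = v \<omega>"
  shows "u \<in> borel_measurable (completion M)"
proof (rule measurableI)
  fix S :: "'b set" assume S: "S \<in> sets borel"
  have vS: "v -` S \<inter> space M \<in> sets (completion M)" using measurable_sets[OF v S] by auto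
  have "AE \<omega> in M. \<not> (u \<omega> \<in> S \<and> v \<omega> \<notin> S)" using eq by eventually_elim simp
  then have P: "{\<omega> \<in> space (completion M). u \<omega> \<in> S \<and> v \<omega> \<notin> S} \<in> sets (completion M)"
    using sets_completion_AE by (intro predE)
  have "AE \<omega> in M. \<not> (u \<omega> \<notin> S \<and> v \<omega> \<in> S)" using eq by eventually_elim simp
  then have Q: "{\<omega> \<in> space (completion M). u \<omega> \<notin> S \<and> v \<omega> \<in> S} \<in> sets (completion M)"
    using sets_completion_AE by (intro predE)
  have "u -` S \<inter> space (completion M) = (v -` S \<inter> space M - {\<omega> \<in> space (completion M). u \<omega> \<notin> S \<and> v \<omega> \<in> S})
      \<union> {\<omega> \<in> space (completion M). u \<omega> \<in> S \<and> v \<omega> \<notin> S}"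
    by auto
  then show "u -` S \<inter> space (completion M) \<in> sets (completion M)" using vS P Q by auto
qed auto

text \<open>Integrals over the events of \<open>G\<close>, which characterize the conditional expectation, do not notice
  that the integrand \<open>u\<close> is measurable for the completion only: it may be replaced by \<open>v\<close>.\<close>

lemma real_cond_exp_completion:
  fixes u v g :: "'a \<Rightarrow> real"
  assumes M: "prob_space M" and G: "subalgebra M G"
    and uv: "AE \<omega> in M. u \<omega> = v \<omega>" and v: "integrable M v"
    and g: "integrable M g" "g \<in> borel_measurable G"
    and eq: "\<And>A. A \<in> sets G \<Longrightarrow> (\<integral>\<omega>. indicator A \<omega> * v \<omega> \<partial>M) = (\<integral>\<omega>. indicator A \<omega> * g \<omega> \<partial>M)"
  shows "AE \<omega> in M. real_cond_exp (completion M) G u \<omega> = g \<omega>"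
proof -
  interpret prob_space M by (rule M)
  interpret C: prob_space "completion M" by (rule prob_space_completion)
  have "subalgebra (completion M) G" using G by (auto simp: subalgebra_def)
  then interpret C: finite_measure_subalgebra "completion M" G by unfold_locales
  have [measurable]: "u \<in> borel_measurable (completion M)"
    using v uv by (intro borel_measurable_completion_AE_eq[of v]) auto
  have [measurable]: "v \<in> borel_measurable M" "g \<in> borel_measurable M" using v g by auto
  have uvC: "AE \<omega> in completion M. u \<omega> = v \<omega>" using uv by (rule AE_completion)
  have vC: "integrable (completion M) v" using v by (simp add: integrable_completion)
  have "AE \<omega> in completion M. real_cond_exp (completion M) G u \<omega> = g \<omega>"
  proof (rule C.real_cond_exp_charact)
    show "integrable (completion M) u"
      by (rule iffD2[OF integrable_cong_AE[OF _ _ uvC] vC]) (simp_all add: measurable_completion)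
    show "integrable (completion M) g" using g(1) by (simp add: integrable_completion)
    show "g \<in> borel_measurable G" by (rule g)
    fix A assume A: "A \<in> sets G"
    then have [measurable]: "A \<in> sets M" using G by (auto simp: subalgebra_def)
    have m: "(\<lambda>\<omega>. indicator A \<omega> * v \<omega>) \<in> borel_measurable M" "(\<lambda>\<omega>. indicator A \<omega> * g \<omega>) \<in> borel_measurable M"
      by measurable
    have "(\<integral>\<omega>. indicator A \<omega> * u \<omega> \<partial>completion M) = (\<integral>\<omega>. indicator A \<omega> * v \<omega> \<partial>completion M)"
    proof (rule integral_cong_AE)
      show "(\<lambda>\<omega>. indicator A \<omega> * u \<omega>) \<in> borel_measurable (completion M)"
        by (intro borel_measurable_times borel_measurable_indicator) auto
      show "(\<lambda>\<omega>. indicator A \<omega> * v \<omega>) \<in> borel_measurable (completion M)"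
        using m(1) by (rule measurable_completion)
      show "AE \<omega> in completion M. indicator A \<omega> * u \<omega> = indicator A \<omega> * v \<omega>" using uvC by eventually_elim simp
    qed
    also have "\<dots> = (\<integral>\<omega>. indicator A \<omega> * g \<omega> \<partial>completion M)"
      using eq[OF A] by (simp add: integral_completion[OF m(1)] integral_completion[OF m(2)])
    finally show "(\<integral>\<omega>\<in>A. u \<omega> \<partial>completion M) = (\<integral>\<omega>\<in>A. g \<omega> \<partial>completion M)"
      by (simp add: set_lebesgue_integral_def)
  qed
  then show ?thesis by (simp add: AE_completion_iff)
qed

context optimal_policy
begin

lemma Lq_component_integrable:
  fixes w :: "'a \<Rightarrow> real^'i"
  assumes "w \<in> lp_space q M (\<F> t)" shows "integrable M (\<lambda>\<omega>. w \<omega> $ i)"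
proof -
  have w: "integrable M w" by (rule Lq_integrable[OF sub conjugate assms])
  show ?thesis
  proof (rule Bochner_Integration.integrable_bound[OF w])
    show "(\<lambda>\<omega>. w \<omega> $ i) \<in> borel_measurable M"
      using w by (intro borel_measurable_component) auto
    show "AE \<omega> in M. norm (w \<omega> $ i) \<le> norm (w \<omega>)" by (simp add: component_le_norm_cart)
  qed
qed

lemma Lq_measurable: "w \<in> lp_space q M (\<F> t) \<Longrightarrow> w \<in> borel_measurable (\<F> t)"
  by (simp add: lp_space_def)

lemma transpose_jac_measurable:
  assumes "\<psi> \<in> lp_space q M (\<F> l)"
  shows "(\<lambda>\<omega>. (transpose (jac xh l t \<omega>) *v \<psi> \<omega>) $ j) \<in> borel_measurable (\<F> l)"
  unfolding matrix_vector_mult_def transpose_def vec_lambda_beta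
  using jac_measurable[OF xh] borel_measurable_component[OF Lq_measurable[OF assms]]
  by (intro borel_measurable_sum borel_measurable_times)

lemma transpose_jac_integrable:
  assumes \<psi>: "\<psi> \<in> lp_space q M (\<F> l)"
  shows "integrable M (\<lambda>\<omega>. (transpose (jac xh l t \<omega>) *v \<psi> \<omega>) $ j)"
proof -
  obtain C where C: "0 \<le> C" "AE \<omega> in M. \<forall>t l i j. \<bar>jac xh t l \<omega> $ i $ j\<bar> \<le> C"
    by (rule AE_jac_bound)
  show ?thesis
    unfolding matrix_vector_mult_def transpose_def vec_lambda_beta
  proof (intro Bochner_Integration.integrable_sum)
    fix i
    show "integrable M (\<lambda>\<omega>. jac xh l t \<omega> $ i $ j * \<psi> \<omega> $ i)"
    proof (rule Bochner_Integration.integrable_bound)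
      show "integrable M (\<lambda>\<omega>. C * \<psi> \<omega> $ i)"
        by (intro integrable_mult_right Lq_component_integrable[OF \<psi>])
      show "(\<lambda>\<omega>. jac xh l t \<omega> $ i $ j * \<psi> \<omega> $ i) \<in> borel_measurable M"
        using jac_measurable[OF xh] borel_measurable_component[OF Lq_measurable[OF \<psi>]]
        by (intro borel_measurable_times measurable_from_subalg[OF sub])
      show "AE \<omega> in M. norm (jac xh l t \<omega> $ i $ j * \<psi> \<omega> $ i) \<le> norm (C * \<psi> \<omega> $ i)"
        using C(2)
      proof eventually_elim
        case (elim \<omega>)
        have "\<bar>jac xh l t \<omega> $ i $ j\<bar> * \<bar>\<psi> \<omega> $ i\<bar> \<le> C * \<bar>\<psi> \<omega> $ i\<bar>"
          using elim by (intro mult_right_mono) auto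
        then show ?case using C(1) by (simp add: abs_mult)
      qed
    qed
  qed
qed

text \<open>Only block \<open>t\<close> of the direction is nonzero, so a single Jacobian remains, and it moves to the other
  factor as its transpose.\<close>

lemma inner_lin_embed:
  "\<psi> \<bullet> lin xh l (embed t (\<lambda>\<omega>. c \<omega> *\<^sub>R axis j 1)) \<omega> = c \<omega> * (transpose (jac xh l t \<omega>) *v \<psi>) $ j"
proof -
  have "lin xh l (embed t (\<lambda>\<omega>. c \<omega> *\<^sub>R axis j 1)) \<omega>
      = (\<Sum>s\<in>UNIV. if s = t then jac xh l t \<omega> *v (c \<omega> *\<^sub>R axis j 1) else 0)"
    unfolding lin_def by (intro sum.cong) (auto simp: embed_component)
  then have "lin xh l (embed t (\<lambda>\<omega>. c \<omega> *\<^sub>R axis j 1)) \<omega> = jac xh l t \<omega> *v (c \<omega> *\<^sub>R axis j 1)" by simp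
  then have "\<psi> \<bullet> lin xh l (embed t (\<lambda>\<omega>. c \<omega> *\<^sub>R axis j 1)) \<omega> = (\<psi> v* jac xh l t \<omega>) \<bullet> (c \<omega> *\<^sub>R axis j 1)"
    by (simp only: dot_lmul_matrix)
  then show ?thesis by (simp add: inner_axis)
qed

text \<open>The sublinear functional \<open>clarke u + N (\<Sum> \<parallel>y\<^sub>t\<parallel> + \<parallel>v\<^sub>t\<parallel>)\<close> is nonnegative on the convex cone of all
  \<open>(d, A d - y, d - v)\<close>. A linear minorant that is nonnegative on the cone splits into \<open>g\<close>, \<open>\<psi>\<close>, \<open>\<nu>\<close>:
  the lines in the cone give the adjoint equation, the remaining directions the normality, and
  domination the bounds needed to represent the three parts by functions.\<close>

lemma multiplier_rule:
  obtains g :: "'t \<Rightarrow> 'a \<Rightarrow> real^'n" and \<psi> :: "'t \<Rightarrow> 'a \<Rightarrow> real^'m" and \<nu> :: "'t \<Rightarrow> 'a \<Rightarrow> real^'n"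
  where "\<And>t. g t \<in> lp_space q M (\<F> t)" "\<And>t. \<psi> t \<in> lp_space q M (\<F> t)" "\<And>t. \<nu> t \<in> lp_space q M (\<F> t)"
    "\<And>t u. u \<in> Lp (\<F> t) \<Longrightarrow> integrable M (\<lambda>\<omega>. g t \<omega> \<bullet> u \<omega>)"
    "\<And>d. d \<in> adapted \<F> \<Longrightarrow> (\<Sum>t\<in>UNIV. pairing M (g t) (\<lambda>\<omega>. d \<omega> $ t)) \<le> clarke d"
    "\<And>t y. y \<in> dirY t \<Longrightarrow> pairing M (\<psi> t) y \<le> 0"
    "\<And>t v. v \<in> dirX t \<Longrightarrow> pairing M (\<nu> t) v \<le> 0"
    "\<And>t u. u \<in> Lp (\<F> t) \<Longrightarrow> pairing M (g t) u
       + (\<Sum>l\<in>UNIV. pairing M (\<psi> l) (lin xh l (embed t u))) + pairing M (\<nu> t) u = 0"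
proof -
  obtain N where N: "0 \<le> N" and opt:
    "\<And>d y v. d \<in> adapted \<F> \<Longrightarrow> (\<And>t. y t \<in> dirY t) \<Longrightarrow> (\<And>t. v t \<in> dirX t) \<Longrightarrow>
      0 \<le> clarke d + N * (\<Sum>t\<in>UNIV. nrm (\<lambda>\<omega>. lin xh t d \<omega> - y t \<omega>) + nrm (\<lambda>\<omega>. d \<omega> $ t - v t \<omega>))"
    by (rule penalized_optimality) blast
  obtain L where "lipschitz_functional M p \<F> \<phi> xh L" by (rule lipschitz_constant)
  then interpret \<phi>: lipschitz_functional M p \<F> \<phi> xh L .
  let ?U = "adapted \<F> :: ('a \<Rightarrow> (real^'n, 't) vec) set" and ?V = "adapted \<F> :: ('a \<Rightarrow> (real^'m, 't) vec) set"
  have SU: "subspace ?U" and SV: "subspace ?V" by (rule subspace_adapted[OF sub])+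
  define nn where "nn y = (\<Sum>t\<in>UNIV. nrm (\<lambda>\<omega>. y \<omega> $ t))" for y :: "'a \<Rightarrow> (real^'n, 't) vec"
  define nm where "nm y = (\<Sum>t\<in>UNIV. nrm (\<lambda>\<omega>. y \<omega> $ t))" for y :: "'a \<Rightarrow> (real^'m, 't) vec"
  have comp: "(\<lambda>\<omega>. y \<omega> $ t) \<in> Lp M" if "y \<in> adapted \<F>" for t and y :: "'a \<Rightarrow> (real^'i, 't) vec"
    using that by (intro Lp_subalgebra[OF sub[of t]]) (simp add: adapted_iff)
  have nn_add: "nn (y + z) \<le> nn y + nn z" if "y \<in> ?U" "z \<in> ?U" for y z
    unfolding nn_def sum.distrib[symmetric] using that
    by (intro sum_mono) (simp add: lp_norm_triangle comp)
  have nm_add: "nm (y + z) \<le> nm y + nm z" if "y \<in> ?V" "z \<in> ?V" for y z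
    unfolding nm_def sum.distrib[symmetric] using that
    by (intro sum_mono) (simp add: lp_norm_triangle comp)
  have nn_scale: "nn (c *\<^sub>R y) = c * nn y" and nm_scale: "nm (c *\<^sub>R z) = c * nm z" if "c > 0" for c y z
    using that by (simp_all add: nn_def nm_def scaleR_fun_def lp_norm_scaleR sum_distrib_left)
  define S where "S = (\<lambda>(u, y, v). clarke u + N * (nm y + nn v))"
  have subS: "sublinear_on (?U \<times> ?V \<times> ?U) S"
    unfolding sublinear_on_def
  proof (intro conjI ballI allI impI)
    fix a b assume ab: "a \<in> ?U \<times> ?V \<times> ?U" "b \<in> ?U \<times> ?V \<times> ?U"
    obtain u y v u' y' v' where e: "a = (u, y, v)" "b = (u', y', v')" by (metis surj_pair)
    have "N * (nm (y + y') + nn (v + v')) \<le> N * ((nm y + nm y') + (nn v + nn v'))"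
      using ab e N nn_add nm_add by (intro mult_left_mono add_mono) auto
    moreover have "clarke (u + u') \<le> clarke u + clarke u'"
      using ab e by (intro \<phi>.clarke_subadditive) auto
    ultimately show "S (a + b) \<le> S a + S b" by (simp add: S_def e algebra_simps)
  next
    fix a and c :: real assume "a \<in> ?U \<times> ?V \<times> ?U" "c > 0"
    then show "S (c *\<^sub>R a) = c * S a"
      using sublinear_on_scale[OF \<phi>.clarke_sublinear] by (auto simp: S_def nn_scale nm_scale algebra_simps)
  qed
  define pt where "pt d y v = (d, (\<lambda>\<omega>. \<chi> t. lin xh t d \<omega> - y t \<omega>), (\<lambda>\<omega>. \<chi> t. d \<omega> $ t - v t \<omega>))"
    for d :: "'a \<Rightarrow> (real^'n, 't) vec" and y :: "'t \<Rightarrow> 'a \<Rightarrow> real^'m" and v :: "'t \<Rightarrow> 'a \<Rightarrow> real^'n"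
  \<comment> \<open>A convex cone, since \<open>pt\<close> is linear in all arguments and the feasible directions form cones.\<close>
  define Cn where "Cn = {pt d y v | d y v. d \<in> adapted \<F> \<and> (\<forall>t. y t \<in> dirY t) \<and> (\<forall>t. v t \<in> dirX t)}"
  have CnI: "pt d y v \<in> Cn" if "d \<in> adapted \<F>" "\<And>t. y t \<in> dirY t" "\<And>t. v t \<in> dirX t" for d y v
    using that unfolding Cn_def by blast
  have zY: "0 \<in> dirY t" and zX: "0 \<in> dirX t" for t
    by (intro feasible_directions_zero fh_Y xh_X)+
  have lin0: "lin xh t (\<lambda>\<omega>. 0) \<omega> = 0" for t \<omega> by (simp add: lin_def)
  have z0: "(\<lambda>\<omega>. 0) \<in> adapted \<F>" by (simp add: adapted_iff Lp_zero)
  obtain h where h: "linear_functional_on (?U \<times> ?V \<times> ?U) h"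
    and hS: "\<And>a. a \<in> ?U \<times> ?V \<times> ?U \<Longrightarrow> h a \<le> S a" and hC: "\<And>a. a \<in> Cn \<Longrightarrow> 0 \<le> h a"
  proof (rule hahn_banach_cone[OF subS, of Cn])
    show "subspace (?U \<times> ?V \<times> ?U)" by (intro subspace_Times SU SV)
    show "Cn \<subseteq> ?U \<times> ?V \<times> ?U"
    proof
      fix a assume "a \<in> Cn"
      then obtain d y v where a: "a = pt d y v" and d: "d \<in> adapted \<F>"
        and yv: "\<And>t. y t \<in> dirY t" "\<And>t. v t \<in> dirX t" unfolding Cn_def by blast
      have "(\<lambda>\<omega>. lin xh t d \<omega> - y t \<omega>) \<in> Lp (\<F> t)" "(\<lambda>\<omega>. d \<omega> $ t - v t \<omega>) \<in> Lp (\<F> t)" for t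
        using d yv[THEN feasible_directions_Lp] by (auto intro!: Lp_diff lin_Lp xh sub simp: adapted_iff)
      then show "a \<in> ?U \<times> ?V \<times> ?U" using d by (simp add: a pt_def adapted_iff)
    qed
    have "pt (\<lambda>\<omega>. 0) (\<lambda>t. 0) (\<lambda>t. 0) = 0"
      by (simp add: pt_def zero_prod_def fun_eq_iff vec_eq_iff lin0)
    then show "0 \<in> Cn" using CnI[of "\<lambda>\<omega>. 0" "\<lambda>t. 0" "\<lambda>t. 0", OF z0 zY zX] by simp
    show "a + b \<in> Cn" if ab: "a \<in> Cn" "b \<in> Cn" for a b
    proof -
      obtain d y v where a: "a = pt d y v" "d \<in> adapted \<F>" "\<And>t. y t \<in> dirY t" "\<And>t. v t \<in> dirX t"
        using ab(1) unfolding Cn_def by blast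
      obtain d' y' v' where b: "b = pt d' y' v'" "d' \<in> adapted \<F>" "\<And>t. y' t \<in> dirY t" "\<And>t. v' t \<in> dirX t"
        using ab(2) unfolding Cn_def by blast
      have "a + b = pt (d + d') (\<lambda>t. y t + y' t) (\<lambda>t. v t + v' t)"
        by (simp add: a b pt_def fun_eq_iff vec_eq_iff lin_add plus_fun_def)
      moreover have "pt (d + d') (\<lambda>t. y t + y' t) (\<lambda>t. v t + v' t) \<in> Cn"
        by (intro CnI subspace_add[OF SU] feasible_directions_add sub a b convex_Y convex_X)
      ultimately show ?thesis by simp
    qed
    show "c *\<^sub>R a \<in> Cn" if ac: "a \<in> Cn" "c > 0" for a and c :: real
    proof -
      obtain d y v where a: "a = pt d y v" "d \<in> adapted \<F>" "\<And>t. y t \<in> dirY t" "\<And>t. v t \<in> dirX t"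
        using ac(1) unfolding Cn_def by blast
      have "c *\<^sub>R a = pt (c *\<^sub>R d) (\<lambda>t. c *\<^sub>R y t) (\<lambda>t. c *\<^sub>R v t)"
        by (simp add: a pt_def fun_eq_iff vec_eq_iff lin_scaleR scaleR_fun_def right_diff_distrib)
      moreover have "pt (c *\<^sub>R d) (\<lambda>t. c *\<^sub>R y t) (\<lambda>t. c *\<^sub>R v t) \<in> Cn"
        by (intro CnI subspace_scale[OF SU] feasible_directions_scaleR ac a)
      ultimately show ?thesis by simp
    qed
    show "0 \<le> S a" if ac: "a \<in> Cn" for a
    proof -
      obtain d y v where a: "a = pt d y v" "d \<in> adapted \<F>" "\<And>t. y t \<in> dirY t" "\<And>t. v t \<in> dirX t"
        using ac unfolding Cn_def by blast
      show ?thesis using opt[OF a(2-4)] by (simp add: a(1) pt_def S_def nn_def nm_def sum.distrib)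
    qed
  qed blast
  have Z: "(0 :: 'a \<Rightarrow> (real^'n, 't) vec) \<in> ?U" "(0 :: 'a \<Rightarrow> (real^'m, 't) vec) \<in> ?V"
    using SU SV by (auto intro: subspace_0)
  define hg where "hg u = h (u, 0, 0)" for u
  define h\<psi> where "h\<psi> y = h (0, y, 0)" for y
  define h\<nu> where "h\<nu> v = h (0, 0, v)" for v
  have split: "h (u, y, v) = hg u + h\<psi> y + h\<nu> v" if "u \<in> ?U" "y \<in> ?V" "v \<in> ?U" for u y v
    using linear_functional_on_add[OF h, of "(u, 0, 0)" "(0, y, v)"]
      linear_functional_on_add[OF h, of "(0, y, 0)" "(0, 0, v)"] that Z
    by (simp add: hg_def h\<psi>_def h\<nu>_def)
  have lg: "linear_functional_on ?U hg"
    unfolding linear_functional_on_def hg_def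
    using linear_functional_on_add[OF h, of "(_, 0, 0)" "(_, 0, 0)"]
      linear_functional_on_scale[OF h, of "(_, 0, 0)"] Z by auto
  have l\<psi>: "linear_functional_on ?V h\<psi>"
    unfolding linear_functional_on_def h\<psi>_def
    using linear_functional_on_add[OF h, of "(0, _, 0)" "(0, _, 0)"]
      linear_functional_on_scale[OF h, of "(0, _, 0)"] Z by auto
  have l\<nu>: "linear_functional_on ?U h\<nu>"
    unfolding linear_functional_on_def h\<nu>_def
    using linear_functional_on_add[OF h, of "(0, 0, _)" "(0, 0, _)"]
      linear_functional_on_scale[OF h, of "(0, 0, _)"] Z by auto
  have c0: "clarke 0 = 0" by (rule sublinear_on_zero[OF \<phi>.clarke_sublinear SU])
  have n0: "nn 0 = 0" "nm 0 = 0" by (simp_all add: nn_def nm_def lp_norm_zero)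
  have ug: "hg u \<le> clarke u" if "u \<in> ?U" for u
    using hS[of "(u, 0, 0)"] that Z by (simp add: S_def hg_def n0)
  have u\<psi>: "h\<psi> y \<le> N * nm y" if "y \<in> ?V" for y
    using hS[of "(0, y, 0)"] that Z by (simp add: S_def h\<psi>_def n0 c0)
  have u\<nu>: "h\<nu> v \<le> N * nn v" if "v \<in> ?U" for v
    using hS[of "(0, 0, v)"] that Z by (simp add: S_def h\<nu>_def n0 c0)
  have emb_neg: "- embed t u = embed t (- u)" for t and u :: "'a \<Rightarrow> real^'i"
    by (simp add: fun_eq_iff vec_eq_iff embed_component)
  have nrm_neg: "nrm (- u) = nrm u" for u :: "'a \<Rightarrow> real^'i"
    by (simp add: lp_norm_def)
  have nn_embed: "nn (embed t u) = nrm u" for t u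
  proof -
    have "nrm (\<lambda>\<omega>. embed t u \<omega> $ s) = (if s = t then nrm u else 0)" for s
      by (simp add: embed_component lp_norm_zero)
    then show ?thesis by (simp add: nn_def)
  qed
  have nm_embed: "nm (embed t u) = nrm u" for t u
  proof -
    have "nrm (\<lambda>\<omega>. embed t u \<omega> $ s) = (if s = t then nrm u else 0)" for s
      by (simp add: embed_component lp_norm_zero)
    then show ?thesis by (simp add: nm_def)
  qed
  have two_sided: "\<bar>k (embed t u)\<bar> \<le> C * nrm u"
    if k: "linear_functional_on (adapted \<F>) k" "\<And>t u. u \<in> Lp (\<F> t) \<Longrightarrow> k (embed t u) \<le> C * nrm u"
      and u: "u \<in> Lp (\<F> t)" for k :: "('a \<Rightarrow> (real^'i, 't) vec) \<Rightarrow> real" and C t u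
  proof -
    have "- u \<in> Lp (\<F> t)" using subspace_neg[OF subspace_Lp[OF sub] u] .
    then have "k (embed t (- u)) \<le> C * nrm u" using k(2)[of "- u" t] by (simp add: nrm_neg)
    moreover have "k (embed t (- u)) = - k (embed t u)"
      using linear_functional_on_neg[OF k(1) embed_adapted[where \<F> = \<F>, OF u]] by (simp add: emb_neg)
    ultimately show ?thesis using k(2)[OF u] by (simp add: abs_le_iff)
  qed
  obtain g where g: "\<And>t. g t \<in> lp_space q M (\<F> t)"
    "\<And>t u. u \<in> Lp (\<F> t) \<Longrightarrow> integrable M (\<lambda>\<omega>. g t \<omega> \<bullet> u \<omega>)"
    "\<And>t u. u \<in> Lp (\<F> t) \<Longrightarrow> hg (embed t u) = pairing M (g t) u"
    "\<And>d. d \<in> adapted \<F> \<Longrightarrow> hg d = (\<Sum>t\<in>UNIV. pairing M (g t) (\<lambda>\<omega>. d \<omega> $ t))"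
  proof (rule adapted_functional_representation[where \<F> = \<F>, OF sub conjugate lg \<phi>.L])
    have "hg (embed t u) \<le> L * nrm u" if "u \<in> Lp (\<F> t)" for t u
      using ug[OF embed_adapted[where \<F> = \<F>, OF that]] \<phi>.clarke_upper_bound[OF embed_adapted[where \<F> = \<F>, OF that]]
      by (simp add: lp_norm_embed)
    from two_sided[OF lg this] show "\<bar>hg (embed t u)\<bar> \<le> L * nrm u" if "u \<in> Lp (\<F> t)" for t u using that by blast
  qed blast
  obtain \<psi> where \<psi>: "\<And>t. \<psi> t \<in> lp_space q M (\<F> t)"
    "\<And>t u. u \<in> Lp (\<F> t) \<Longrightarrow> h\<psi> (embed t u) = pairing M (\<psi> t) u"
    "\<And>d. d \<in> adapted \<F> \<Longrightarrow> h\<psi> d = (\<Sum>t\<in>UNIV. pairing M (\<psi> t) (\<lambda>\<omega>. d \<omega> $ t))"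
  proof (rule adapted_functional_representation[where \<F> = \<F>, OF sub conjugate l\<psi> N])
    have "h\<psi> (embed t u) \<le> N * nrm u" if "u \<in> Lp (\<F> t)" for t u
      using u\<psi>[OF embed_adapted[where \<F> = \<F>, OF that]] by (simp add: nm_embed)
    from two_sided[OF l\<psi> this] show "\<bar>h\<psi> (embed t u)\<bar> \<le> N * nrm u" if "u \<in> Lp (\<F> t)" for t u using that by blast
  qed blast
  obtain \<nu> where \<nu>: "\<And>t. \<nu> t \<in> lp_space q M (\<F> t)"
    "\<And>t u. u \<in> Lp (\<F> t) \<Longrightarrow> h\<nu> (embed t u) = pairing M (\<nu> t) u"
  proof (rule adapted_functional_representation[where \<F> = \<F>, OF sub conjugate l\<nu> N])
    have "h\<nu> (embed t u) \<le> N * nrm u" if "u \<in> Lp (\<F> t)" for t u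
      using u\<nu>[OF embed_adapted[where \<F> = \<F>, OF that]] by (simp add: nn_embed)
    from two_sided[OF l\<nu> this] show "\<bar>h\<nu> (embed t u)\<bar> \<le> N * nrm u" if "u \<in> Lp (\<F> t)" for t u using that by blast
  qed blast
  define A where "A d = (\<lambda>\<omega>. \<chi> t. lin xh t d \<omega>)" for d
  have AV: "A d \<in> ?V" if "d \<in> ?U" for d
    using lin_Lp[OF xh that] by (simp add: A_def adapted_iff)
  have line: "hg d + h\<psi> (A d) + h\<nu> d \<ge> 0" if d: "d \<in> ?U" for d
  proof -
    have "pt d (\<lambda>t. 0) (\<lambda>t. 0) = (d, A d, d)" by (simp add: pt_def A_def fun_eq_iff vec_eq_iff)
    then have "0 \<le> h (d, A d, d)" using hC[OF CnI[of d "\<lambda>t. 0" "\<lambda>t. 0", OF d zY zX]] by simp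
    then show ?thesis using split[OF d AV[OF d] d] by simp
  qed
  have stationary: "hg d + h\<psi> (A d) + h\<nu> d = 0" if d: "d \<in> ?U" for d
  proof -
    have d': "- d \<in> ?U" using SU d by (rule subspace_neg)
    have "A (- d) = - A d"
      using lin_scaleR[of xh _ "-1" d] by (simp add: A_def fun_eq_iff vec_eq_iff fun_Compl_def)
    then have "hg (- d) + h\<psi> (A (- d)) + h\<nu> (- d) = - (hg d + h\<psi> (A d) + h\<nu> d)"
      using linear_functional_on_neg[OF lg d] linear_functional_on_neg[OF l\<nu> d]
        linear_functional_on_neg[OF l\<psi> AV[OF d]] by simp
    then show ?thesis using line[OF d] line[OF d'] by simp
  qed
  show ?thesis
  proof (rule that[of g \<psi> \<nu>])
    fix d :: "'a \<Rightarrow> (real^'n, 't) vec" assume d: "d \<in> adapted \<F>"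
    show "(\<Sum>t\<in>UNIV. pairing M (g t) (\<lambda>\<omega>. d \<omega> $ t)) \<le> clarke d" using ug[OF d] g(4)[OF d] by simp
  next
    fix t and y :: "'a \<Rightarrow> real^'m" assume y: "y \<in> dirY t"
    have yL: "y \<in> Lp (\<F> t)" using y by (rule feasible_directions_Lp)
    have eY: "embed t y \<in> ?V" using yL by (rule embed_adapted)
    have "pt (\<lambda>\<omega>. 0) (\<lambda>s. if s = t then y else 0) (\<lambda>t. 0) = (0, - embed t y, 0)"
      by (auto simp: pt_def fun_eq_iff vec_eq_iff lin0 embed_component)
    moreover have "pt (\<lambda>\<omega>. 0) (\<lambda>s. if s = t then y else 0) (\<lambda>t. 0) \<in> Cn"
      using y zY zX z0 by (intro CnI) auto
    ultimately have "0 \<le> h\<psi> (- embed t y)" using hC by (simp add: h\<psi>_def)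
    then show "pairing M (\<psi> t) y \<le> 0" using linear_functional_on_neg[OF l\<psi> eY] \<psi>(2)[OF yL] by simp
  next
    fix t and v :: "'a \<Rightarrow> real^'n" assume v: "v \<in> dirX t"
    have vL: "v \<in> Lp (\<F> t)" using v by (rule feasible_directions_Lp)
    have eX: "embed t v \<in> ?U" using vL by (rule embed_adapted)
    have "pt (\<lambda>\<omega>. 0) (\<lambda>t. 0) (\<lambda>s. if s = t then v else 0) = (0, 0, - embed t v)"
      by (auto simp: pt_def fun_eq_iff vec_eq_iff lin0 embed_component)
    moreover have "pt (\<lambda>\<omega>. 0) (\<lambda>t. 0) (\<lambda>s. if s = t then v else 0) \<in> Cn"
      using v zY zX z0 by (intro CnI) auto
    ultimately have "0 \<le> h\<nu> (- embed t v)" using hC by (simp add: h\<nu>_def)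
    then show "pairing M (\<nu> t) v \<le> 0" using linear_functional_on_neg[OF l\<nu> eX] \<nu>(2)[OF vL] by simp
  next
    fix t and u :: "'a \<Rightarrow> real^'n" assume u: "u \<in> Lp (\<F> t)"
    have e: "embed t u \<in> ?U" using u by (rule embed_adapted)
    have "h\<psi> (A (embed t u)) = (\<Sum>l\<in>UNIV. pairing M (\<psi> l) (lin xh l (embed t u)))"
      using \<psi>(3)[OF AV[OF e]] by (simp add: A_def)
    then show "pairing M (g t) u + (\<Sum>l\<in>UNIV. pairing M (\<psi> l) (lin xh l (embed t u))) + pairing M (\<nu> t) u = 0"
      using stationary[OF e] g(3)[OF u] \<nu>(2)[OF u] by simp
  qed (use g \<psi> \<nu> in auto)
qed

text \<open>Test stationarity in the directions \<open>1\<^sub>B e\<^sub>j\<close> at stage \<open>t\<close>, for events \<open>B\<close> observable at \<open>t\<close>. Stages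
  before \<open>t\<close> do not react, by causality; \<open>g\<close>, \<open>\<nu>\<close> and the contribution of stage \<open>t\<close> itself are observable
  at \<open>t\<close>. The later contributions are not, so the equation determines their conditional expectation.\<close>

lemma adjoint_equation_component:
  assumes g: "g \<in> lp_space q M (\<F> t)" and \<psi>: "\<And>l. \<psi> l \<in> lp_space q M (\<F> l)"
    and \<nu>: "\<nu> \<in> lp_space q M (\<F> t)"
    and stationary: "\<And>u. u \<in> Lp (\<F> t) \<Longrightarrow> pairing M g u
       + (\<Sum>l\<in>UNIV. pairing M (\<psi> l) (lin xh l (embed t u))) + pairing M \<nu> u = 0"
  shows "AE \<omega> in M. real_cond_exp (completion M) (\<F> t)
      (\<lambda>\<omega>. (\<Sum>l | t < l. transpose (partial_jacobian f xh l t \<omega>) *v \<psi> l \<omega>) $ j) \<omega>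
    = - (g \<omega> $ j + (transpose (jac xh t t \<omega>) *v \<psi> t \<omega>) $ j + \<nu> \<omega> $ j)"
proof -
  define H where "H l \<omega> = (transpose (jac xh l t \<omega>) *v \<psi> l \<omega>) $ j" for l \<omega>
  have Hint: "integrable M (H l)" for l unfolding H_def by (rule transpose_jac_integrable[OF \<psi>])
  have gint: "integrable M (\<lambda>\<omega>. g \<omega> $ j)" and \<nu>int: "integrable M (\<lambda>\<omega>. \<nu> \<omega> $ j)"
    using g \<nu> by (auto intro: Lq_component_integrable)
  have H0: "H l \<omega> = 0" if "l < t" "\<omega> \<in> space M" for l \<omega>
    using jac_causal[OF that, of xh] by (simp add: H_def vector_matrix_mult_def)
  show ?thesis
  proof (rule real_cond_exp_completion[OF prob_space_axioms sub])
    show "AE \<omega> in M. (\<Sum>l | t < l. transpose (partial_jacobian f xh l t \<omega>) *v \<psi> l \<omega>) $ j = (\<Sum>l | t < l. H l \<omega>)"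
      using AE_jac[of xh]
    proof eventually_elim
      case (elim \<omega>)
      then have "partial_jacobian f xh l t \<omega> = jac xh l t \<omega>" for l by metis
      then show ?case by (simp add: H_def sum_component)
    qed
    show "integrable M (\<lambda>\<omega>. \<Sum>l | t < l. H l \<omega>)" by (intro Bochner_Integration.integrable_sum Hint)
    have "integrable M (\<lambda>\<omega>. - (g \<omega> $ j + H t \<omega> + \<nu> \<omega> $ j))"
      by (intro Bochner_Integration.integrable_minus Bochner_Integration.integrable_add gint Hint \<nu>int)
    then show "integrable M (\<lambda>\<omega>. - (g \<omega> $ j + (transpose (jac xh t t \<omega>) *v \<psi> t \<omega>) $ j + \<nu> \<omega> $ j))"
      by (simp only: H_def)
    show "(\<lambda>\<omega>. - (g \<omega> $ j + (transpose (jac xh t t \<omega>) *v \<psi> t \<omega>) $ j + \<nu> \<omega> $ j)) \<in> borel_measurable (\<F> t)"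
      by (intro borel_measurable_uminus borel_measurable_add transpose_jac_measurable \<psi>
          borel_measurable_component Lq_measurable g \<nu>)
    fix B assume B: "B \<in> sets (\<F> t)"
    then have [measurable]: "B \<in> sets M" using sub[of t] by (auto simp: subalgebra_def)
    define u where "u \<omega> = (indicator B \<omega> :: real) *\<^sub>R (axis j 1 :: real^'n)" for \<omega>
    have u: "u \<in> Lp (\<F> t)"
    proof (rule Lp_dominated[OF sub _ Lp_const[of "1::real" "\<F> t"]])
      show "u \<in> borel_measurable (\<F> t)"
        unfolding u_def using B by (intro borel_measurable_scaleR borel_measurable_indicator borel_measurable_const)
      show "AE \<omega> in M. norm (u \<omega>) \<le> norm (1::real)" by (simp add: u_def norm_axis indicator_def)
    qed
    have ind: "integrable M (\<lambda>\<omega>. indicator B \<omega> * k \<omega>)" if "integrable M k" for k :: "'a \<Rightarrow> real"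
      using integrable_mult_indicator[OF \<open>B \<in> sets M\<close> that] by simp
    have 1: "pairing M g u = (\<integral>\<omega>. indicator B \<omega> * g \<omega> $ j \<partial>M)" "pairing M \<nu> u = (\<integral>\<omega>. indicator B \<omega> * \<nu> \<omega> $ j \<partial>M)"
      by (simp_all add: pairing_def u_def inner_axis)
    have 2: "pairing M (\<psi> l) (lin xh l (embed t u)) = (\<integral>\<omega>. indicator B \<omega> * H l \<omega> \<partial>M)" for l
      unfolding pairing_def u_def H_def inner_lin_embed ..
    have "(\<Sum>l\<in>UNIV. \<integral>\<omega>. indicator B \<omega> * H l \<omega> \<partial>M) = (\<Sum>l\<in>insert t {l. t < l}. \<integral>\<omega>. indicator B \<omega> * H l \<omega> \<partial>M)"
    proof (rule sum.mono_neutral_right)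
      show "\<forall>l\<in>UNIV - insert t {l. t < l}. (\<integral>\<omega>. indicator B \<omega> * H l \<omega> \<partial>M) = 0"
      proof
        fix l assume "l \<in> UNIV - insert t {l. t < l}"
        then have "l < t" by auto
        then have "(\<integral>\<omega>. indicator B \<omega> * H l \<omega> \<partial>M) = (\<integral>\<omega>. 0 \<partial>M)"
          by (intro Bochner_Integration.integral_cong) (auto simp: H0)
        then show "(\<integral>\<omega>. indicator B \<omega> * H l \<omega> \<partial>M) = 0" by simp
      qed
    qed auto
    also have "\<dots> = (\<integral>\<omega>. indicator B \<omega> * H t \<omega> \<partial>M) + (\<Sum>l | t < l. \<integral>\<omega>. indicator B \<omega> * H l \<omega> \<partial>M)"
      by simp
    also have "(\<Sum>l | t < l. \<integral>\<omega>. indicator B \<omega> * H l \<omega> \<partial>M) = (\<integral>\<omega>. indicator B \<omega> * (\<Sum>l | t < l. H l \<omega>) \<partial>M)"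
      unfolding sum_distrib_left by (rule Bochner_Integration.integral_sum[symmetric]) (rule ind[OF Hint])
    finally have "(\<integral>\<omega>. indicator B \<omega> * (\<Sum>l | t < l. H l \<omega>) \<partial>M)
        = - ((\<integral>\<omega>. indicator B \<omega> * g \<omega> $ j \<partial>M) + (\<integral>\<omega>. indicator B \<omega> * H t \<omega> \<partial>M) + (\<integral>\<omega>. indicator B \<omega> * \<nu> \<omega> $ j \<partial>M))"
      using stationary[OF u] unfolding 1 2 by linarith
    also have "\<dots> = (\<integral>\<omega>. indicator B \<omega> * - (g \<omega> $ j + H t \<omega> + \<nu> \<omega> $ j) \<partial>M)"
    proof -
      have e: "(\<lambda>\<omega>. indicator B \<omega> * - (g \<omega> $ j + H t \<omega> + \<nu> \<omega> $ j))
          = (\<lambda>\<omega>. - (indicator B \<omega> * g \<omega> $ j + indicator B \<omega> * H t \<omega> + indicator B \<omega> * \<nu> \<omega> $ j))"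
        by (simp add: fun_eq_iff algebra_simps)
      show ?thesis unfolding e using ind[OF gint] ind[OF Hint[of t]] ind[OF \<nu>int] by simp
    qed
    finally show "(\<integral>\<omega>. indicator B \<omega> * (\<Sum>l | t < l. H l \<omega>) \<partial>M)
        = (\<integral>\<omega>. indicator B \<omega> * - (g \<omega> $ j + (transpose (jac xh t t \<omega>) *v \<psi> t \<omega>) $ j + \<nu> \<omega> $ j) \<partial>M)"
      by (simp only: H_def)
  qed
qed

lemma adjoint_equation:
  assumes g: "\<And>t. g t \<in> lp_space q M (\<F> t)" and \<psi>: "\<And>t. \<psi> t \<in> lp_space q M (\<F> t)"
    and \<nu>: "\<And>t. \<nu> t \<in> lp_space q M (\<F> t)"
    and stationary: "\<And>t u. u \<in> Lp (\<F> t) \<Longrightarrow> pairing M (g t) u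
       + (\<Sum>l\<in>UNIV. pairing M (\<psi> l) (lin xh l (embed t u))) + pairing M (\<nu> t) u = 0"
  shows "AE \<omega> in M. \<forall>t. g t \<omega> + transpose (partial_jacobian f xh t t \<omega>) *v \<psi> t \<omega>
      + vec_cond_exp M (\<F> t) (\<lambda>\<omega>'. \<Sum>l | t < l. transpose (partial_jacobian f xh l t \<omega>') *v \<psi> l \<omega>') \<omega>
      + \<nu> t \<omega> = 0"
proof (rule AE_all_stages)
  fix t
  have "AE \<omega> in M. \<forall>j. real_cond_exp (completion M) (\<F> t)
      (\<lambda>\<omega>. (\<Sum>l | t < l. transpose (partial_jacobian f xh l t \<omega>) *v \<psi> l \<omega>) $ j) \<omega>
    = - (g t \<omega> $ j + (transpose (jac xh t t \<omega>) *v \<psi> t \<omega>) $ j + \<nu> t \<omega> $ j)"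
    by (rule eventually_all_finite) (rule adjoint_equation_component[OF g \<psi> \<nu> stationary])
  with AE_jac[of xh]
  show "AE \<omega> in M. g t \<omega> + transpose (partial_jacobian f xh t t \<omega>) *v \<psi> t \<omega>
      + vec_cond_exp M (\<F> t) (\<lambda>\<omega>'. \<Sum>l | t < l. transpose (partial_jacobian f xh l t \<omega>') *v \<psi> l \<omega>') \<omega>
      + \<nu> t \<omega> = 0"
  proof eventually_elim
    case (elim \<omega>)
    have eq: "jac xh t t \<omega> = partial_jacobian f xh t t \<omega>" using elim(1) by metis
    from elim(2)[unfolded eq] show ?case by (simp add: vec_eq_iff vec_cond_exp_def)
  qed
qed

text \<open>The base point may be changed on a null set: the values of the causal operator agree with the
  superposition with \<open>f t\<close> almost surely only.\<close>

lemma normal_cone_of_feasible_directions: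
  fixes S :: "'t \<Rightarrow> 'a \<Rightarrow> (real^'i) set"
  assumes w: "w \<in> lp_space q M (\<F> t)" and a: "a \<in> Lp (\<F> t)"
    and le: "\<And>y. y \<in> feasible_directions (\<F> t) (S t) a \<Longrightarrow> pairing M w y \<le> 0"
    and b: "b \<in> borel_measurable M" and eq: "AE \<omega> in M. b \<omega> = a \<omega>"
  shows "w \<in> normal_cone (ennreal p) q M (\<F> t) (S t) b"
  unfolding normal_cone_def
proof (intro CollectI conjI ballI w)
  fix z assume z: "z \<in> selections S t"
  have [measurable]: "w \<in> borel_measurable M" "a \<in> borel_measurable M" "z \<in> borel_measurable M" "b \<in> borel_measurable M"
    using measurable_from_subalg[OF sub Lq_measurable[OF w]] Lp_measurable[OF Lp_subalgebra[OF sub a]] b z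
      Lp_measurable[OF Lp_subalgebra[OF sub, of z t]] by (auto simp: lp_selections_def)
  have "pairing M w (\<lambda>\<omega>. z \<omega> - b \<omega>) = pairing M w (\<lambda>\<omega>. z \<omega> - a \<omega>)"
    unfolding pairing_def
  proof (rule integral_cong_AE)
    show "AE \<omega> in M. w \<omega> \<bullet> (z \<omega> - b \<omega>) = w \<omega> \<bullet> (z \<omega> - a \<omega>)" using eq by eventually_elim simp
  qed measurable
  also have "\<dots> \<le> 0" by (intro le feasible_directions_selection sub a z)
  finally show "pairing M w (\<lambda>\<omega>. z \<omega> - b \<omega>) \<le> 0" .
qed

theorem optimality_conditions:
  "\<exists>g \<psi> \<nu>.
    g \<in> clarke_subdifferential p q M \<F> \<phi> xh \<and>
    (\<forall>t. \<psi> t \<in> normal_cone (ennreal p) q M (\<F> t) (Y t) (\<lambda>\<omega>. F xh \<omega> $ t)) \<and>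
    (\<forall>t. \<nu> t \<in> normal_cone (ennreal p) q M (\<F> t) (X t) (\<lambda>\<omega>. xh \<omega> $ t)) \<and>
    (AE \<omega> in M. \<forall>t.
       g \<omega> $ t
       + transpose (partial_jacobian f xh t t \<omega>) *v \<psi> t \<omega>
       + vec_cond_exp M (\<F> t)
           (\<lambda>\<omega>'. \<Sum>l | t < l. transpose (partial_jacobian f xh l t \<omega>') *v \<psi> l \<omega>') \<omega>
       + \<nu> t \<omega> = 0)"
proof -
  obtain g \<psi> \<nu> where g: "\<And>t. g t \<in> lp_space q M (\<F> t)"
    and \<psi>: "\<And>t. \<psi> t \<in> lp_space q M (\<F> t)" and \<nu>: "\<And>t. \<nu> t \<in> lp_space q M (\<F> t)"
    and gint: "\<And>t u. u \<in> Lp (\<F> t) \<Longrightarrow> integrable M (\<lambda>\<omega>. g t \<omega> \<bullet> u \<omega>)"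
    and gle: "\<And>d. d \<in> adapted \<F> \<Longrightarrow> (\<Sum>t\<in>UNIV. pairing M (g t) (\<lambda>\<omega>. d \<omega> $ t)) \<le> clarke d"
    and \<psi>le: "\<And>t y. y \<in> dirY t \<Longrightarrow> pairing M (\<psi> t) y \<le> 0"
    and \<nu>le: "\<And>t v. v \<in> dirX t \<Longrightarrow> pairing M (\<nu> t) v \<le> 0"
    and stationary: "\<And>t u. u \<in> Lp (\<F> t) \<Longrightarrow> pairing M (g t) u
       + (\<Sum>l\<in>UNIV. pairing M (\<psi> l) (lin xh l (embed t u))) + pairing M (\<nu> t) u = 0"
    by (rule multiplier_rule) blast
  obtain L where "lipschitz_functional M p \<F> \<phi> xh L" by (rule lipschitz_constant)
  then interpret \<phi>: lipschitz_functional M p \<F> \<phi> xh L .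
  define G where "G \<omega> = (\<chi> t. g t \<omega>)" for \<omega>
  have "G \<in> clarke_subdifferential p q M \<F> \<phi> xh"
    unfolding clarke_subdifferential_def
  proof (intro CollectI conjI ballI)
    show "G \<in> adapted_lp q M \<F>" using g by (simp add: adapted_lp_def G_def)
    fix d :: "'a \<Rightarrow> (real^'n, 't) vec" assume d: "d \<in> adapted \<F>"
    have "pairing M G d = (\<integral>\<omega>. (\<Sum>t\<in>UNIV. g t \<omega> \<bullet> (d \<omega> $ t)) \<partial>M)"
      by (simp add: pairing_def G_def inner_vec_def)
    also have "\<dots> = (\<Sum>t\<in>UNIV. pairing M (g t) (\<lambda>\<omega>. d \<omega> $ t))"
      unfolding pairing_def using d gint by (intro Bochner_Integration.integral_sum) (simp add: adapted_iff)
    also have "\<dots> \<le> clarke d" by (rule gle[OF d])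
    finally show "ereal (pairing M G d) \<le> clarke_derivative p M \<F> \<phi> xh d"
      using \<phi>.clarke_real[OF d] by (metis ereal_less_eq(3))
  qed
  moreover have "\<psi> t \<in> normal_cone (ennreal p) q M (\<F> t) (Y t) (\<lambda>\<omega>. F xh \<omega> $ t)" for t
  proof (rule normal_cone_of_feasible_directions[OF \<psi> f_Lp[OF xh] \<psi>le _ AE_F[OF xh]])
    have "(\<lambda>\<omega>. F xh \<omega> $ t) \<in> Lp (\<F> t)" using F_adapted[OF xh] by (simp add: adapted_iff)
    then show "(\<lambda>\<omega>. F xh \<omega> $ t) \<in> borel_measurable M" by (intro Lp_measurable Lp_subalgebra[OF sub])
  qed
  moreover have "\<nu> t \<in> normal_cone (ennreal p) q M (\<F> t) (X t) (\<lambda>\<omega>. xh \<omega> $ t)" for t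
    by (rule normal_cone_of_feasible_directions[OF \<nu> xh_Lp \<nu>le Lp_measurable[OF Lp_subalgebra[OF sub xh_Lp]]]) auto
  moreover have "AE \<omega> in M. \<forall>t. G \<omega> $ t + transpose (partial_jacobian f xh t t \<omega>) *v \<psi> t \<omega>
      + vec_cond_exp M (\<F> t) (\<lambda>\<omega>'. \<Sum>l | t < l. transpose (partial_jacobian f xh l t \<omega>') *v \<psi> l \<omega>') \<omega>
      + \<nu> t \<omega> = 0"
    using adjoint_equation[OF g \<psi> \<nu> stationary] by (simp only: G_def vec_lambda_beta)
  ultimately show ?thesis by blast
qed

end

theorem theorem4p3:
  fixes M :: "'a measure"
    and \<F> :: "'t::{finite,linorder} \<Rightarrow> 'a measure"
    and p :: real and q :: ennreal
    and f :: "'t \<Rightarrow> (real^'n, 't) vec \<Rightarrow> 'a \<Rightarrow> real^'m"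
    and f' :: "'t \<Rightarrow> (real^'n, 't) vec \<Rightarrow> 'a \<Rightarrow> (real^'n, 't) vec \<Rightarrow>\<^sub>L (real^'m)"
    and F :: "('a \<Rightarrow> (real^'n, 't) vec) \<Rightarrow> ('a \<Rightarrow> (real^'m, 't) vec)"
    and Y :: "'t \<Rightarrow> 'a \<Rightarrow> (real^'m) set"
    and X :: "'t \<Rightarrow> 'a \<Rightarrow> (real^'n) set"
    and \<phi> :: "('a \<Rightarrow> (real^'n, 't) vec) \<Rightarrow> real"
    and xh :: "'a \<Rightarrow> (real^'n, 't) vec"
  assumes prob: "prob_space M"
    and sub: "\<And>t. subalgebra M (\<F> t)"
    and mono: "\<And>s t. s \<le> t \<Longrightarrow> sets (\<F> s) \<subseteq> sets (\<F> t)"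
    and first: "sets (\<F> (Min UNIV)) = {{}, space M}"
    and last: "sets (\<F> (Max UNIV)) = sets M"
    and p: "1 \<le> p"
    and q: "1 / ennreal p + 1 / q = 1"
    and causal: "causal_operator (ennreal p) M \<F> f F"
    and smooth: "smooth_bounded_jacobian (ennreal p) M \<F> f f'"
    and Y: "\<And>t. measurable_multifunction (\<F> t) (Y t)"
           "\<And>t \<omega>. \<omega> \<in> space M \<Longrightarrow> convex (Y t \<omega>) \<and> closed (Y t \<omega>)"
    and X: "\<And>t. measurable_multifunction (\<F> t) (X t)"
           "\<And>t \<omega>. \<omega> \<in> space M \<Longrightarrow> convex (X t \<omega>) \<and> closed (X t \<omega>)"
    and lipschitz: "lp_lipschitz p M \<F> \<phi>"
    and recourse: "complete_subregular_recourse M f Y X"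
    and local_min: "lp_local_minimum p M \<phi> (feasible_policies (ennreal p) M \<F> F Y X) xh"
  shows "\<exists>g \<psi> \<nu>.
    g \<in> clarke_subdifferential p q M \<F> \<phi> xh \<and>
    (\<forall>t. \<psi> t \<in> normal_cone (ennreal p) q M (\<F> t) (Y t) (\<lambda>\<omega>. F xh \<omega> $ t)) \<and>
    (\<forall>t. \<nu> t \<in> normal_cone (ennreal p) q M (\<F> t) (X t) (\<lambda>\<omega>. xh \<omega> $ t)) \<and>
    (AE \<omega> in M. \<forall>t.
       g \<omega> $ t
       + transpose (partial_jacobian f xh t t \<omega>) *v \<psi> t \<omega>
       + vec_cond_exp M (\<F> t)
           (\<lambda>\<omega>'. \<Sum>l | t < l. transpose (partial_jacobian f xh l t \<omega>') *v \<psi> l \<omega>') \<omega>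
       + \<nu> t \<omega> = 0)"
proof -
  interpret prob_space M by (rule prob)
  interpret optimal_policy M p \<F> f f' F Y X \<phi> xh q
    by (unfold_locales; fact assms)
  show ?thesis by (rule optimality_conditions)
qed

end
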